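(* Let $G$ be any outerplanar graph with $V(G)=\{x,y,v_1,\dots,v_n\}$ (where $x,y,v_1,\dots,v_n$ are pairwise distinct). Then in the graph polynomial $P(G)$ there is a non-vanishing monomial of the form $\eta\, x^{\beta}y^{\gamma}\prod_{i=1}^n v_i^{\alpha_i}$ with $\alpha_i\le 2$ for all $i$ and $\beta,\gamma\le 1$, satisfying: (1) $\beta=\gamma=1$ when every proper $3$-colouring $C$ of $G$ satisfies $C(x)=C(y)$; (2) $\beta+\gamma=1$ when every proper $3$-colouring $C$ of $G$ satisfies $C(x)\neq C(y)$; (3) $\beta=\gamma=0$ otherwise.
   Context: All graphs are simple, undirected and finite. A graph is outerplanar if it can be drawn in the plane without crossings with all vertices on the outer face. The graph polynomial of $G$ is $P(G)=\prod_{uv\in E(G),\,u<v}(u-v)$, a polynomial with integer coefficients whose variables are the vertices of $G$, where $<$ fixes an arbitrary orientation of the edges; changing the orientation only changes the sign of $P(G)$. A monomial is non-vanishing in $P(G)$ if its coefficient $\eta$ in the expanded polynomial $P(G)$ is non-zero. A proper $3$-colouring is a map $C:V(G)\to\{1,2,3\}$ giving different values to adjacent vertices. *)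

theory Defs
  imports "HOL-Analysis.Analysis" "HOL-Library.Poly_Mapping"
begin

definition simple_graph :: "'a set \<Rightarrow> 'a set set \<Rightarrow> bool" where
  "simple_graph V E \<longleftrightarrow> finite V \<and> (\<forall>e\<in>E. e \<subseteq> V \<and> card e = 2)"

text \<open>Topological drawings in the plane: a vertex \<open>v\<close> is the point \<open>pos v\<close> and an edge \<open>e\<close> is
  the arc \<open>crv e\<close>.\<close>

definition plane_drawing ::
  "'a set \<Rightarrow> 'a set set \<Rightarrow> ('a \<Rightarrow> complex) \<Rightarrow> ('a set \<Rightarrow> real \<Rightarrow> complex) \<Rightarrow> bool" where
  "plane_drawing V E pos crv \<longleftrightarrow>
     inj_on pos V \<and>
     (\<forall>e\<in>E. arc (crv e) \<and> {pathstart (crv e), pathfinish (crv e)} = pos ` e \<and>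
            path_image (crv e) \<inter> pos ` V = pos ` e) \<and>
     (\<forall>e\<in>E. \<forall>f\<in>E. e \<noteq> f \<longrightarrow> path_image (crv e) \<inter> path_image (crv f) \<subseteq> pos ` (e \<inter> f))"

definition drawing_set ::
  "'a set \<Rightarrow> 'a set set \<Rightarrow> ('a \<Rightarrow> complex) \<Rightarrow> ('a set \<Rightarrow> real \<Rightarrow> complex) \<Rightarrow> complex set" where
  "drawing_set V E pos crv = pos ` V \<union> (\<Union>e\<in>E. path_image (crv e))"

text \<open>The drawing of a finite graph is compact, so its complement has exactly one unbounded
  component, which is \<^const>\<open>outside\<close> of the drawing: this is the outer face. A vertex is on
  a face if its point lies on the boundary of that face.\<close>

definition outerplanar :: "'a set \<Rightarrow> 'a set set \<Rightarrow> bool" where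
  "outerplanar V E \<longleftrightarrow>
     (\<exists>pos crv. plane_drawing V E pos crv \<and>
        (\<forall>v\<in>V. pos v \<in> frontier (outside (drawing_set V E pos crv))))"

text \<open>An orientation of the edge set \<open>E\<close> picks exactly one of the ordered pairs \<open>(u, v)\<close>,
  \<open>(v, u)\<close> for every edge \<open>{u, v}\<close>.\<close>

definition orientation_of :: "('a \<times> 'a) set \<Rightarrow> 'a set set \<Rightarrow> bool" where
  "orientation_of D E \<longleftrightarrow> bij_betw (\<lambda>(u, v). {u, v}) D E"

text \<open>Integer polynomials with variables in \<open>'a\<close>: a monomial is its finitely supported exponent
  function, and a polynomial maps each monomial to its coefficient.\<close>

type_synonym 'a monomial = "'a \<Rightarrow>\<^sub>0 nat"
type_synonym 'a int_mpoly = "'a monomial \<Rightarrow>\<^sub>0 int"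

definition var_pow :: "'a \<Rightarrow> nat \<Rightarrow> 'a monomial" where
  "var_pow v k = Poly_Mapping.single v k"

definition Var :: "'a \<Rightarrow> 'a int_mpoly" where
  "Var v = Poly_Mapping.single (var_pow v 1) 1"

definition mcoeff :: "'a int_mpoly \<Rightarrow> 'a monomial \<Rightarrow> int" where
  "mcoeff p m = Poly_Mapping.lookup p m"

definition graph_polynomial :: "('a \<times> 'a) set \<Rightarrow> 'a int_mpoly" where
  "graph_polynomial D = (\<Prod>(u, v)\<in>D. Var u - Var v)"

definition proper_3_colouring :: "'a set \<Rightarrow> 'a set set \<Rightarrow> ('a \<Rightarrow> nat) \<Rightarrow> bool" where
  "proper_3_colouring V E C \<longleftrightarrow>
     C ` V \<subseteq> {1, 2, 3} \<and> (\<forall>u v. {u, v} \<in> E \<longrightarrow> C u \<noteq> C v)"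

end

theory Submission
  imports Defs
begin

text \<open>
  Outerplanar drawings survive passing to subgraphs and smoothing a vertex of degree 2, and
  \<open>K\<^sub>4\<close> has none; hence every outerplanar graph has a vertex of degree at most 2, and further such
  vertices outside any given edge. This licenses inductions that peel off low-degree vertices.

  All coefficients are considered modulo 3 and only exponents at most 2 are kept. What is shown is
  that, for suitable exponents of the remaining variables, the coefficient in \<open>P(G)\<close>, as a polynomial
  in \<open>x\<close> and \<open>y\<close>, is a nonzero multiple of \<open>x\<^sup>2 + x y + y\<^sup>2\<close>, of \<open>x - y\<close> or of \<open>1\<close>, according to whether
  the colours of \<open>x\<close> and \<open>y\<close> always agree, always differ, or neither. Vertices of degree at most 2
  other than \<open>x, y\<close> can be removed, after which \<open>x\<close> itself has degree at most 2. If it has two neighbours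
  \<open>a, b\<close>, then these are adjacent and one of them, say \<open>a\<close>, has just one further neighbour \<open>c\<close>. If
  \<open>b c\<close> is an edge, then \<open>x\<close> and \<open>c\<close> are interchangeable, both for colourings and for coefficients;
  otherwise both colour patterns occur and the constant term is computed directly.
\<close>

text \<open>A statement about single exponents is too weak for an induction: passing from a leaf
  \<open>x\<close> to its neighbour \<open>a\<close> uses two coefficients of the smaller
  polynomial, in a fixed ratio. Hence a whole form in \<open>x\<close> and \<open>y\<close> is
  tracked. Modulo 3 the three forms are the powers \<open>(x - y)^k\<close>, since there
  \<open>x^2 + x y + y^2\<close> is \<open>(x - y)^2\<close>; the exponents \<open>(1, 1)\<close>
  asked for when the colours agree belong to its middle term. The modulus is dictated by one
  configuration, a triangle \<open>x a b\<close> with further edges \<open>a c\<close> and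
  \<open>b d\<close>: extracting \<open>a^2 b^2\<close> leaves the factor \<open>c - d\<close>,
  which may repeat an existing edge. So polynomials with one doubled edge have to be handled as
  well, and a doubled edge survives the deletion of an end of degree 2 because \<open>-2 = 1\<close>
  modulo 3. In the main induction \<open>y\<close> is never moved: low-degree vertices are sought
  away from it, and only \<open>x\<close> is replaced by other vertices.\<close>

section \<open>Plane drawings\<close>

lemma theta_loop:
  fixes c d :: "real \<Rightarrow> complex"
  assumes "arc c" "pathstart c = a" "pathfinish c = b"
    and "arc d" "pathstart d = a" "pathfinish d = b"
    and "path_image c \<inter> path_image d = {a, b}"
  shows "simple_path (c +++ reversepath d)"
    and "pathfinish (c +++ reversepath d) = pathstart (c +++ reversepath d)"
    and "path_image (c +++ reversepath d) = path_image c \<union> path_image d"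
  using assms
  by (auto simp: simple_path_join_loop_eq arc_simple_path arc_reversepath simple_path_reversepath path_image_join)

lemma inside_subset_inside_if_disjoint_frontier:
  fixes A B :: "'a::euclidean_space set"
  assumes "connected (inside A)" "inside A \<inter> B = {}" "frontier (inside B) = B"
    and "inside A \<inter> inside B \<noteq> {}"
  shows "inside A \<subseteq> inside B"
  using assms connected_Int_frontier[of "inside A" "inside B"] by auto

text \<open>If the two regions met, each would contain the other, since a connected set leaves a
  region only through its frontier. Equal regions have equal frontiers, and then \<open>c2\<close>
  would be reduced to its two endpoints.\<close>

lemma theta_insides_disjoint:
  fixes c1 c2 c3 :: "real \<Rightarrow> complex"
  assumes c1: "arc c1" "pathstart c1 = a" "pathfinish c1 = b"
    and c2: "arc c2" "pathstart c2 = a" "pathfinish c2 = b"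
    and c3: "arc c3" "pathstart c3 = a" "pathfinish c3 = b"
    and c12: "path_image c1 \<inter> path_image c2 = {a, b}"
    and c13: "path_image c1 \<inter> path_image c3 = {a, b}"
    and c23: "path_image c2 \<inter> path_image c3 = {a, b}"
    and n3: "path_image c3 \<inter> inside (path_image c1 \<union> path_image c2) = {}"
    and n2: "path_image c2 \<inter> inside (path_image c1 \<union> path_image c3) = {}"
  shows "inside (path_image c1 \<union> path_image c2) \<inter> inside (path_image c1 \<union> path_image c3) = {}"
proof (rule ccontr)
  let ?S1 = "path_image c1" and ?S2 = "path_image c2" and ?S3 = "path_image c3"
  assume ne: "\<not> ?thesis"
  note l12 = theta_loop[OF c1 c2 c12] and l13 = theta_loop[OF c1 c3 c13]
  have J12: "connected (inside (?S1 \<union> ?S2))" "frontier (inside (?S1 \<union> ?S2)) = ?S1 \<union> ?S2"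
    and J13: "connected (inside (?S1 \<union> ?S3))" "frontier (inside (?S1 \<union> ?S3)) = ?S1 \<union> ?S3"
    using Jordan_inside_outside[OF l12(1,2)] Jordan_inside_outside[OF l13(1,2)] l12(3) l13(3) by auto
  have "inside (?S1 \<union> ?S2) \<inter> (?S1 \<union> ?S3) = {}" "inside (?S1 \<union> ?S3) \<inter> (?S1 \<union> ?S2) = {}"
    using n2 n3 inside_no_overlap[of "?S1 \<union> ?S2"] inside_no_overlap[of "?S1 \<union> ?S3"] by blast+
  then have "inside (?S1 \<union> ?S2) \<subseteq> inside (?S1 \<union> ?S3)" "inside (?S1 \<union> ?S3) \<subseteq> inside (?S1 \<union> ?S2)"
    using ne by (intro inside_subset_inside_if_disjoint_frontier J12 J13; simp add: Int_commute)+
  then have "?S1 \<union> ?S2 = ?S1 \<union> ?S3" using J12 J13 by (metis subset_antisym)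
  then have "?S2 \<subseteq> {a, b}" using c12 c23 by blast
  moreover have "?S2 - {a, b} \<noteq> {}"
    using nonempty_simple_path_endless[of c2] c2 by (simp add: arc_imp_simple_path)
  ultimately show False by blast
qed

text \<open>An application of Janiszewski's theorem. If no arc enters the loop of the other two, a
  point \<open>p\<close> inside the loop of \<open>c1\<close> and \<open>c2\<close> is outside both
  loops through \<open>c3\<close>, so it can be joined to a far away point \<open>q\<close> off each
  of them. These two loops meet in the connected set \<open>c3\<close>, so \<open>p\<close> and
  \<open>q\<close> can be joined off their union, which contains the loop around
  \<open>p\<close>.\<close>

lemma theta_some_arc_inside:
  fixes c1 c2 c3 :: "real \<Rightarrow> complex"
  assumes c1: "arc c1" "pathstart c1 = a" "pathfinish c1 = b"
    and c2: "arc c2" "pathstart c2 = a" "pathfinish c2 = b"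
    and c3: "arc c3" "pathstart c3 = a" "pathfinish c3 = b"
    and c12: "path_image c1 \<inter> path_image c2 = {a, b}"
    and c13: "path_image c1 \<inter> path_image c3 = {a, b}"
    and c23: "path_image c2 \<inter> path_image c3 = {a, b}"
  shows "path_image c1 \<inter> inside (path_image c2 \<union> path_image c3) \<noteq> {} \<or>
    path_image c2 \<inter> inside (path_image c1 \<union> path_image c3) \<noteq> {} \<or>
    path_image c3 \<inter> inside (path_image c1 \<union> path_image c2) \<noteq> {}"
proof (rule ccontr)
  let ?S1 = "path_image c1" and ?S2 = "path_image c2" and ?S3 = "path_image c3"
  let ?T = "?S1 \<union> ?S2 \<union> ?S3"
  assume "\<not> ?thesis"
  then have none: "?S1 \<inter> inside (?S2 \<union> ?S3) = {}" "?S2 \<inter> inside (?S1 \<union> ?S3) = {}"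
    "?S3 \<inter> inside (?S1 \<union> ?S2) = {}" by auto
  note l12 = theta_loop[OF c1 c2 c12] and l13 = theta_loop[OF c1 c3 c13]
    and l23 = theta_loop[OF c2 c3 c23]
  note J12 = Jordan_inside_outside[OF l12(1,2), unfolded l12(3)]
    and J13 = Jordan_inside_outside[OF l13(1,2), unfolded l13(3)]
    and J23 = Jordan_inside_outside[OF l23(1,2), unfolded l23(3)]
  have dis13: "inside (?S1 \<union> ?S2) \<inter> inside (?S1 \<union> ?S3) = {}"
    using none by (intro theta_insides_disjoint[OF c1 c2 c3 c12 c13 c23]) auto
  have dis23: "inside (?S1 \<union> ?S2) \<inter> inside (?S2 \<union> ?S3) = {}"
    using theta_insides_disjoint[OF c2 c1 c3 _ c23 c13] none c12 by (simp add: Un_commute Int_commute)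
  obtain p where p: "p \<in> inside (?S1 \<union> ?S2)" using J12 by blast
  have "compact ?T" using c1 c2 c3 by (simp add: compact_Un compact_path_image arc_imp_path)
  then have "outside ?T \<noteq> {}" 
    by (intro outside_bounded_nonempty compact_imp_bounded)
  then obtain q where q: "q \<in> outside ?T" by blast
  have cc: "connected_component (- A) p q"
    if "connected (outside A)" "p \<in> outside A" "A \<subseteq> ?T" for A
    unfolding connected_component_def using that q outside_mono[OF that(3)] outside_no_overlap[of A]
    by (intro exI[of _ "outside A"]) blast
  have "p \<notin> ?S1 \<union> ?S2" using p inside_no_overlap[of "?S1 \<union> ?S2"] by blast
  moreover have "p \<notin> ?S3" using p none(3) by blast
  moreover have "p \<notin> inside (?S1 \<union> ?S3)" "p \<notin> inside (?S2 \<union> ?S3)" using p dis13 dis23 by blast+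
  ultimately have "p \<in> outside (?S1 \<union> ?S3)" "p \<in> outside (?S2 \<union> ?S3)"
    by (simp_all add: outside_inside)
  then have "connected_component (- (?S1 \<union> ?S3)) p q" "connected_component (- (?S2 \<union> ?S3)) p q"
    using J13 J23 by - (rule cc; blast)+
  moreover have "(?S1 \<union> ?S3) \<inter> (?S2 \<union> ?S3) = ?S3" using c12 c13 c3(2,3) pathstart_in_path_image pathfinish_in_path_image by blast
  ultimately have "connected_component (- ((?S1 \<union> ?S3) \<union> (?S2 \<union> ?S3))) p q"
    using c1 c2 c3
    by - (rule Janiszewski_weak,
        simp_all add: compact_Un compact_path_image arc_imp_path connected_path_image)
  then have "connected_component (- (?S1 \<union> ?S2)) p q"
    by (rule connected_component_of_subset) auto
  then have "q \<in> inside (?S1 \<union> ?S2)" using p by (rule inside_same_component)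
  moreover have "q \<in> outside (?S1 \<union> ?S2)" using q outside_mono[of "?S1 \<union> ?S2" ?T] by auto
  ultimately show False using inside_Int_outside by blast
qed

section \<open>Subgraphs and smoothing of outerplanar drawings\<close>

lemma arc_between:
  assumes "arc c" "{pathstart c, pathfinish c} = {p, q}"
  obtains g where "arc g" "pathstart g = p" "pathfinish g = q" "path_image g = path_image c"
proof (cases "pathstart c = p")
  case True
  with assms that[of c] show ?thesis using arc_distinct_ends[OF assms(1)] by (auto simp: doubleton_eq_iff)
next
  case False
  with assms that[of "reversepath c"] show ?thesis by (auto simp: arc_reversepath doubleton_eq_iff)
qed

lemma plane_drawing_edge_arc:
  assumes "plane_drawing V E pos crv" "{u, v} \<in> E"
  obtains g where "arc g" "pathstart g = pos u" "pathfinish g = pos v" "path_image g = path_image (crv {u, v})"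
proof -
  have "arc (crv {u, v})" "{pathstart (crv {u, v}), pathfinish (crv {u, v})} = {pos u, pos v}"
    using assms unfolding plane_drawing_def by auto
  then show ?thesis by (rule arc_between) (rule that)
qed

text \<open>Shrinking the drawing enlarges the outside and hence its closure, while a point of
  \<open>S\<close> itself never lies in the outside of \<open>S\<close>. This is how the outer-face
  condition passes to smaller drawings.\<close>

lemma frontier_outside_subset:
  assumes "S \<subseteq> T" "p \<in> S" "p \<in> frontier (outside T)"
  shows "p \<in> frontier (outside S)"
  using assms closure_mono[OF outside_mono[OF assms(1)]] outside_no_overlap[of S] interior_subset[of "outside S"]
  unfolding frontier_def by blast

lemma outerplanar_subgraph:
  assumes "outerplanar V E" "V' \<subseteq> V" "E' \<subseteq> E" "\<And>e. e \<in> E' \<Longrightarrow> e \<subseteq> V'"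
  shows "outerplanar V' E'"
proof -
  obtain pos crv where dr: "plane_drawing V E pos crv"
    and out: "\<And>v. v \<in> V \<Longrightarrow> pos v \<in> frontier (outside (drawing_set V E pos crv))"
    using assms(1) unfolding outerplanar_def by blast
  have sub: "drawing_set V' E' pos crv \<subseteq> drawing_set V E pos crv"
    using assms unfolding drawing_set_def by auto
  have "plane_drawing V' E' pos crv"
    unfolding plane_drawing_def
  proof (intro conjI ballI impI)
    show "inj_on pos V'" using dr assms(2) unfolding plane_drawing_def by (auto intro: inj_on_subset)
  next
    fix e assume e: "e \<in> E'"
    with assms(3) have "e \<in> E" by blast
    with dr have *: "arc (crv e)" "{pathstart (crv e), pathfinish (crv e)} = pos ` e"
      "path_image (crv e) \<inter> pos ` V = pos ` e" unfolding plane_drawing_def by blast+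
    show "arc (crv e)" "{pathstart (crv e), pathfinish (crv e)} = pos ` e" by fact+
    show "path_image (crv e) \<inter> pos ` V' = pos ` e" using *(3) assms(2) assms(4)[OF e] by blast
  next
    fix e f assume "e \<in> E'" "f \<in> E'" "e \<noteq> f"
    then show "path_image (crv e) \<inter> path_image (crv f) \<subseteq> pos ` (e \<inter> f)"
      using dr assms(3) unfolding plane_drawing_def by (meson subsetD)
  qed
  moreover have "pos v \<in> frontier (outside (drawing_set V' E' pos crv))" if "v \<in> V'" for v
    using that assms(2) by (intro frontier_outside_subset[OF sub] out) (auto simp: drawing_set_def)
  ultimately show ?thesis unfolding outerplanar_def by blast
qed

lemma arc_joined_edges:
  assumes dr: "plane_drawing V E pos crv"
    and e: "{u, v} \<in> E" "{v, w} \<in> E" and "u \<noteq> w"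
  obtains g where "arc g" "pathstart g = pos u" "pathfinish g = pos w"
    "path_image g = path_image (crv {u, v}) \<union> path_image (crv {v, w})"
proof -
  obtain g where g: "arc g" "pathstart g = pos u" "pathfinish g = pos v" "path_image g = path_image (crv {u, v})"
    using plane_drawing_edge_arc[OF dr e(1)] .
  obtain h where h: "arc h" "pathstart h = pos v" "pathfinish h = pos w" "path_image h = path_image (crv {v, w})"
    using plane_drawing_edge_arc[OF dr e(2)] .
  have "u \<noteq> v" "v \<noteq> w" using g h arc_distinct_ends by metis+
  then have "{u, v} \<inter> {v, w} = {v}" "{u, v} \<noteq> {v, w}" using \<open>u \<noteq> w\<close> by (auto simp: doubleton_eq_iff)
  then have "path_image g \<inter> path_image h \<subseteq> {pos v}"
    using dr e g h unfolding plane_drawing_def by (metis image_empty image_insert)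
  with g h have "arc (g +++ h)" by (intro arc_join) auto
  then show ?thesis using g h by (intro that[of "g +++ h"]) (auto simp: path_image_join)
qed

text \<open>The new edge \<open>a b\<close> is drawn along the old curves through \<open>v\<close>,
  so the new drawing is part of the old one and all vertices stay on the outer face. Any further
  edges at \<open>v\<close> are dropped. If \<open>a b\<close> is already an edge, deleting
  \<open>v\<close> is enough.\<close>

lemma outerplanar_smooth:
  assumes op: "outerplanar V E" and ab: "a \<noteq> b" "v \<notin> {a, b}" and e: "{v, a} \<in> E" "{v, b} \<in> E"
    and sub: "\<And>e. e \<in> E \<Longrightarrow> e \<subseteq> V"
  shows "outerplanar (V - {v}) (insert {a, b} {e \<in> E. v \<notin> e})"
proof (cases "{a, b} \<in> E")
  case True
  show ?thesis by (rule outerplanar_subgraph[OF op]) (use True ab sub in auto)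
next
  case False
  obtain pos crv where dr: "plane_drawing V E pos crv"
    and out: "\<And>v. v \<in> V \<Longrightarrow> pos v \<in> frontier (outside (drawing_set V E pos crv))"
    using op unfolding outerplanar_def by blast
  obtain g where g: "arc g" "pathstart g = pos a" "pathfinish g = pos b"
    "path_image g = path_image (crv {a, v}) \<union> path_image (crv {v, b})"
    using arc_joined_edges[OF dr _ e(2) ab(1)] e(1) by (metis insert_commute)
  define crv' where "crv' = crv({a, b} := g)"
  have V: "a \<in> V" "b \<in> V" "v \<in> V" using sub e by auto
  have inj: "inj_on pos V" using dr unfolding plane_drawing_def by blast
  have arcs: "arc (crv f)" "{pathstart (crv f), pathfinish (crv f)} = pos ` f"
     "path_image (crv f) \<inter> pos ` V = pos ` f" if "f \<in> E" for f
    using dr that unfolding plane_drawing_def by auto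
  have cross: "path_image (crv f) \<inter> path_image (crv f') \<subseteq> pos ` (f \<inter> f')"
    if "f \<in> E" "f' \<in> E" "f \<noteq> f'" for f f'
    using dr that unfolding plane_drawing_def by blast
  have e': "{a, v} \<in> E" using e by (simp add: insert_commute)
  have gV: "path_image g \<inter> pos ` (V - {v}) = pos ` {a, b}"
  proof -
    have "path_image g \<inter> pos ` V = pos ` {a, v, b}" using arcs(3)[OF e'] arcs(3)[OF e(2)] g(4) by auto
    moreover have "pos ` (V - {v}) = pos ` V - {pos v}" using inj V by (auto dest: inj_onD)
    moreover have "pos v \<noteq> pos a" "pos v \<noteq> pos b" using inj V ab by (auto dest: inj_onD)
    ultimately show ?thesis by auto
  qed
  have gf: "path_image g \<inter> path_image (crv f) \<subseteq> pos ` ({a, b} \<inter> f)" if "f \<in> E" "v \<notin> f" for f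
  proof -
    have "path_image (crv {a, v}) \<inter> path_image (crv f) \<subseteq> pos ` ({a, v} \<inter> f)"
      "path_image (crv {v, b}) \<inter> path_image (crv f) \<subseteq> pos ` ({v, b} \<inter> f)"
      using that e e' by (intro cross; blast)+
    moreover have "{a, v} \<inter> f \<subseteq> {a, b} \<inter> f" "{v, b} \<inter> f \<subseteq> {a, b} \<inter> f" using that by auto
    ultimately show ?thesis using g(4) by blast
  qed
  have sub': "drawing_set (V - {v}) (insert {a, b} {e \<in> E. v \<notin> e}) pos crv' \<subseteq> drawing_set V E pos crv"
    using g(4) e e' unfolding drawing_set_def crv'_def by (auto split: if_splits)
  have "plane_drawing (V - {v}) (insert {a, b} {e \<in> E. v \<notin> e}) pos crv'"
    unfolding plane_drawing_def
  proof (intro conjI ballI impI)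
    show "inj_on pos (V - {v})" using inj by (rule inj_on_subset) auto
  next
    fix f assume f: "f \<in> insert {a, b} {e \<in> E. v \<notin> e}"
    show "arc (crv' f)" "{pathstart (crv' f), pathfinish (crv' f)} = pos ` f"
      using f g(1-3) arcs(1,2)[of f] unfolding crv'_def by (cases "f = {a, b}"; simp)+
    show "path_image (crv' f) \<inter> pos ` (V - {v}) = pos ` f"
    proof (cases "f = {a, b}")
      case True then show ?thesis using gV unfolding crv'_def by simp
    next
      case False
      then have "f \<in> E" "v \<notin> f" using f by auto
      then show ?thesis using arcs(3)[of f] sub[of f] False unfolding crv'_def by auto
    qed
  next
    fix f f' assume f: "f \<in> insert {a, b} {e \<in> E. v \<notin> e}" "f' \<in> insert {a, b} {e \<in> E. v \<notin> e}" "f \<noteq> f'"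
    consider "f = {a, b}" "f' \<noteq> {a, b}" | "f' = {a, b}" "f \<noteq> {a, b}" | "f \<noteq> {a, b}" "f' \<noteq> {a, b}"
      using f(3) by blast
    then show "path_image (crv' f) \<inter> path_image (crv' f') \<subseteq> pos ` (f \<inter> f')"
    proof cases
      case 1 then show ?thesis using f gf[of f'] unfolding crv'_def by auto
    next
      case 2 then show ?thesis using f gf[of f] unfolding crv'_def by (auto simp: Int_commute)
    next
      case 3 then show ?thesis using f cross[of f f'] unfolding crv'_def by auto
    qed
  qed
  moreover have "pos w \<in> frontier (outside (drawing_set (V - {v}) (insert {a, b} {e \<in> E. v \<notin> e}) pos crv'))"
    if "w \<in> V - {v}" for w
    using that by (intro frontier_outside_subset[OF sub'] out) (auto simp: drawing_set_def)
  ultimately show ?thesis unfolding outerplanar_def by blast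
qed


section \<open>The complete graph on four vertices\<close>

lemma arc_endless_subset_inside:
  fixes g :: "real \<Rightarrow> complex"
  assumes "arc g" "pathstart g = p" "pathfinish g = q" "frontier (inside S) = S"
    and "path_image g \<inter> S \<subseteq> {p, q}" "{p, q} \<subseteq> S" "path_image g \<inter> inside S \<noteq> {}"
  shows "path_image g - {p, q} \<subseteq> inside S"
proof -
  have "connected (path_image g - {p, q})"
    using connected_simple_path_endless[of g] assms(1-3) arc_imp_simple_path by auto
  moreover have "(path_image g - {p, q}) \<inter> inside S \<noteq> {}" using assms(6,7) inside_no_overlap by blast
  ultimately show ?thesis
    using connected_Int_frontier[of "path_image g - {p, q}" "inside S"] assms(4,5) by blast
qed

text \<open>As the arc meets \<open>S\<close> at most at its start, the rest of it, end included, is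
  connected and avoids the frontier of \<open>inside S\<close>.\<close>

lemma arc_pathfinish_in_inside:
  fixes h :: "real \<Rightarrow> complex"
  assumes "arc h" "frontier (inside S) = S" "path_image h \<inter> S \<subseteq> {pathstart h}"
    and "z \<in> path_image h" "z \<in> inside S" "z \<noteq> pathstart h"
  shows "pathfinish h \<in> inside S"
proof -
  have inj: "inj_on h {0..1}" and "continuous_on {0..1} h"
    using assms(1) by (auto simp: arc_def path_def)
  then have con: "connected (h ` {0<..1})"
    by (intro connected_continuous_image) (auto intro: continuous_on_subset)
  have "z \<in> h ` {0<..1}" using assms(4,6) by (force simp: path_image_def pathstart_def less_le)
  moreover have "h ` {0<..1} \<inter> S = {}"
  proof -
    have "h t \<noteq> h 0" if "t \<in> {0<..1}" for t using inj_onD[OF inj, of t 0] that by auto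
    moreover have "h ` {0<..1} \<subseteq> path_image h" by (auto simp: path_image_def)
    ultimately show ?thesis using assms(3) unfolding pathstart_def by blast
  qed
  ultimately have "h ` {0<..1} \<subseteq> inside S"
    using connected_Int_frontier[OF con, of "inside S"] assms(2,5) by blast
  then show ?thesis by (auto simp: pathfinish_def)
qed

text \<open>The paths \<open>a b c\<close> and \<open>a d c\<close> and the edge \<open>a c\<close>
  form a theta curve, so one of them enters the loop of the other two. It cannot be \<open>A\<close>
  or \<open>B\<close>: then all of it except its ends would be enclosed, and with it
  \<open>b\<close> or \<open>d\<close>, which lies on the outer face.\<close>

lemma chord_meets_inside:
  assumes dr: "plane_drawing V E pos crv"
    and out: "\<And>v. v \<in> {b, d} \<Longrightarrow> pos v \<in> frontier (outside (drawing_set V E pos crv))"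
    and dist: "distinct [a, b, c, d]"
    and e: "{a, b} \<in> E" "{b, c} \<in> E" "{a, d} \<in> E" "{d, c} \<in> E" "{a, c} \<in> E"
    and A: "arc A" "pathstart A = pos a" "pathfinish A = pos c"
      "path_image A = path_image (crv {a, b}) \<union> path_image (crv {b, c})"
    and B: "arc B" "pathstart B = pos a" "pathfinish B = pos c"
      "path_image B = path_image (crv {a, d}) \<union> path_image (crv {d, c})"
    and g: "arc g" "pathstart g = pos a" "pathfinish g = pos c" "path_image g = path_image (crv {a, c})"
  shows "path_image A \<inter> path_image B = {pos a, pos c}"
    and "path_image A \<inter> path_image g = {pos a, pos c}"
    and "path_image B \<inter> path_image g = {pos a, pos c}"
    and "path_image g \<inter> inside (path_image A \<union> path_image B) \<noteq> {}"
proof -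
  have cross: "path_image (crv f) \<inter> path_image (crv f') \<subseteq> pos ` (f \<inter> f')"
    if "f \<in> E" "f' \<in> E" "f \<noteq> f'" for f f'
    using dr that unfolding plane_drawing_def by blast
  have ne: "{a, b} \<noteq> {a, d}" "{a, b} \<noteq> {d, c}" "{b, c} \<noteq> {a, d}" "{b, c} \<noteq> {d, c}"
    "{a, b} \<noteq> {a, c}" "{b, c} \<noteq> {a, c}" "{a, d} \<noteq> {a, c}" "{d, c} \<noteq> {a, c}"
    using dist by (auto simp: doubleton_eq_iff)
  have int: "{a, b} \<inter> {a, d} = {a}" "{a, b} \<inter> {d, c} = {}" "{b, c} \<inter> {a, d} = {}" "{b, c} \<inter> {d, c} = {c}"
    "{a, b} \<inter> {a, c} = {a}" "{b, c} \<inter> {a, c} = {c}" "{a, d} \<inter> {a, c} = {a}" "{d, c} \<inter> {a, c} = {c}"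
    using dist by auto
  have ends: "pos a \<in> path_image A" "pos c \<in> path_image A" "pos a \<in> path_image B" "pos c \<in> path_image B"
    "pos a \<in> path_image g" "pos c \<in> path_image g"
    using A B g by (metis pathstart_in_path_image pathfinish_in_path_image)+
  have cr: "path_image (crv {a, b}) \<inter> path_image (crv {a, d}) \<subseteq> {pos a}"
    "path_image (crv {a, b}) \<inter> path_image (crv {d, c}) \<subseteq> {}"
    "path_image (crv {b, c}) \<inter> path_image (crv {a, d}) \<subseteq> {}"
    "path_image (crv {b, c}) \<inter> path_image (crv {d, c}) \<subseteq> {pos c}"
    "path_image (crv {a, b}) \<inter> path_image (crv {a, c}) \<subseteq> {pos a}"
    "path_image (crv {b, c}) \<inter> path_image (crv {a, c}) \<subseteq> {pos c}"
    "path_image (crv {a, d}) \<inter> path_image (crv {a, c}) \<subseteq> {pos a}"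
    "path_image (crv {d, c}) \<inter> path_image (crv {a, c}) \<subseteq> {pos c}"
    using cross[OF e(1) e(3) ne(1)] cross[OF e(1) e(4) ne(2)] cross[OF e(2) e(3) ne(3)]
      cross[OF e(2) e(4) ne(4)] cross[OF e(1) e(5) ne(5)] cross[OF e(2) e(5) ne(6)]
      cross[OF e(3) e(5) ne(7)] cross[OF e(4) e(5) ne(8)] unfolding int by simp_all
  show AB: "path_image A \<inter> path_image B = {pos a, pos c}"
    using cr(1-4) ends unfolding A B by blast
  show Ag: "path_image A \<inter> path_image g = {pos a, pos c}"
    using cr(5,6) ends unfolding A g by blast
  show Bg: "path_image B \<inter> path_image g = {pos a, pos c}"
    using cr(7,8) ends unfolding B g by blast
  have end_in: "pos u \<in> path_image (crv {u, v})" "pos v \<in> path_image (crv {u, v})" if "{u, v} \<in> E" for u v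
    using dr that unfolding plane_drawing_def by blast+
  have bd: "pos b \<in> path_image A" "pos d \<in> path_image B" "pos b \<noteq> pos a" "pos b \<noteq> pos c"
    "pos d \<noteq> pos a" "pos d \<noteq> pos c"
  proof -
    have inj: "pos u \<noteq> pos v" if "{u, v} \<in> E" for u v
      using plane_drawing_edge_arc[OF dr that] arc_distinct_ends by metis
    show "pos b \<in> path_image A" "pos d \<in> path_image B" unfolding A B using end_in e by blast+
    show "pos b \<noteq> pos a" "pos b \<noteq> pos c" "pos d \<noteq> pos a" "pos d \<noteq> pos c"
      using inj[OF e(1)] inj[OF e(2)] inj[OF e(3)] inj[OF e(4)] by auto
  qed
  \<comment> \<open>A vertex enclosed by a loop of the drawing has a neighbourhood free of the
    outside, so it is not on the outer face.\<close>
  have not_in: False if "pos v \<in> inside S" "v \<in> {b, d}" "S \<subseteq> drawing_set V E pos crv" "open (inside S)" for v S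
  proof -
    have "pos v \<in> closure (outside S)"
      using out[OF that(2)] closure_mono[OF outside_mono[OF that(3)]] unfolding frontier_def by blast
    moreover have "inside S \<inter> closure (outside S) = {}"
      using open_Int_closure_eq_empty[OF that(4)] inside_Int_outside by blast
    ultimately show False using that(1) by blast
  qed
  have sub: "path_image A \<union> path_image B \<union> path_image g \<subseteq> drawing_set V E pos crv"
    unfolding A B g drawing_set_def using e by blast
  have jordan: "open (inside (path_image A' \<union> path_image g))" "frontier (inside (path_image A' \<union> path_image g)) = path_image A' \<union> path_image g"
    if "arc A'" "pathstart A' = pos a" "pathfinish A' = pos c" "path_image A' \<inter> path_image g = {pos a, pos c}" for A'
    using theta_loop[OF that(1-3) g(1-3) that(4)] Jordan_inside_outside[of "A' +++ reversepath g"] by simp_all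
  have "path_image A \<inter> inside (path_image B \<union> path_image g) = {}"
  proof (rule ccontr)
    assume "\<not> ?thesis"
    then have "path_image A - {pos a, pos c} \<subseteq> inside (path_image B \<union> path_image g)"
      using jordan[OF B(1-3) Bg] AB Ag ends by (intro arc_endless_subset_inside A(1-3)) auto
    then have "pos b \<in> inside (path_image B \<union> path_image g)" using bd by blast
    then show False by (rule not_in) (use sub jordan[OF B(1-3) Bg] in auto)
  qed
  moreover have "path_image B \<inter> inside (path_image A \<union> path_image g) = {}"
  proof (rule ccontr)
    assume "\<not> ?thesis"
    then have "path_image B - {pos a, pos c} \<subseteq> inside (path_image A \<union> path_image g)"
      using jordan[OF A(1-3) Ag] AB Bg ends by (intro arc_endless_subset_inside B(1-3)) auto
    then have "pos d \<in> inside (path_image A \<union> path_image g)" using bd by blast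
    then show False by (rule not_in) (use sub jordan[OF A(1-3) Ag] in auto)
  qed
  ultimately show "path_image g \<inter> inside (path_image A \<union> path_image B) \<noteq> {}"
    using theta_some_arc_inside[OF A(1-3) B(1-3) g(1-3) AB Ag Bg] by blast
qed

text \<open>Both diagonals of the cycle \<open>a b c d\<close> run through its inside, by
  \<open>chord_meets_inside\<close> applied to each. The diagonal \<open>a c\<close> cuts the inside
  into two parts, and an interior point of \<open>b d\<close>, which cannot cross
  \<open>a c\<close>, lies in one of them. Following \<open>b d\<close> to the end that is not on
  the boundary of this part would put that end inside the cycle, but it lies on the cycle.\<close>

lemma K4_not_outerplanar:
  assumes op: "outerplanar V E" and V: "{a, b, c, d} \<subseteq> V" and dist: "distinct [a, b, c, d]"
    and e: "{a, b} \<in> E" "{b, c} \<in> E" "{a, d} \<in> E" "{d, c} \<in> E" "{a, c} \<in> E" "{b, d} \<in> E"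
  shows False
proof -
  obtain pos crv where dr: "plane_drawing V E pos crv"
    and out: "\<And>v. v \<in> V \<Longrightarrow> pos v \<in> frontier (outside (drawing_set V E pos crv))"
    using op unfolding outerplanar_def by blast
  have e': "{b, a} \<in> E" "{d, a} \<in> E" "{c, d} \<in> E" "{c, b} \<in> E" using e by (simp_all add: insert_commute)
  have nac: "a \<noteq> c" and nbd: "b \<noteq> d" and dist': "distinct [b, a, d, c]" using dist by auto
  obtain A where A: "arc A" "pathstart A = pos a" "pathfinish A = pos c"
      "path_image A = path_image (crv {a, b}) \<union> path_image (crv {b, c})" using arc_joined_edges[OF dr e(1,2) nac] .
  obtain B where B: "arc B" "pathstart B = pos a" "pathfinish B = pos c"
      "path_image B = path_image (crv {a, d}) \<union> path_image (crv {d, c})" using arc_joined_edges[OF dr e(3,4) nac] .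
  obtain g where g: "arc g" "pathstart g = pos a" "pathfinish g = pos c" "path_image g = path_image (crv {a, c})"
    using plane_drawing_edge_arc[OF dr e(5)] .
  obtain A' where A': "arc A'" "pathstart A' = pos b" "pathfinish A' = pos d"
      "path_image A' = path_image (crv {b, a}) \<union> path_image (crv {a, d})" using arc_joined_edges[OF dr e'(1) e(3) nbd] .
  obtain B' where B': "arc B'" "pathstart B' = pos b" "pathfinish B' = pos d"
      "path_image B' = path_image (crv {b, c}) \<union> path_image (crv {c, d})" using arc_joined_edges[OF dr e(2) e'(3) nbd] .
  obtain h where h: "arc h" "pathstart h = pos b" "pathfinish h = pos d" "path_image h = path_image (crv {b, d})"
    using plane_drawing_edge_arc[OF dr e(6)] .
  note C = chord_meets_inside[OF dr _ dist e(1-5) A B g]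
  have C1: "path_image A \<inter> path_image B = {pos a, pos c}"
    "path_image A \<inter> path_image g = {pos a, pos c}"
    "path_image B \<inter> path_image g = {pos a, pos c}"
    "path_image g \<inter> inside (path_image A \<union> path_image B) \<noteq> {}"
    using V out by (intro C; auto)+
  have C2: "path_image h \<inter> inside (path_image A' \<union> path_image B') \<noteq> {}"
    by (rule chord_meets_inside[OF dr _ dist' e'(1) e(3) e(2) e'(3) e(6) A' B' h]) (use V out in auto)
  have cyc: "path_image A' \<union> path_image B' = path_image A \<union> path_image B"
    unfolding A A' B B' by (auto simp: insert_commute)
  have inV: "a \<in> V" "b \<in> V" "c \<in> V" "d \<in> V" using V by auto
  have inj: "inj_on pos V" using dr unfolding plane_drawing_def by blast
  let ?AB = "path_image A \<union> path_image B" let ?Ag = "path_image A \<union> path_image g" let ?Bg = "path_image B \<union> path_image g"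
  have cross: "path_image (crv {b, d}) \<inter> path_image (crv f) \<subseteq> pos ` ({b, d} \<inter> f)"
    if "f \<in> E" "f \<noteq> {b, d}" for f
    using dr that e(6) unfolding plane_drawing_def by metis
  have ne: "{a, b} \<noteq> {b, d}" "{b, c} \<noteq> {b, d}" "{a, d} \<noteq> {b, d}" "{d, c} \<noteq> {b, d}" "{a, c} \<noteq> {b, d}"
    using dist by (auto simp: doubleton_eq_iff)
  have int: "{b, d} \<inter> {a, b} = {b}" "{b, d} \<inter> {b, c} = {b}" "{b, d} \<inter> {a, d} = {d}" "{b, d} \<inter> {d, c} = {d}"
    "{b, d} \<inter> {a, c} = {}"
    using dist by auto
  have cr: "path_image (crv {b, d}) \<inter> path_image (crv {a, b}) \<subseteq> {pos b}"
    "path_image (crv {b, d}) \<inter> path_image (crv {b, c}) \<subseteq> {pos b}"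
    "path_image (crv {b, d}) \<inter> path_image (crv {a, d}) \<subseteq> {pos d}"
    "path_image (crv {b, d}) \<inter> path_image (crv {d, c}) \<subseteq> {pos d}"
    "path_image (crv {b, d}) \<inter> path_image (crv {a, c}) \<subseteq> {}"
    using cross[OF e(1) ne(1)] cross[OF e(2) ne(2)] cross[OF e(3) ne(3)] cross[OF e(4) ne(4)]
      cross[OF e(5) ne(5)] unfolding int by simp_all
  have hAB: "path_image h \<inter> ?AB \<subseteq> {pos b, pos d}"
    using cr(1-4) unfolding A B h by blast
  have hg: "path_image h \<inter> path_image g = {}"
    using cr(5) unfolding g h by blast
  have pe: "pos b \<in> path_image A" "pos d \<in> path_image B"
  proof -
    have "pos u \<in> path_image (crv {u, v})" if "{u, v} \<in> E" for u v
      using plane_drawing_edge_arc[OF dr that] pathstart_in_path_image by metis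
    then show "pos b \<in> path_image A" "pos d \<in> path_image B" unfolding A B using e by blast+
  qed
  have "path_image h \<inter> inside ?AB \<noteq> {}" using C2 unfolding cyc .
  then have hin: "path_image h - {pos b, pos d} \<subseteq> inside ?AB"
    using hAB Jordan_inside_outside[OF theta_loop(1,2)[OF A(1-3) B(1-3) C1(1)]] pe
      theta_loop(3)[OF A(1-3) B(1-3) C1(1)]
    by (intro arc_endless_subset_inside h(1-3)) auto
  have ac: "pos a \<noteq> pos c" using inj inV nac by (auto dest: inj_onD)
  obtain s: "inside ?Ag \<inter> inside ?Bg = {}"
    "inside ?Ag \<union> inside ?Bg \<union> (path_image g - {pos a, pos c}) = inside ?AB"
    using split_inside_simple_closed_curve[OF arc_imp_simple_path[OF A(1)] A(2,3) arc_imp_simple_path[OF B(1)] B(2,3)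
      arc_imp_simple_path[OF g(1)] g(2,3) ac C1] .
  have "pos v \<noteq> pos u" if "v \<in> {b, d}" "u \<in> {a, c}" for u v
    using that inj inV dist by (auto dest!: inj_onD)
  then have ndA: "pos d \<notin> path_image A" and nbB: "pos b \<notin> path_image B" using C1(1) pe by blast+
  have frA: "frontier (inside ?Ag) = ?Ag"
    using Jordan_inside_outside[OF theta_loop(1,2)[OF A(1-3) g(1-3) C1(2)]] theta_loop(3)[OF A(1-3) g(1-3) C1(2)]
    by simp
  have frB: "frontier (inside ?Bg) = ?Bg"
    using Jordan_inside_outside[OF theta_loop(1,2)[OF B(1-3) g(1-3) C1(3)]] theta_loop(3)[OF B(1-3) g(1-3) C1(3)]
    by simp
  obtain z where z: "z \<in> path_image h - {pos b, pos d}"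
    using nonempty_simple_path_endless[of h] h by (auto simp: arc_imp_simple_path)
  then have zh: "z \<in> path_image h" "z \<noteq> pos b" "z \<noteq> pos d" by auto
  from z have "z \<in> inside ?Ag \<or> z \<in> inside ?Bg" using hin s(2) hg by blast
  then show False
  proof
    assume zA: "z \<in> inside ?Ag"
    have "path_image h \<inter> ?Ag \<subseteq> {pathstart h}"
      unfolding h(2) using hAB hg ndA by blast
    then have "pathfinish h \<in> inside ?Ag"
      using frA h(1,2) zh zA by (intro arc_pathfinish_in_inside) simp_all
    then have "pos d \<in> inside ?AB" using s(2) unfolding h(3) by blast
    then show False using pe(2) inside_no_overlap[of ?AB] by blast
  next
    assume zB: "z \<in> inside ?Bg"
    have "path_image (reversepath h) \<inter> ?Bg \<subseteq> {pathstart (reversepath h)}"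
      unfolding path_image_reversepath pathstart_reversepath h(3) using hAB hg nbB by blast
    then have "pathfinish (reversepath h) \<in> inside ?Bg"
      using frB h(1,3) zh zB by (intro arc_pathfinish_in_inside) (simp_all add: arc_reversepath)
    then have "pos b \<in> inside ?AB" using s(2) h(2) by (simp only: pathfinish_reversepath) blast
    then show False using pe(1) inside_no_overlap[of ?AB] by blast
  qed
qed

section \<open>Low-degree vertices of outerplanar graphs\<close>

definition outerplanar_graph :: "'a set \<Rightarrow> 'a set set \<Rightarrow> bool" where
  "outerplanar_graph V E \<longleftrightarrow> simple_graph V E \<and> outerplanar V E"

abbreviation nbrs :: "'a set set \<Rightarrow> 'a \<Rightarrow> 'a set" where
  "nbrs E v \<equiv> {u. {v, u} \<in> E}"

section \<open>Paths and subdivisions\<close>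

fun path_edges :: "'a list \<Rightarrow> 'a set set" where
  "path_edges (x # y # zs) = insert {x, y} (path_edges (y # zs))"
| "path_edges _ = {}"

lemma path_edges_Cons: "path_edges (x # xs) = (if xs = [] then {} else insert {x, hd xs} (path_edges xs))"
  by (cases xs) auto

lemma path_edges_append:
  "path_edges (xs @ ys) = path_edges xs \<union> path_edges ys \<union>
    (if xs = [] \<or> ys = [] then {} else {{last xs, hd ys}})"
  by (induction xs) (auto simp: path_edges_Cons)

lemma path_edges_rev: "path_edges (rev xs) = path_edges xs"
  by (induction xs) (auto simp: path_edges_Cons path_edges_append last_rev insert_commute)

lemma path_edges_subset: "e \<in> path_edges xs \<Longrightarrow> e \<subseteq> set xs"
  by (induction xs rule: path_edges.induct) auto

text \<open>The inner vertices are smoothed one by one from the end \<open>a\<close>; the edges in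
  \<open>F\<close> avoid them, so nothing of \<open>F\<close> is lost.\<close>

lemma outerplanar_smooth_path:
  assumes "outerplanar V (F \<union> path_edges (a # q @ [b]))" "\<And>e. e \<in> F \<union> path_edges (a # q @ [b]) \<Longrightarrow> e \<subseteq> V"
    and "distinct (a # q @ [b])" "\<And>e. e \<in> F \<Longrightarrow> e \<inter> set q = {}"
  shows "outerplanar (V - set q) (insert {a, b} F)"
  using assms
proof (induction q arbitrary: V)
  case Nil
  then show ?case by simp
next
  case (Cons v q)
  \<comment> \<open>\<open>w\<close> is the vertex after \<open>v\<close> on the path; it equals
    \<open>b\<close> when \<open>q\<close> is used up.\<close>
  define w where "w = hd (q @ [b])"
  have w: "w \<in> set (q @ [b])" "a \<noteq> w" "v \<notin> {a, w}"
    using Cons.prems(3) hd_in_set[of "q @ [b]"] unfolding w_def by auto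
  have E: "path_edges (a # (v # q) @ [b]) = insert {a, v} (insert {v, w} (path_edges (q @ [b])))"
    "path_edges (a # q @ [b]) = insert {a, w} (path_edges (q @ [b]))"
    by (simp_all add: path_edges_Cons w_def)
  have v: "v \<notin> e" if "e \<in> F \<union> path_edges (q @ [b])" for e
    using that Cons.prems(3) Cons.prems(4)[of e] path_edges_subset[of e "q @ [b]"] by auto
  let ?E = "F \<union> path_edges (a # (v # q) @ [b])"
  have "outerplanar (V - {v}) (insert {a, w} {e \<in> ?E. v \<notin> e})"
    by (rule outerplanar_smooth[OF Cons.prems(1)])
      (use w E Cons.prems(2) in \<open>auto simp: insert_commute\<close>)
  moreover have "F \<union> path_edges (a # q @ [b]) \<subseteq> insert {a, w} {e \<in> ?E. v \<notin> e}"
    using E v by auto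
  moreover have *: "e \<subseteq> V - {v}" if "e \<in> F \<union> path_edges (a # q @ [b])" for e
  proof (cases "e = {a, w}")
    case True
    have "{a, v} \<subseteq> V" "{v, w} \<subseteq> V" using Cons.prems(2) E by blast+
    then show ?thesis using w True by auto
  next
    case False
    then show ?thesis using that v[of e] Cons.prems(2)[of e] E by auto
  qed
  ultimately have "outerplanar (V - {v}) (F \<union> path_edges (a # q @ [b]))"
    by (rule outerplanar_subgraph[OF _ order_refl])
  then have "outerplanar (V - {v} - set q) (insert {a, b} F)"
    using * Cons.prems(3,4) by (intro Cons.IH) auto
  then show ?case by (simp add: Diff_insert2[symmetric])
qed

text \<open>The branch vertices are \<open>x\<close>, \<open>p\<close>, \<open>h\<close>,
  \<open>w\<close>. Three of the six connections are paths with inner vertices \<open>q\<close>,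
  \<open>r\<close>, \<open>t\<close>, which are smoothed in turn; the other three are single edges.
  This is the shape that Dirac's argument delivers.\<close>

lemma subdivided_K4_not_outerplanar:
  assumes op: "outerplanar V E" "\<And>e. e \<in> E \<Longrightarrow> e \<subseteq> V"
    and dist: "distinct (x # q @ [p] @ h # r @ w # t)"
    and E: "path_edges (x # q @ [p]) \<subseteq> E" "path_edges (h # r @ [w]) \<subseteq> E" "path_edges (w # t @ [p]) \<subseteq> E"
      "{x, h} \<in> E" "{p, h} \<in> E" "{x, w} \<in> E"
  shows False
proof -
  let ?K = "{{x, h}, {p, h}, {x, w}}"
  have V: "{x, p, h, w} \<subseteq> V" using op(2)[OF E(4)] op(2)[OF E(5)] op(2)[OF E(6)] by auto
  have EV: "e \<subseteq> V" if "e \<in> path_edges (x # q @ [p]) \<union> path_edges (h # r @ [w]) \<union> path_edges (w # t @ [p]) \<union> ?K" for e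
    by (rule op(2)) (use that E in blast)
  have disj: "set q \<inter> ({x, p, h, w} \<union> set r \<union> set t) = {}" "set r \<inter> ({x, p, h, w} \<union> set q \<union> set t) = {}"
    "set t \<inter> ({x, p, h, w} \<union> set q \<union> set r) = {}"
    using dist by auto
  have sub2: "e \<subseteq> {x, p, h, w} \<union> set t" if "e \<in> insert {x, p} ?K \<union> path_edges (w # t @ [p])" for e
    using that path_edges_subset[of e "w # t @ [p]"] by auto
  then have sub1: "e \<subseteq> {x, p, h, w} \<union> set r \<union> set t"
    if "e \<in> insert {x, p} ?K \<union> path_edges (w # t @ [p]) \<union> path_edges (h # r @ [w])" for e
    using that path_edges_subset[of e "h # r @ [w]"] by fastforce
  have dq: "e \<inter> set q = {}" if "e \<in> insert {x, p} ?K \<union> path_edges (w # t @ [p]) \<union> path_edges (h # r @ [w])" for e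
    using sub1[OF that] disj(1) by blast
  have dr: "e \<inter> set r = {}" if "e \<in> insert {x, p} ?K \<union> path_edges (w # t @ [p])" for e
    using sub2[OF that] disj(2) by blast
  have ends: "{x, p, h, w} \<inter> (set q \<union> set r \<union> set t) = {}" using disj by blast
  have V1: "e \<subseteq> V - set q" if "e \<in> insert {x, p} ?K \<union> path_edges (w # t @ [p]) \<union> path_edges (h # r @ [w])" for e
  proof -
    have "e \<subseteq> V" using EV[of e] that V by auto
    then show ?thesis using dq[OF that] by blast
  qed
  have V2: "e \<subseteq> V - set q - set r" if "e \<in> insert {h, w} (insert {x, p} ?K) \<union> path_edges (w # t @ [p])" for e
  proof (cases "e = {h, w}")
    case True
    then show ?thesis using V ends by auto
  next
    case False
    then have e: "e \<in> insert {x, p} ?K \<union> path_edges (w # t @ [p])" using that by simp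
    then have "e \<subseteq> V - set q" by (intro V1) blast
    then show ?thesis using dr[OF e] by blast
  qed
  have "outerplanar V ((?K \<union> path_edges (w # t @ [p]) \<union> path_edges (h # r @ [w])) \<union> path_edges (x # q @ [p]))"
  proof (rule outerplanar_subgraph[OF op(1) order_refl])
    show "e \<subseteq> V" if "e \<in> (?K \<union> path_edges (w # t @ [p]) \<union> path_edges (h # r @ [w])) \<union> path_edges (x # q @ [p])" for e
      by (rule EV) (use that in blast)
  qed (use E in blast)
  then have "outerplanar (V - set q) (insert {x, p} (?K \<union> path_edges (w # t @ [p]) \<union> path_edges (h # r @ [w])))"
  proof (rule outerplanar_smooth_path)
    show "e \<subseteq> V" if "e \<in> (?K \<union> path_edges (w # t @ [p]) \<union> path_edges (h # r @ [w])) \<union> path_edges (x # q @ [p])" for e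
      by (rule EV) (use that in blast)
    show "distinct (x # q @ [p])" using dist by simp
    show "e \<inter> set q = {}" if "e \<in> ?K \<union> path_edges (w # t @ [p]) \<union> path_edges (h # r @ [w])" for e
      by (rule dq) (use that in blast)
  qed
  then have "outerplanar (V - set q) ((insert {x, p} ?K \<union> path_edges (w # t @ [p])) \<union> path_edges (h # r @ [w]))"
    by (simp only: Un_insert_left)
  then have "outerplanar (V - set q - set r) (insert {h, w} (insert {x, p} ?K \<union> path_edges (w # t @ [p])))"
    by (rule outerplanar_smooth_path[OF _ V1 _ dr]) (use dist in simp_all)
  then have "outerplanar (V - set q - set r) ((insert {h, w} (insert {x, p} ?K)) \<union> path_edges (w # t @ [p]))"
    by (simp only: Un_insert_left)
  then have "outerplanar (V - set q - set r - set t) (insert {w, p} (insert {h, w} (insert {x, p} ?K)))"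
  proof (rule outerplanar_smooth_path[OF _ V2])
    show "distinct (w # t @ [p])" using dist by auto
    show "e \<inter> set t = {}" if "e \<in> insert {h, w} (insert {x, p} ?K)" for e
    proof -
      have "e \<subseteq> {x, p, h, w}" using that by blast
      then show ?thesis using ends by blast
    qed
  qed
  moreover have "{x, p, w, h} \<subseteq> V - set q - set r - set t" using V ends by blast
  moreover have "distinct [x, p, w, h]" using dist by auto
  ultimately show False
    by (rule K4_not_outerplanar) (auto simp: insert_commute)
qed

definition edge_path :: "'a set \<Rightarrow> 'a set set \<Rightarrow> 'a list \<Rightarrow> bool" where
  "edge_path V E xs \<longleftrightarrow> xs \<noteq> [] \<and> distinct xs \<and> set xs \<subseteq> V \<and> path_edges xs \<subseteq> E"

text \<open>Dirac's argument. Among the longest paths \<open>s @ h # t\<close> whose first vertex is adjacent to \<open>h\<close>,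
  take one with \<open>s\<close> as short as possible. Reversing \<open>s\<close> gives another such path, so if all degrees are
  at least 3 then both ends of \<open>s\<close> have a neighbour in \<open>t\<close>; this makes a subdivision of \<open>K\<^sub>4\<close>.\<close>

lemma outerplanar_graph_has_low_degree_vertex:
  assumes G: "outerplanar_graph V E" and "V \<noteq> {}"
  shows "\<exists>v\<in>V. card (nbrs E v) \<le> 2"
proof (rule ccontr)
  assume contra: "\<not> ?thesis"
  have fin: "finite V" and EV: "\<And>e. e \<in> E \<Longrightarrow> e \<subseteq> V" and E2: "\<And>e. e \<in> E \<Longrightarrow> card e = 2"
    and op: "outerplanar V E"
    using G unfolding outerplanar_graph_def simple_graph_def by auto
  have noloop: "v \<notin> nbrs E v" for v using E2[of "{v}"] by auto
  have third: "\<exists>u\<in>nbrs E v. u \<notin> {a, b}" if "v \<in> V" for v a b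
  proof (rule ccontr)
    assume "\<not> ?thesis"
    then have "nbrs E v \<subseteq> {a, b}" by auto
    then have "card (nbrs E v) \<le> card {a, b}" by (rule card_mono[rotated]) simp
    also have "\<dots> \<le> 2" by (simp add: card_insert_if)
    finally have "card (nbrs E v) \<le> 2" .
    then show False using contra that by auto
  qed
  obtain v where "v \<in> V" using \<open>V \<noteq> {}\<close> by auto
  then have v: "edge_path V E [v]" unfolding edge_path_def by auto
  have len: "length xs \<le> card V" if "edge_path V E xs" for xs
    using that fin unfolding edge_path_def by (metis card_mono distinct_card)
  obtain N where ex: "\<exists>xs. edge_path V E xs \<and> length xs = N"
    and longest: "\<And>xs. edge_path V E xs \<Longrightarrow> length xs \<le> N"
    using ex_has_greatest_nat[of "edge_path V E" "[v]" length "Suc (card V)"] v len by (auto simp: less_Suc_eq_le)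
  have closed: "nbrs E (hd xs) \<subseteq> set xs" if "edge_path V E xs" "length xs = N" for xs
  proof
    fix u assume u: "u \<in> nbrs E (hd xs)"
    show "u \<in> set xs"
    proof (rule ccontr)
      assume "u \<notin> set xs"
      then have "edge_path V E (u # xs)" using that u EV[of "{hd xs, u}"]
        unfolding edge_path_def by (auto simp: path_edges_Cons insert_commute)
      then show False using longest[of "u # xs"] that(2) by simp
    qed
  qed
  define chord where "chord s h t \<longleftrightarrow> edge_path V E (s @ h # t) \<and> length (s @ h # t) = N \<and> 2 \<le> length s \<and> {hd s, h} \<in> E"
    for s h t
  have ex_chord: "\<exists>s h t. chord s h t"
  proof -
    obtain xs where xs: "edge_path V E xs" "length xs = N" using ex by blast
    then have "hd xs \<in> V" unfolding edge_path_def by auto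
    \<comment> \<open>The neighbour is chosen different from the second vertex of the path, so that
      the chord skips at least one vertex; this gives \<open>2 \<le> length s\<close> below.\<close>
    then obtain u where u: "u \<in> nbrs E (hd xs)" "u \<noteq> xs ! 1" using third[of "hd xs" "xs ! 1" "xs ! 1"] by auto
    then have "u \<in> set xs" using closed[OF xs] by blast
    then obtain s t where st: "xs = s @ u # t" by (meson split_list)
    have "u \<noteq> hd xs" using u noloop by auto
    then have "s \<noteq> []" using st by auto
    moreover have "length s \<noteq> 1" using u(2) st by (auto simp: nth_append)
    ultimately have "2 \<le> length s" by (cases s) (auto simp: Suc_le_eq)
    then have "chord s u t" using xs st u \<open>s \<noteq> []\<close> unfolding chord_def by auto
    then show ?thesis by blast
  qed
  obtain k where k: "\<exists>s h t. chord s h t \<and> length s = k" and kmin: "\<And>s h t. chord s h t \<Longrightarrow> k \<le> length s"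
    using ex_chord ex_has_least_nat[of "\<lambda>(s, h, t). chord s h t" _ "\<lambda>(s, h, t). length s"] by fast

  obtain s h t where st: "chord s h t" "length s = k" using k by blast
  \<comment> \<open>A neighbour of \<open>hd s\<close> other than its successor and \<open>h\<close>
    cannot lie in \<open>s\<close>, as it would end a chord with a shorter initial segment.\<close>
  have far: "\<exists>w\<in>set t. {hd s, w} \<in> E" if "chord s h t" "length s = k" for s
  proof -
    have p: "edge_path V E (s @ h # t)" "length (s @ h # t) = N" and s: "2 \<le> length s" "s \<noteq> []"
      using that unfolding chord_def by auto
    then have "hd s \<in> V" unfolding edge_path_def by auto
    then obtain w where w: "w \<in> nbrs E (hd s)" "w \<noteq> s ! 1" "w \<noteq> h" using third[of "hd s" "s ! 1" h] by auto
    have "w \<in> set (s @ h # t)" using closed[OF p] w(1) s(2) by auto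
    moreover have "w \<notin> set s"
    proof
      assume "w \<in> set s"
      then obtain s1 s2 where s12: "s = s1 @ w # s2" by (meson split_list)
      have "w \<noteq> hd s" using w noloop by auto
      then have "s1 \<noteq> []" using s12 by auto
      moreover have "length s1 \<noteq> 1" using w(2) s12 by (auto simp: nth_append)
      ultimately have "2 \<le> length s1" by (cases s1) (auto simp: Suc_le_eq)
      then have "chord s1 w (s2 @ h # t)" using p s12 w \<open>s1 \<noteq> []\<close> unfolding chord_def by auto
      then show False using kmin[of s1] that(2) s12 by simp
    qed
    ultimately show ?thesis using w by auto
  qed
  have rev_chord: "chord (rev s) h t"
    using st unfolding chord_def edge_path_def
    by (auto simp: path_edges_append path_edges_rev hd_rev last_rev insert_commute)
  \<comment> \<open>The branch vertices are \<open>h\<close>, the two ends of \<open>s\<close>, and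
    \<open>w\<close>. Here \<open>w\<close>, a neighbour of the first end, comes in \<open>t\<close>
    no later than \<open>w'\<close>, a neighbour of the last end.\<close>
  have main: False if c: "chord s h t" and w: "t = t1 @ w # t2" "w' \<in> set (w # t2)"
    "{hd s, w} \<in> E" "{last s, w'} \<in> E" for s t1 t2 w w'
  proof -
    obtain x q p where s: "s = x # q @ [p]"
    proof (cases s)
      case (Cons x s')
      then have "s' \<noteq> []" using c unfolding chord_def by auto
      then show ?thesis using that[of x "butlast s'" "last s'"] Cons by simp
    qed (use c in \<open>auto simp: chord_def\<close>)
    obtain r r' where r: "w # t2 = r @ w' # r'" using split_list[OF w(2)] by blast
    \<comment> \<open>The connection from \<open>w\<close> to \<open>p\<close> runs along
      \<open>t\<close> up to \<open>w'\<close> and then jumps to \<open>p\<close>; \<open>t'\<close>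
      collects its inner vertices and is empty when \<open>w = w'\<close>.\<close>
    obtain t' where t': "r @ [w'] @ [p] = w # t' @ [p]" "set t' \<subseteq> set t2" "distinct t2 \<longrightarrow> distinct t'"
      "path_edges (r @ [w']) \<subseteq> path_edges (w # t2)" "last (w # t') = w'"
    proof (cases r)
      case Nil
      then show ?thesis using that[of "[]"] r by auto
    next
      case (Cons a r2)
      then have a: "a = w" "t2 = r2 @ w' # r'" using r by auto
      have "path_edges ((w # r2 @ [w']) @ r') = path_edges (w # t2)" using a by simp
      then have "path_edges (w # r2 @ [w']) \<subseteq> path_edges (w # t2)"
        using path_edges_append[of "w # r2 @ [w']" r'] by blast
      then show ?thesis using a Cons by (intro that[of "r2 @ [w']"]) auto
    qed
    have path: "distinct (s @ h # t)" "path_edges (s @ h # t) \<subseteq> E" "{x, h} \<in> E"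
      using c s unfolding chord_def edge_path_def by auto
    have dist: "distinct (x # q @ [p] @ h # t1 @ w # t')" using path(1) t' unfolding s w(1) by auto
    have pe: "path_edges (x # q @ [p]) \<subseteq> E" "{p, h} \<in> E" "path_edges (h # t1 @ [w]) \<subseteq> E" "path_edges (w # t2) \<subseteq> E"
      using path(2) unfolding s w(1) by (auto simp: path_edges_append path_edges_Cons split: if_splits)
    have "path_edges (w # t' @ [p]) \<subseteq> E"
      using pe(4) t'(4) w(4) unfolding t'(1)[symmetric] s
      by (auto simp: path_edges_append insert_commute)
    then show False
      using subdivided_K4_not_outerplanar[OF op EV dist pe(1,3) _ path(3) pe(2)] w(3) unfolding s by auto
  qed
  obtain w where w: "w \<in> set t" "{hd s, w} \<in> E" using far[OF st] by blast
  obtain w' where w': "w' \<in> set t" "{last s, w'} \<in> E"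
    using far[OF rev_chord] st unfolding chord_def by (auto simp: hd_rev)
  obtain t1 t2 where t: "t = t1 @ w # t2" using split_list[OF w(1)] by blast
  show False
  proof (cases "w' \<in> set (w # t2)")
    case True
    then show False using main[OF st(1) t _ w(2) w'(2)] by blast
  next
    case False
    \<comment> \<open>Here \<open>w'\<close> comes before \<open>w\<close>, and reversing
      \<open>s\<close> exchanges the roles of its two ends.\<close>
    then obtain r r' where "t1 = r @ w' # r'" using w'(1) t split_list[of w' t1] by auto
    then have "t = r @ w' # (r' @ w # t2)" using t by simp
    moreover have "{hd (rev s), w'} \<in> E" "{last (rev s), w} \<in> E" using w w' st
      unfolding chord_def by (auto simp: hd_rev last_rev)
    ultimately show False using main[OF rev_chord, of r w' "r' @ w # t2" w] by auto
  qed
qed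

section \<open>Vertex deletion, and low-degree vertices away from a vertex or an edge\<close>

abbreviation del :: "'a set set \<Rightarrow> 'a \<Rightarrow> 'a set set" where
  "del E v \<equiv> {e \<in> E. v \<notin> e}"

lemma outerplanar_graphD:
  assumes "outerplanar_graph V E"
  shows "finite V" "finite E" "\<And>e. e \<in> E \<Longrightarrow> e \<subseteq> V" "\<And>u v. {u, v} \<in> E \<Longrightarrow> u \<noteq> v \<and> u \<in> V \<and> v \<in> V"
    and "\<And>e. e \<in> E \<Longrightarrow> card e = 2" "\<And>v. finite (nbrs E v)"
proof -
  show f: "finite V" and s: "\<And>e. e \<in> E \<Longrightarrow> e \<subseteq> V" and c: "\<And>e. e \<in> E \<Longrightarrow> card e = 2"
    using assms unfolding outerplanar_graph_def simple_graph_def by auto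
  show "finite E" using f s by (meson Pow_iff finite_Pow_iff finite_subset subsetI)
  show *: "u \<noteq> v \<and> u \<in> V \<and> v \<in> V" if "{u, v} \<in> E" for u v using c[OF that] s[OF that] by auto
  show "finite (nbrs E v)" for v by (rule finite_subset[OF _ f]) (use * in auto)
qed

lemma outerplanar_graph_subgraph:
  assumes "outerplanar_graph V E" "E' \<subseteq> E"
  shows "outerplanar_graph V E'"
proof -
  have "outerplanar V E'"
  proof (rule outerplanar_subgraph[of V E])
    show "outerplanar V E" using assms(1) unfolding outerplanar_graph_def by simp
    show "e \<subseteq> V" if "e \<in> E'" for e using that assms(2) outerplanar_graphD(3)[OF assms(1), of e] by auto
  qed (use assms(2) in auto)
  then show ?thesis using assms unfolding outerplanar_graph_def simple_graph_def by auto
qed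

lemma outerplanar_graph_del:
  assumes "outerplanar_graph V E"
  shows "outerplanar_graph (V - {v}) (del E v)"
proof -
  have "outerplanar (V - {v}) (del E v)"
  proof (rule outerplanar_subgraph[of V E])
    show "outerplanar V E" using assms unfolding outerplanar_graph_def by simp
    show "e \<subseteq> V - {v}" if "e \<in> del E v" for e using that outerplanar_graphD(3)[OF assms, of e] by auto
  qed auto
  then show ?thesis using assms unfolding outerplanar_graph_def simple_graph_def by auto
qed

lemma outerplanar_graph_smooth:
  assumes "outerplanar_graph V E" "{v, a} \<in> E" "{v, b} \<in> E" "a \<noteq> b"
  shows "outerplanar_graph (V - {v}) (insert {a, b} (del E v))"
proof -
  have "a \<in> V" "b \<in> V" "v \<noteq> a" "v \<noteq> b" using outerplanar_graphD(4)[OF assms(1)] assms(2,3) by auto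
  then show ?thesis
    using assms outerplanar_smooth[of V E a b v] unfolding outerplanar_graph_def simple_graph_def
    by (auto simp: card_insert_if)
qed

lemma nbrs_sym: "u \<in> nbrs E v \<longleftrightarrow> v \<in> nbrs E u"
  by (simp add: insert_commute)

lemma nbrs_del: "v \<noteq> w \<Longrightarrow> nbrs (del E v) w = nbrs E w - {v}"
  by auto

lemma nbrs_insert: "w \<notin> {a, b} \<Longrightarrow> nbrs (insert {a, b} E) w = nbrs E w"
  "a \<noteq> b \<Longrightarrow> nbrs (insert {a, b} E) a = insert b (nbrs E a)"
  "a \<noteq> b \<Longrightarrow> nbrs (insert {a, b} E) b = insert a (nbrs E b)"
  by (auto simp: doubleton_eq_iff)

lemma card_le_2E:
  assumes "card S \<le> 2" "finite S"
  obtains "S = {}" | a where "S = {a}" | a b where "S = {a, b}" "a \<noteq> b"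
proof -
  consider "card S = 0" | "card S = 1" | "card S = 2" using assms(1) by linarith
  then show thesis using that assms(2) by cases (auto simp: card_2_iff card_1_singleton_iff)
qed

text \<open>The two claims need each other in the induction. If the low-degree vertex found is an
  end \<open>a\<close> of the edge \<open>a b\<close>, then \<open>a\<close> is deleted and, if it
  has a second neighbour \<open>e\<close>, replaced by an edge \<open>b e\<close>. The hypothesis
  for that edge, or for \<open>b\<close> alone, yields a vertex not adjacent to \<open>a\<close>,
  whose degree is therefore the same as before. Avoiding a single vertex \<open>y\<close> reduces to
  avoiding an edge at \<open>y\<close>, or to deleting \<open>y\<close> if it is isolated.\<close>

lemma low_degree_vertex_avoiding:
  assumes "outerplanar_graph V E"
  shows "V - {y} \<noteq> {} \<Longrightarrow> \<exists>v\<in>V - {y}. card (nbrs E v) \<le> 2"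
    and "{a, b} \<in> E \<Longrightarrow> V - {a, b} \<noteq> {} \<Longrightarrow> \<exists>v\<in>V - {a, b}. card (nbrs E v) \<le> 2"
proof -
  have "(\<forall>y. V - {y} \<noteq> {} \<longrightarrow> (\<exists>v\<in>V - {y}. card (nbrs E v) \<le> 2)) \<and>
    (\<forall>a b. {a, b} \<in> E \<longrightarrow> V - {a, b} \<noteq> {} \<longrightarrow> (\<exists>v\<in>V - {a, b}. card (nbrs E v) \<le> 2))"
    using assms
  proof (induction "card V" arbitrary: V E rule: less_induct)
    case less
    note G = less.prems and D = outerplanar_graphD[OF less.prems]
    have small: "card (V - {v}) < card V" if "v \<in> V" for v
      using that D(1) by (meson card_Diff1_less)
    have edge: "\<exists>v\<in>V - {a, b}. card (nbrs E v) \<le> 2"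
      if ab: "{a, b} \<in> E" "V - {a, b} \<noteq> {}" and a: "card (nbrs E a) \<le> 2" for a b
    proof -
      have aV: "a \<in> V" "b \<in> V" "a \<noteq> b" "b \<in> nbrs E a" using D(4)[OF ab(1)] ab by auto
      show ?thesis using a D(6)
      proof (cases rule: card_le_2E)
        case 1
        then show ?thesis using aV by auto
      next
        case (2 c)
        then have nb: "nbrs E a = {b}" using aV by auto
        have "V - {a} - {b} \<noteq> {}" using ab(2) by auto
        then obtain w where w: "w \<in> V - {a} - {b}" "card (nbrs (del E a) w) \<le> 2"
          using less.hyps[OF small[OF aV(1)] outerplanar_graph_del[OF G]] by blast
        have "a \<notin> nbrs E w" using nb w nbrs_sym[of a w E] by auto
        then have "nbrs (del E a) w = nbrs E w" using w nbrs_del[of a w E] by auto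
        then show ?thesis using w by auto
      next
        case (3 c d)
        then obtain e where e: "nbrs E a = {b, e}" "e \<noteq> b" using aV by auto
        then have eV: "e \<in> V" "e \<noteq> a" "{a, e} \<in> E" using D(4)[of a e] by auto
        show ?thesis
        proof (cases "V - {a} - {b, e} = {}")
          case True
          \<comment> \<open>Only \<open>a\<close>, \<open>b\<close> and \<open>e\<close> are left,
            so \<open>e\<close> itself qualifies.\<close>
          then have "nbrs E e \<subseteq> {a, b}" using D(4)[of e] by auto
          then have "card (nbrs E e) \<le> card {a, b}" by (rule card_mono[rotated]) simp
          also have "card {a, b} \<le> 2" by (simp add: card_insert_if)
          finally show ?thesis using eV e aV by blast
        next
          case False
          have G': "outerplanar_graph (V - {a}) (insert {b, e} (del E a))"
            by (rule outerplanar_graph_smooth[OF G ab(1) eV(3) e(2)[symmetric]])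
          obtain w where w: "w \<in> V - {a} - {b, e}" "card (nbrs (insert {b, e} (del E a)) w) \<le> 2"
            using less.hyps[OF small[OF aV(1)] G'] False by blast
          have "a \<notin> nbrs E w" using e w nbrs_sym[of a w E] by auto
          then have "nbrs (insert {b, e} (del E a)) w = nbrs E w"
            using w nbrs_del[of a w E] nbrs_insert(1)[of w b e "del E a"] by auto
          then show ?thesis using w by auto
        qed
      qed
    qed
    have L1: "\<exists>v\<in>V - {a, b}. card (nbrs E v) \<le> 2" if ab: "{a, b} \<in> E" "V - {a, b} \<noteq> {}" for a b
    proof -
      obtain v where v: "v \<in> V" "card (nbrs E v) \<le> 2"
        using outerplanar_graph_has_low_degree_vertex[OF G] ab by auto
      consider "v = a" | "v = b" | "v \<in> V - {a, b}" using v by auto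
      then show ?thesis
        using edge[OF ab] edge[of b a] ab v by cases (auto simp: insert_commute)
    qed
    have L0: "\<exists>v\<in>V - {y}. card (nbrs E v) \<le> 2" if y: "V - {y} \<noteq> {}" for y
    proof (cases "nbrs E y = {}")
      case True
      obtain v where v: "v \<in> V - {y}" "card (nbrs (del E y) v) \<le> 2"
        using outerplanar_graph_has_low_degree_vertex[OF outerplanar_graph_del[OF G] y] by auto
      have "y \<notin> nbrs E v" using True nbrs_sym[of y v E] by auto
      then have "nbrs (del E y) v = nbrs E v" using v nbrs_del[of y v E] by auto
      then show ?thesis using v by auto
    next
      case False
      then obtain b where b: "{y, b} \<in> E" by auto
      show ?thesis
      proof (cases "V - {y, b} = {}")
        case True
        then have "nbrs E b \<subseteq> {y}" using D(4)[of b] by auto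
        then have "card (nbrs E b) \<le> card {y}" by (rule card_mono[rotated]) simp
        then have "card (nbrs E b) \<le> 2" by simp
        then show ?thesis using D(4)[OF b] by blast
      next
        case False
        then show ?thesis using L1[OF b False] by blast
      qed
    qed
    show ?case using L0 L1 by blast
  qed
  then show "V - {y} \<noteq> {} \<Longrightarrow> \<exists>v\<in>V - {y}. card (nbrs E v) \<le> 2"
    "{a, b} \<in> E \<Longrightarrow> V - {a, b} \<noteq> {} \<Longrightarrow> \<exists>v\<in>V - {a, b}. card (nbrs E v) \<le> 2" by blast+
qed

section \<open>Coefficients of graph polynomials\<close>

lemma mcoeff_simps [simp]:
  "mcoeff (p + q) m = mcoeff p m + mcoeff q m"
  "mcoeff (p - q) m = mcoeff p m - mcoeff q m"
  "mcoeff (- p) m = - mcoeff p m"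
  "mcoeff 0 m = 0"
  by (simp_all add: mcoeff_def lookup_add lookup_minus)

lemma lookup_single_mult:
  fixes p :: "'a::cancel_comm_monoid_add \<Rightarrow>\<^sub>0 'b::comm_ring_1"
  shows "Poly_Mapping.lookup (Poly_Mapping.single k 1 * p) (k + m) = Poly_Mapping.lookup p m"
  by (simp add: lookup_mult lookup_single when_mult)

lemma lookup_single_mult_0:
  fixes p :: "'a::cancel_comm_monoid_add \<Rightarrow>\<^sub>0 'b::comm_ring_1"
  assumes "\<And>q. m \<noteq> k + q"
  shows "Poly_Mapping.lookup (Poly_Mapping.single k 1 * p) m = 0"
  using assms by (simp add: lookup_mult lookup_single when_mult)

abbreviation expo :: "'a monomial \<Rightarrow> 'a \<Rightarrow> nat" where
  "expo \<equiv> Poly_Mapping.lookup"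

lemma expo_var_pow: "expo (var_pow v k) u = (if u = v then k else 0)"
  by (simp add: var_pow_def lookup_single when_def)

lemma var_pow_0 [simp]: "var_pow v 0 = 0"
  by (simp add: var_pow_def)

lemma expo_add [simp]: "expo (m + m') v = expo m v + expo m' v"
  by (rule lookup_add)

lemma mcoeff_3_mult: "mcoeff (3 * p) m = 3 * mcoeff p m"
proof -
  have "3 * p = p + (p + p)" by (simp add: algebra_simps)
  then have "mcoeff (3 * p) m = mcoeff (p + (p + p)) m" by (rule arg_cong)
  then show ?thesis unfolding mcoeff_simps by simp
qed

definition free_of :: "'a \<Rightarrow> 'a int_mpoly \<Rightarrow> bool" where
  "free_of v p \<longleftrightarrow> (\<forall>m\<in>Poly_Mapping.keys p. expo m v = 0)"

lemma free_ofD: "free_of v p \<Longrightarrow> expo m v \<noteq> 0 \<Longrightarrow> mcoeff p m = 0"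
  unfolding free_of_def mcoeff_def by (meson in_keys_iff)

lemma free_of_intros [intro]:
  "free_of v p \<Longrightarrow> free_of v q \<Longrightarrow> free_of v (p + q)"
  "free_of v p \<Longrightarrow> free_of v q \<Longrightarrow> free_of v (p - q)"
  "free_of v p \<Longrightarrow> free_of v (- p)"
  "free_of v p \<Longrightarrow> free_of v q \<Longrightarrow> free_of v (p * q)"
  "free_of v 1"
  "u \<noteq> v \<Longrightarrow> free_of v (Var u)"
proof -
  show "free_of v p \<Longrightarrow> free_of v q \<Longrightarrow> free_of v (p + q)"
    using keys_add[of p q] unfolding free_of_def by blast
  show "free_of v p \<Longrightarrow> free_of v q \<Longrightarrow> free_of v (p - q)"
    using keys_diff[of p q] unfolding free_of_def by blast
  show "free_of v p \<Longrightarrow> free_of v (- p)"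
    unfolding free_of_def by (simp add: in_keys_iff)
  show "free_of v p \<Longrightarrow> free_of v q \<Longrightarrow> free_of v (p * q)"
    using keys_mult[of p q] unfolding free_of_def by fastforce
  show "free_of v 1" unfolding free_of_def by simp
  show "u \<noteq> v \<Longrightarrow> free_of v (Var u)"
    unfolding free_of_def Var_def var_pow_def by (simp add: lookup_single)
qed

lemma free_of_power [intro]: "free_of v p \<Longrightarrow> free_of v (p ^ n)"
  by (induction n) auto

lemma Var_power: "Var v ^ i = Poly_Mapping.single (var_pow v i) 1"
proof (induction i)
  case (Suc i)
  then show ?case
    by (simp add: Var_def var_pow_def mult_single flip: single_add)
qed simp

lemma mcoeff_Var_power_mult:
  "mcoeff (Var v ^ i * p) (m + var_pow v (i + j)) = mcoeff p (m + var_pow v j)"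
  unfolding mcoeff_def Var_power
  using lookup_single_mult[of "var_pow v i" p "m + var_pow v j"]
  by (simp add: var_pow_def single_add ac_simps)

lemma mcoeff_Var_power_mult_0:
  assumes "expo m v < i"
  shows "mcoeff (Var v ^ i * p) m = 0"
  unfolding mcoeff_def Var_power
proof (rule lookup_single_mult_0)
  fix q show "m \<noteq> var_pow v i + q" using assms by (auto simp: expo_var_pow)
qed

text \<open>This reads off one coefficient of a polynomial in \<open>v\<close> whose coefficients
  are free of \<open>v\<close>. Products below are expanded in powers of the vertex to be deleted in
  order to apply it.\<close>

lemma mcoeff_extract:
  assumes "free_of v p" "expo m v = 0"
  shows "mcoeff (Var v ^ i * p) (m + var_pow v j) = (if i = j then mcoeff p m else 0)"
proof (cases "i \<le> j")
  case True
  then obtain k where k: "j = i + k" using le_iff_add by blast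
  show ?thesis unfolding k mcoeff_Var_power_mult
    using free_ofD[OF assms(1), of "m + var_pow v k"] assms(2) by (auto simp: expo_var_pow)
next
  case False
  then show ?thesis using assms(2) by (auto intro!: mcoeff_Var_power_mult_0 simp: expo_var_pow)
qed

lemma mcoeff_extract':
  assumes "free_of v p" "expo m v = 0"
  shows "mcoeff (Var v * p) (m + var_pow v j) = (if j = 1 then mcoeff p m else 0)"
    and "mcoeff p (m + var_pow v j) = (if j = 0 then mcoeff p m else 0)"
  using mcoeff_extract[OF assms, of 1 j] mcoeff_extract[OF assms, of 0 j] by auto

lemma mcoeff_Var_mult_0: "expo m v = 0 \<Longrightarrow> mcoeff (Var v * p) m = 0"
  using mcoeff_Var_power_mult_0[of m v 1 p] by simp

section \<open>Graph polynomials up to sign\<close>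

definition sign_eq :: "'a::comm_ring_1 \<Rightarrow> 'a \<Rightarrow> bool" where
  "sign_eq p q \<longleftrightarrow> p = q \<or> p = - q"

lemma sign_eq_refl [simp]: "sign_eq p p"
  and sign_eq_sym: "sign_eq p q \<Longrightarrow> sign_eq q p"
  and sign_eq_trans [trans]: "sign_eq p q \<Longrightarrow> sign_eq q r \<Longrightarrow> sign_eq p r"
  and sign_eq_mult: "sign_eq p q \<Longrightarrow> sign_eq p' q' \<Longrightarrow> sign_eq (p * p') (q * q')"
  unfolding sign_eq_def by auto

lemma sign_eq_prod:
  "(\<And>a. a \<in> A \<Longrightarrow> sign_eq (f a) (g a)) \<Longrightarrow> sign_eq (prod f A) (prod g A)"
  by (induction A rule: infinite_finite_induct) (auto intro: sign_eq_mult)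

lemma sign_eq_mcoeff: "sign_eq p q \<Longrightarrow> (\<forall>m. mcoeff p m = mcoeff q m) \<or> (\<forall>m. mcoeff p m = - mcoeff q m)"
  unfolding sign_eq_def by auto

text \<open>An arbitrary orientation is chosen for each edge, which makes the polynomial a function
  of the edge set alone. Signs are thereby unspecified, so later comparisons are made by
  \<open>sign_eq\<close>.\<close>

definition edge_poly :: "'a set \<Rightarrow> 'a int_mpoly" where
  "edge_poly e = (SOME p. \<exists>u v. e = {u, v} \<and> u \<noteq> v \<and> p = Var u - Var v)"

lemma edge_poly: "u \<noteq> v \<Longrightarrow> sign_eq (edge_poly {u, v}) (Var u - Var v)"
proof -
  assume "u \<noteq> v"
  then have "\<exists>p a b. {u, v} = {a, b} \<and> a \<noteq> b \<and> p = (Var a - Var b :: 'a int_mpoly)" by blast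
  then have "\<exists>a b. {u, v} = {a, b} \<and> a \<noteq> b \<and> edge_poly {u, v} = Var a - Var b"
    unfolding edge_poly_def by (rule someI_ex)
  then show ?thesis unfolding sign_eq_def by (auto simp: doubleton_eq_iff)
qed

definition graph_poly :: "'a set set \<Rightarrow> 'a int_mpoly" where
  "graph_poly E = (\<Prod>e\<in>E. edge_poly e)"

lemma graph_poly_insert:
  assumes "finite E" "{u, v} \<notin> E" "u \<noteq> v"
  shows "sign_eq (graph_poly (insert {u, v} E)) ((Var u - Var v) * graph_poly E)"
  using assms by (auto simp: graph_poly_def intro!: sign_eq_mult edge_poly)

lemma graph_polynomial_sign_eq_graph_poly:
  assumes "orientation_of D E" "\<And>e. e \<in> E \<Longrightarrow> card e = 2"
  shows "sign_eq (graph_polynomial D) (graph_poly E)"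
proof -
  have bij: "bij_betw (\<lambda>(u, v). {u, v}) D E" using assms(1) unfolding orientation_of_def .
  have "graph_poly E = (\<Prod>d\<in>D. edge_poly ((\<lambda>(u, v). {u, v}) d))"
    unfolding graph_poly_def by (rule prod.reindex_bij_betw[OF bij, symmetric])
  moreover have "sign_eq (graph_polynomial D) (\<Prod>d\<in>D. edge_poly ((\<lambda>(u, v). {u, v}) d))"
    unfolding graph_polynomial_def
  proof (rule sign_eq_prod)
    fix d assume d: "d \<in> D"
    obtain u v where uv: "d = (u, v)" by (cases d)
    have "{u, v} \<in> E" using bij d uv unfolding bij_betw_def by auto
    then have "u \<noteq> v" using assms(2)[of "{u, v}"] by auto
    then show "sign_eq (case d of (u, v) \<Rightarrow> Var u - Var v) (edge_poly (case d of (u, v) \<Rightarrow> {u, v}))"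
      using edge_poly sign_eq_sym uv by fastforce
  qed
  ultimately show ?thesis by simp
qed

lemma graph_poly_split:
  assumes "finite E" "\<And>e. e \<in> E \<Longrightarrow> card e = 2"
  shows "sign_eq (graph_poly E) ((\<Prod>u\<in>{u. {v, u} \<in> E}. Var v - Var u) * graph_poly {e \<in> E. v \<notin> e})"
proof -
  have inj: "inj_on (\<lambda>u. {v, u}) {u. {v, u} \<in> E}" by (auto simp: inj_on_def doubleton_eq_iff)
  have star: "{e \<in> E. v \<in> e} = (\<lambda>u. {v, u}) ` {u. {v, u} \<in> E}"
  proof
    show "{e \<in> E. v \<in> e} \<subseteq> (\<lambda>u. {v, u}) ` {u. {v, u} \<in> E}"
    proof
      fix e assume e: "e \<in> {e \<in> E. v \<in> e}"
      then obtain a b where "e = {a, b}" using assms(2)[of e] by (auto simp: card_2_iff)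
      then show "e \<in> (\<lambda>u. {v, u}) ` {u. {v, u} \<in> E}" using e by (auto simp: insert_commute)
    qed
  qed auto
  have "graph_poly E = graph_poly {e \<in> E. v \<in> e} * graph_poly {e \<in> E. v \<notin> e}"
  proof -
    have "E = {e \<in> E. v \<in> e} \<union> {e \<in> E. v \<notin> e}" by auto
    then have "graph_poly E = graph_poly ({e \<in> E. v \<in> e} \<union> {e \<in> E. v \<notin> e})" by simp
    also have "\<dots> = graph_poly {e \<in> E. v \<in> e} * graph_poly {e \<in> E. v \<notin> e}"
      unfolding graph_poly_def using assms(1) by (intro prod.union_disjoint) auto
    finally show ?thesis .
  qed
  moreover have "graph_poly {e \<in> E. v \<in> e} = (\<Prod>u\<in>{u. {v, u} \<in> E}. edge_poly {v, u})"
    unfolding graph_poly_def star by (simp add: prod.reindex[OF inj])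
  moreover have "sign_eq (\<Prod>u\<in>{u. {v, u} \<in> E}. edge_poly {v, u}) (\<Prod>u\<in>{u. {v, u} \<in> E}. Var v - Var u)"
  proof (rule sign_eq_prod)
    fix u assume "u \<in> {u. {v, u} \<in> E}"
    then have "v \<noteq> u" using assms(2)[of "{v, u}"] by auto
    then show "sign_eq (edge_poly {v, u}) (Var v - Var u)" by (rule edge_poly)
  qed
  ultimately show ?thesis by (auto intro: sign_eq_mult)
qed

lemma free_of_graph_poly:
  assumes "\<And>e. e \<in> E \<Longrightarrow> card e = 2" "\<And>e. e \<in> E \<Longrightarrow> v \<notin> e"
  shows "free_of v (graph_poly E)"
  using assms
proof (induction E rule: infinite_finite_induct)
  case (insert e E)
  obtain a b where ab: "e = {a, b}" "a \<noteq> b" using insert.prems(1)[of e] by (auto simp: card_2_iff)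
  then have "free_of v (Var a - Var b)" using insert.prems(2)[of e] by auto
  then have "free_of v (edge_poly e)"
    using edge_poly[OF ab(2)] free_of_intros(3)[of v "Var a - Var b"] unfolding sign_eq_def ab(1) by metis
  moreover have "free_of v (graph_poly E)" using insert by simp
  ultimately show ?case using insert.hyps free_of_intros(4) by (simp add: graph_poly_def)
qed (auto simp: graph_poly_def)

section \<open>Monomials avoiding given vertices\<close>

lemma free_of_numeral [intro]: "free_of v (numeral k)"
  unfolding free_of_def
  using keys_single[of "0 :: 'a monomial" "numeral k :: int"] by (simp add: single_numeral split: if_splits)

lemma graph_poly_insert_edge:
  assumes "outerplanar_graph V E" "{u, v} \<in> E"
  shows "sign_eq (graph_poly E) ((Var u - Var v) * graph_poly (E - {{u, v}}))"
proof -
  have "sign_eq (graph_poly (insert {u, v} (E - {{u, v}}))) ((Var u - Var v) * graph_poly (E - {{u, v}}))"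
    using outerplanar_graphD(2)[OF assms(1)] outerplanar_graphD(4)[OF assms] by (intro graph_poly_insert) auto
  then show ?thesis using assms(2) by (simp only: insert_Diff)
qed

lemma graph_poly_remove:
  assumes "outerplanar_graph V E"
  shows "sign_eq (graph_poly E) ((\<Prod>u\<in>nbrs E v. Var v - Var u) * graph_poly (del E v))" "free_of v (graph_poly (del E v))"
proof -
  note D = outerplanar_graphD[OF assms]
  show "sign_eq (graph_poly E) ((\<Prod>u\<in>nbrs E v. Var v - Var u) * graph_poly (del E v))"
    by (rule graph_poly_split[OF D(2) D(5)])
  show "free_of v (graph_poly (del E v))"
    by (rule free_of_graph_poly) (simp_all add: D(5))
qed

text \<open>With \<open>S\<close> the set of neighbours of \<open>v\<close> this is the leading
  coefficient in \<open>v\<close>: giving a deleted vertex its full degree as exponent restores the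
  coefficients of the smaller polynomial, and degree at most 2 keeps the exponent
  admissible.\<close>

lemma top_mcoeff:
  assumes "free_of v q" "expo m v = 0" "v \<notin> S" "finite S" "card S \<le> 2"
  shows "mcoeff ((\<Prod>u\<in>S. Var v - Var u) * q) (m + var_pow v (card S)) = mcoeff q m"
  using assms(5,4)
proof (cases rule: card_le_2E)
  case 1
  then show ?thesis by simp
next
  case (2 a)
  then have "(\<Prod>u\<in>S. Var v - Var u) * q = Var v * q - Var a * q" "free_of v (Var a * q)"
    using assms by (auto simp: algebra_simps)
  then show ?thesis using 2 assms by (simp add: mcoeff_extract')
next
  case (3 a b)
  then have "(\<Prod>u\<in>S. Var v - Var u) * q = Var v ^ 2 * q - Var v * ((Var a + Var b) * q) + Var a * Var b * q"
    by (simp add: algebra_simps power2_eq_square)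
  moreover have "free_of v ((Var a + Var b) * q)" "free_of v (Var a * Var b * q)"
    using assms 3 by auto
  ultimately show ?thesis using 3 assms by (simp add: mcoeff_extract' mcoeff_extract)
qed

text \<open>\<open>W\<close> lists the vertices that must have exponent 0. The coefficient has to be
  nonzero modulo 3, because doubled edges are controlled only modulo 3.\<close>

definition small_monomial :: "'a int_mpoly \<Rightarrow> 'a set \<Rightarrow> bool" where
  "small_monomial p W \<longleftrightarrow> (\<exists>m. (\<forall>u. expo m u \<le> 2) \<and> (\<forall>u\<in>W. expo m u = 0) \<and> \<not> 3 dvd mcoeff p m)"

lemma small_monomialI: "(\<And>u. expo m u \<le> 2) \<Longrightarrow> (\<And>u. u \<in> W \<Longrightarrow> expo m u = 0) \<Longrightarrow> \<not> 3 dvd mcoeff p m \<Longrightarrow> small_monomial p W"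
  unfolding small_monomial_def by (intro exI[of _ m]) simp

text \<open>A nonvanishing monomial cannot contain a variable absent from \<open>p\<close>, so a
  deleted vertex has exponent 0 and its exponent can be set afresh.\<close>

lemma small_monomialD:
  assumes "small_monomial p W"
  shows "\<exists>m. (\<forall>u. expo m u \<le> 2) \<and> (\<forall>u\<in>W. expo m u = 0) \<and> \<not> 3 dvd mcoeff p m \<and>
    (\<forall>v. free_of v p \<longrightarrow> expo m v = 0)"
proof -
  obtain m where m: "\<forall>u. expo m u \<le> 2" "\<forall>u\<in>W. expo m u = 0" "\<not> 3 dvd mcoeff p m"
    using assms unfolding small_monomial_def by blast
  have "expo m v = 0" if "free_of v p" for v
    by (rule ccontr) (use free_ofD[OF that, of m] m(3) in simp)
  then show ?thesis using m by blast
qed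

lemma small_monomial_sign_eq: "sign_eq p q \<Longrightarrow> small_monomial q W \<Longrightarrow> small_monomial p W"
  using sign_eq_mcoeff[of p q] unfolding small_monomial_def by auto

text \<open>The extra factor \<open>g\<close> is \<open>1\<close> or the second copy
  \<open>c - d\<close> of an edge that avoids \<open>v\<close>.\<close>

lemma small_monomial_remove:
  assumes G: "outerplanar_graph V E" and v: "card (nbrs E v) \<le> 2" "v \<notin> W"
    and "free_of v g" "small_monomial (g * graph_poly (del E v)) W"
  shows "small_monomial (g * graph_poly E) W"
proof -
  have free: "free_of v (g * graph_poly (del E v))" using graph_poly_remove(2)[OF G] assms(4) by auto
  obtain m where m: "\<And>u. expo m u \<le> 2" "\<And>u. u \<in> W \<Longrightarrow> expo m u = 0" "\<not> 3 dvd mcoeff (g * graph_poly (del E v)) m"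
    "expo m v = 0" using small_monomialD[OF assms(5)] free by blast
  have vn: "v \<notin> nbrs E v" "finite (nbrs E v)" using outerplanar_graphD(4)[OF G, of v v] outerplanar_graphD(6)[OF G] by auto
  have "sign_eq (g * graph_poly E) (g * ((\<Prod>u\<in>nbrs E v. Var v - Var u) * graph_poly (del E v)))"
    by (intro sign_eq_mult sign_eq_refl graph_poly_remove(1)[OF G])
  then have "sign_eq (g * graph_poly E) ((\<Prod>u\<in>nbrs E v. Var v - Var u) * (g * graph_poly (del E v)))"
    by (simp add: ac_simps)
  moreover have "small_monomial ((\<Prod>u\<in>nbrs E v. Var v - Var u) * (g * graph_poly (del E v))) W"
  proof (rule small_monomialI)
    show "\<not> 3 dvd mcoeff ((\<Prod>u\<in>nbrs E v. Var v - Var u) * (g * graph_poly (del E v))) (m + var_pow v (card (nbrs E v)))"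
      using top_mcoeff[OF free m(4) vn v(1)] m(3) by simp
    show "expo (m + var_pow v (card (nbrs E v))) u \<le> 2" for u using m(1)[of u] m(4) v(1) by (simp add: expo_var_pow)
    show "expo (m + var_pow v (card (nbrs E v))) u = 0" if "u \<in> W" for u
      using m(2)[OF that] that v(2) by (auto simp: expo_var_pow)
  qed
  ultimately show ?thesis by (rule small_monomial_sign_eq)
qed

lemma small_monomial_graph_poly_remove:
  assumes "outerplanar_graph V E" "card (nbrs E v) \<le> 2" "v \<notin> W" "small_monomial (graph_poly (del E v)) W"
  shows "small_monomial (graph_poly E) W"
  using small_monomial_remove[OF assms(1-3) free_of_intros(5)] assms(4) by simp

lemma small_monomial_graph_poly_empty: "small_monomial (graph_poly {}) W"
  by (rule small_monomialI[of 0]) (simp_all add: graph_poly_def mcoeff_def lookup_one)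

lemma small_monomial_graph_poly_avoiding_vertex:
  assumes "outerplanar_graph V E"
  shows "small_monomial (graph_poly E) {y}"
  using assms
proof (induction "card V" arbitrary: V E rule: less_induct)
  case less
  note D = outerplanar_graphD[OF less.prems]
  show ?case
  proof (cases "V - {y} = {}")
    case True
    have "E = {}"
    proof (rule equals0I)
      fix e assume e: "e \<in> E"
      have "card e \<le> card {y}" using D(3)[OF e] True by (intro card_mono) auto
      then show False using D(5)[OF e] by simp
    qed
    then show ?thesis using small_monomial_graph_poly_empty by simp
  next
    case False
    then obtain v where v: "v \<in> V - {y}" "card (nbrs E v) \<le> 2"
      using low_degree_vertex_avoiding(1)[OF less.prems] by blast
    have "small_monomial (graph_poly (del E v)) {y}"
      using v D(1) by (intro less.hyps[OF _ outerplanar_graph_del[OF less.prems]] card_Diff1_less) auto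
    then show ?thesis using v by (intro small_monomial_graph_poly_remove[OF less.prems v(2)]) auto
  qed
qed

text \<open>For the choice of \<open>v\<close> the edge \<open>a b\<close> is present, so that a
  low-degree vertex off \<open>a\<close> and \<open>b\<close> exists. In the polynomial it must be
  absent, as each term of the factor \<open>a - b\<close> contains \<open>a\<close> or
  \<open>b\<close>.\<close>

lemma small_monomial_graph_poly_avoiding_edge:
  assumes "outerplanar_graph V (insert {a, b} E)" "{a, b} \<notin> E"
  shows "small_monomial (graph_poly E) {a, b}"
  using assms
proof (induction "card V" arbitrary: V E rule: less_induct)
  case less
  let ?E = "insert {a, b} E"
  note D = outerplanar_graphD[OF less.prems(1)]
  have G: "outerplanar_graph V E" by (rule outerplanar_graph_subgraph[OF less.prems(1)]) blast
  show ?case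
  proof (cases "V - {a, b} = {}")
    case True
    have "E = {}"
    proof (rule equals0I)
      fix e assume e: "e \<in> E"
      then have e': "e \<in> ?E" by simp
      have "e \<subseteq> {a, b}" "card e = 2" using D(3)[OF e'] D(5)[OF e'] True by (blast, simp)
      moreover have "card {a, b} = 2" using D(5) by blast
      ultimately have "e = {a, b}" using card_subset_eq[of "{a, b}" e] by simp
      then show False using e less.prems(2) by simp
    qed
    then show ?thesis using small_monomial_graph_poly_empty by simp
  next
    case False
    then obtain v where v: "v \<in> V - {a, b}" "card (nbrs ?E v) \<le> 2"
      using low_degree_vertex_avoiding(2)[OF less.prems(1)] by blast
    have vE: "card (nbrs E v) \<le> 2" using v nbrs_insert(1)[of v a b E] by simp
    have del: "del ?E v = insert {a, b} (del E v)" using v by auto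
    have "small_monomial (graph_poly (del E v)) {a, b}"
      using v D(1) less.prems(2) outerplanar_graph_del[OF less.prems(1), of v] unfolding del
      by (intro less.hyps[of "V - {v}"] card_Diff1_less) auto
    then show ?thesis using v by (intro small_monomial_graph_poly_remove[OF G vE]) auto
  qed
qed

section \<open>Doubled edges\<close>

text \<open>The product is \<open>(c - d)^2\<close> times the polynomial without the edge. From the
  square one takes the power of the end other than \<open>y\<close>, from the rest a monomial
  avoiding both ends.\<close>

lemma small_monomial_square_edge:
  assumes "outerplanar_graph V E" "{c, d} \<in> E" "y \<in> {c, d}"
  shows "small_monomial ((Var c - Var d) * graph_poly E) {y}"
proof -
  have cd: "c \<noteq> d" using outerplanar_graphD(4)[OF assms(1,2)] by simp
  let ?E = "E - {{c, d}}"
  have "small_monomial (graph_poly ?E) {c, d}"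
    by (rule small_monomial_graph_poly_avoiding_edge[of V]) (use assms(1,2) in \<open>simp_all add: insert_absorb\<close>)
  then obtain m where "\<forall>u. expo m u \<le> 2" "\<forall>u\<in>{c, d}. expo m u = 0" and m4: "\<not> 3 dvd mcoeff (graph_poly ?E) m"
    unfolding small_monomial_def by blast
  then have m: "\<And>u. expo m u \<le> 2" "expo m c = 0" "expo m d = 0" "\<not> 3 dvd mcoeff (graph_poly ?E) m" by simp_all
  have "sign_eq ((Var c - Var d) * graph_poly E) ((Var c - Var d) * ((Var c - Var d) * graph_poly ?E))"
    by (intro sign_eq_mult sign_eq_refl graph_poly_insert_edge[OF assms(1,2)])
  also have "(Var c - Var d) * ((Var c - Var d) * graph_poly ?E)
    = Var c ^ 2 * graph_poly ?E - Var c * (Var d * (2 * graph_poly ?E)) + Var d ^ 2 * graph_poly ?E"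
    by (simp add: algebra_simps power2_eq_square)
  finally have "sign_eq ((Var c - Var d) * graph_poly E)
    (Var c ^ 2 * graph_poly ?E - Var c * (Var d * (2 * graph_poly ?E)) + Var d ^ 2 * graph_poly ?E)" .
  moreover have "small_monomial (Var c ^ 2 * graph_poly ?E - Var c * (Var d * (2 * graph_poly ?E)) + Var d ^ 2 * graph_poly ?E) {y}"
  proof -
    have other: "mcoeff (Var c ^ 2 * graph_poly ?E - Var c * (Var d * (2 * graph_poly ?E)) + Var d ^ 2 * graph_poly ?E) (m + var_pow u 2)
        = mcoeff (graph_poly ?E) m" if u: "u = c \<and> w = d \<or> u = d \<and> w = c" for u w
    proof -
      have 0: "mcoeff (Var w * q) (m + var_pow u 2) = 0" "mcoeff (Var w ^ 2 * q) (m + var_pow u 2) = 0" for q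
        using u m(2,3) cd
        by (auto intro!: mcoeff_Var_mult_0 mcoeff_Var_power_mult_0 simp: expo_var_pow)
      have 1: "mcoeff (Var u ^ 2 * graph_poly ?E) (m + var_pow u 2) = mcoeff (graph_poly ?E) m"
        using mcoeff_Var_power_mult[of u 2 "graph_poly ?E" m 0] by simp
      have 2: "mcoeff (Var c * (Var d * (2 * graph_poly ?E))) (m + var_pow u 2) = 0"
        using u 0(1) by (metis mult.left_commute)
      show ?thesis using u 0 1 2 by auto
    qed
    define u where "u = (if y = c then d else c)"
    show ?thesis
    proof (rule small_monomialI)
      show "\<not> 3 dvd mcoeff (Var c ^ 2 * graph_poly ?E - Var c * (Var d * (2 * graph_poly ?E)) + Var d ^ 2 * graph_poly ?E) (m + var_pow u 2)"
        using other[of u "if y = c then c else d"] m(4) unfolding u_def by auto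
      show "expo (m + var_pow u 2) w \<le> 2" for w using m(1)[of w] m(2,3) by (auto simp: expo_var_pow u_def)
      show "expo (m + var_pow u 2) w = 0" if "w \<in> {y}" for w
        using that assms(3) m(2,3) cd by (auto simp: expo_var_pow u_def)
    qed
  qed
  ultimately show ?thesis by (rule small_monomial_sign_eq)
qed

text \<open>The coefficient of \<open>c\<^sup>2\<close> in \<open>(c - d)\<^sup>2 (c - e)\<close> is \<open>- 2 d - e\<close>, which is \<open>d - e\<close> modulo 3: removing
  \<open>c\<close> moves the doubled edge from \<open>c d\<close> to \<open>d e\<close>.\<close>

lemma small_monomial_doubled_edge_step:
  assumes G: "outerplanar_graph V E" and cd: "{c, d} \<in> E" and y: "y \<noteq> c" and c: "card (nbrs E c) \<le> 2"
    and IH: "\<And>e. {d, e} \<in> del E c \<Longrightarrow> small_monomial ((Var d - Var e) * graph_poly (del E c)) {y}"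
  shows "small_monomial ((Var c - Var d) * graph_poly E) {y}"
proof -
  note D = outerplanar_graphD[OF G]
  let ?P = "graph_poly (del E c)"
  have free: "free_of c ?P" by (rule graph_poly_remove(2)[OF G])
  have ne: "c \<noteq> d" using D(4)[OF cd] by simp
  obtain S where S: "nbrs E c = insert d S" "d \<notin> S" "S = {} \<or> (\<exists>e. S = {e} \<and> e \<noteq> c \<and> {c, e} \<in> E)"
  proof (cases rule: card_le_2E[OF c D(6)])
    case 1 then show ?thesis using cd by auto
  next
    case (2 a)
    then have "nbrs E c = {d}" using cd by auto
    then show ?thesis using that[of "{}"] by auto
  next
    case (3 a b)
    have "a \<in> nbrs E c" "b \<in> nbrs E c" using 3 by auto
    then have *: "a \<noteq> c" "b \<noteq> c" "{c, a} \<in> E" "{c, b} \<in> E" using D(4)[of c a] D(4)[of c b] by auto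
    have "d \<in> nbrs E c" using cd by simp
    then have "d = a \<or> d = b" using 3 by auto
    then show ?thesis
    proof
      assume "d = a"
      then show ?thesis using 3 * by (intro that[of "{b}"]) auto
    next
      assume "d = b"
      then show ?thesis using 3 * by (intro that[of "{a}"]) auto
    qed
  qed
  \<comment> \<open>\<open>R\<close> is what remains, modulo 3, after extracting \<open>c^2\<close>:
    it is \<open>1\<close> if \<open>d\<close> is the only neighbour of \<open>c\<close>, and
    \<open>d - e\<close> if there is a second neighbour \<open>e\<close>.\<close>
  have *: "small_monomial (R * ?P) {y} \<Longrightarrow> small_monomial ((Var c - Var d) * graph_poly E) {y}"
    if R: "\<And>m. expo m c = 0 \<Longrightarrow>
      (3 dvd mcoeff ((Var c - Var d) * ((\<Prod>u\<in>nbrs E c. Var c - Var u) * ?P)) (m + var_pow c 2) \<longleftrightarrow> 3 dvd mcoeff (R * ?P) m)"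
      "free_of c R" for R
  proof -
    assume sm: "small_monomial (R * ?P) {y}"
    have "free_of c (R * ?P)" by (rule free_of_intros(4)[OF R(2) free])
    then obtain m where "\<forall>u. expo m u \<le> 2" "\<forall>u\<in>{y}. expo m u = 0" "\<not> 3 dvd mcoeff (R * ?P) m" "expo m c = 0"
      using small_monomialD[OF sm] by blast
    then have m: "\<And>u. expo m u \<le> 2" "expo m y = 0" "\<not> 3 dvd mcoeff (R * ?P) m" "expo m c = 0" by simp_all
    have "small_monomial ((Var c - Var d) * ((\<Prod>u\<in>nbrs E c. Var c - Var u) * ?P)) {y}"
      by (rule small_monomialI[of "m + var_pow c 2"]) (use m R(1)[OF m(4)] y in \<open>auto simp: expo_var_pow\<close>)
    then show ?thesis
      by (rule small_monomial_sign_eq[rotated]) (intro sign_eq_mult sign_eq_refl graph_poly_remove(1)[OF G])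
  qed
  from S(3) show ?thesis
  proof
    assume "S = {}"
    then have S: "nbrs E c = {d}" using S by simp
    show ?thesis
    proof (rule *[of 1])
      fix m :: "'a monomial" assume m: "expo m c = 0"
      have "(Var c - Var d) * ((\<Prod>u\<in>nbrs E c. Var c - Var u) * ?P)
        = Var c ^ 2 * ?P - Var c * ((Var d + Var d) * ?P) + Var d * Var d * ?P"
        unfolding S by (simp add: algebra_simps power2_eq_square)
      moreover have "free_of c ((Var d + Var d) * ?P)" "free_of c (Var d * Var d * ?P)"
        by (intro free_of_intros free; use ne in simp)+
      ultimately show "3 dvd mcoeff ((Var c - Var d) * ((\<Prod>u\<in>nbrs E c. Var c - Var u) * ?P)) (m + var_pow c 2) \<longleftrightarrow> 3 dvd mcoeff (1 * ?P) m"
        using m free by (simp add: mcoeff_extract mcoeff_extract')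
    qed (use small_monomial_graph_poly_avoiding_vertex[OF outerplanar_graph_del[OF G]] in auto)
  next
    assume "\<exists>e. S = {e} \<and> e \<noteq> c \<and> {c, e} \<in> E"
    then obtain e where e: "nbrs E c = {d, e}" "d \<noteq> e" "e \<noteq> c" "{c, e} \<in> E" using S by auto
    show ?thesis
    proof (rule *[of "Var d - Var e"])
      fix m :: "'a monomial" assume m: "expo m c = 0"
      have "(Var c - Var d) * ((\<Prod>u\<in>nbrs E c. Var c - Var u) * ?P)
        = Var c ^ 3 * ?P + Var c ^ 2 * ((Var d - Var e) * ?P - 3 * (Var d * ?P))
          + Var c * (Var d * (Var d + Var e + Var e) * ?P) - Var d * Var d * Var e * ?P"
        unfolding e(1) using e(2) by (simp add: algebra_simps power2_eq_square power3_eq_cube)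
      moreover have "free_of c ((Var d - Var e) * ?P - 3 * (Var d * ?P))"
        by (intro free_of_intros free_of_numeral free; use ne e(3) in simp)+
      moreover have "free_of c (Var d * (Var d + Var e + Var e) * ?P)" "free_of c (Var d * Var d * Var e * ?P)"
        by (intro free_of_intros free_of_numeral free; use ne e(3) in simp)+
      ultimately have "mcoeff ((Var c - Var d) * ((\<Prod>u\<in>nbrs E c. Var c - Var u) * ?P)) (m + var_pow c 2)
        = mcoeff ((Var d - Var e) * ?P) m - 3 * mcoeff (Var d * ?P) m"
        using m free by (simp add: mcoeff_extract mcoeff_extract' mcoeff_3_mult del: left_diff_distrib_numeral)
      then show "3 dvd mcoeff ((Var c - Var d) * ((\<Prod>u\<in>nbrs E c. Var c - Var u) * ?P)) (m + var_pow c 2) \<longleftrightarrow> 3 dvd mcoeff ((Var d - Var e) * ?P) m"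
        by presburger
    next
      show "small_monomial ((Var d - Var e) * ?P) {y}"
      proof (cases "{d, e} \<in> del E c")
        case True then show ?thesis by (rule IH)
      next
        case False
        \<comment> \<open>If \<open>d e\<close> is not an edge, smoothing \<open>c\<close> supplies
          it: the factor \<open>d - e\<close> completes the polynomial of the smoothed graph, and no
          edge is doubled any more.\<close>
        have G': "outerplanar_graph (V - {c}) (insert {d, e} (del E c))"
          by (rule outerplanar_graph_smooth[OF G cd e(4) e(2)])
        have "sign_eq (graph_poly (insert {d, e} (del E c))) ((Var d - Var e) * ?P)"
          using D(2) by (intro graph_poly_insert False e(2)) simp
        then show ?thesis
          using small_monomial_graph_poly_avoiding_vertex[OF G'] by (meson small_monomial_sign_eq sign_eq_sym)
      qed
    qed (use ne e in auto)
  qed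
qed

text \<open>A doubled edge at \<open>y\<close> is settled directly. Otherwise low-degree vertices
  off \<open>c\<close>, \<open>d\<close>, \<open>y\<close> are peeled off; when none is left, the
  low-degree vertex away from \<open>y\<close> is an end of the doubled edge, and deleting it moves
  the doubled edge into a smaller graph or dissolves it.\<close>

lemma small_monomial_doubled_edge:
  assumes "outerplanar_graph V E" "{c, d} \<in> E"
  shows "small_monomial ((Var c - Var d) * graph_poly E) {y}"
  using assms
proof (induction "card V" arbitrary: V E c d rule: less_induct)
  case less
  note G = less.prems(1) and D = outerplanar_graphD[OF less.prems(1)]
  have cd: "c \<noteq> d" "c \<in> V" "d \<in> V" using D(4)[OF less.prems(2)] by auto
  have IH: "small_monomial ((Var a - Var b) * graph_poly (del E v)) {y}" if "v \<in> V" "{a, b} \<in> del E v" for v a b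
    by (rule less.hyps[OF card_Diff1_less[OF D(1) that(1)] outerplanar_graph_del[OF G] that(2)])
  have flip: "small_monomial ((Var d - Var c) * graph_poly E) {y} \<Longrightarrow> small_monomial ((Var c - Var d) * graph_poly E) {y}"
  proof (rule small_monomial_sign_eq)
    show "sign_eq ((Var c - Var d) * graph_poly E) ((Var d - Var c) * graph_poly E)"
      unfolding sign_eq_def by (simp add: algebra_simps)
  qed
  consider "y \<in> {c, d}" | v where "v \<in> V - {c, d, y}" "card (nbrs E v) \<le> 2"
    | "y \<notin> {c, d}" "\<And>v. v \<in> V - {c, d, y} \<Longrightarrow> \<not> card (nbrs E v) \<le> 2" by blast
  then show ?case
  proof cases
    case 1
    then show ?thesis by (rule small_monomial_square_edge[OF less.prems])
  next
    case 2
    have "small_monomial ((Var c - Var d) * graph_poly (del E v)) {y}" using 2 less.prems(2) by (intro IH) auto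
    then show ?thesis using 2 by (intro small_monomial_remove[OF G 2(2)]) auto
  next
    case 3
    obtain v where v: "v \<in> V - {y}" "card (nbrs E v) \<le> 2"
      using low_degree_vertex_avoiding(1)[OF G, of y] 3(1) cd by blast
    then consider "v = c" | "v = d" using 3(2) by auto
    then show ?thesis
    proof cases
      case 1
      then show ?thesis using small_monomial_doubled_edge_step[OF G less.prems(2), of y] 3 v IH[OF cd(2)] by auto
    next
      case 2
      have dc: "{d, c} \<in> E" using less.prems(2) by (simp add: insert_commute)
      show ?thesis using small_monomial_doubled_edge_step[OF G dc, of y] 2 3 v IH[OF cd(3)] flip by auto
    qed
  qed
qed

section \<open>Extremal coefficient patterns\<close>

definition coeffs_at :: "'a int_mpoly \<Rightarrow> 'a monomial \<Rightarrow> 'a \<Rightarrow> 'a \<Rightarrow> nat \<Rightarrow> nat \<Rightarrow> int" where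
  "coeffs_at p m x y i j = mcoeff p (m + var_pow x i + var_pow y j)"

text \<open>\<open>A i j\<close> stands for the coefficient of \<open>x\<^sup>i y\<^sup>j\<close>; up to a factor prime to 3, the patterns for
  \<open>k = 0, 1, 2\<close> are those of \<open>1\<close>, \<open>x - y\<close> and \<open>x\<^sup>2 + x y + y\<^sup>2\<close>.\<close>

definition pattern :: "nat \<Rightarrow> (nat \<Rightarrow> nat \<Rightarrow> int) \<Rightarrow> bool" where
  "pattern k A \<longleftrightarrow>
     k = 0 \<and> \<not> 3 dvd A 0 0 \<or>
     k = 1 \<and> \<not> 3 dvd A 1 0 \<and> A 0 1 = - A 1 0 \<or>
     k = 2 \<and> \<not> 3 dvd A 2 0 \<and> A 1 1 = A 2 0 \<and> A 0 2 = A 2 0"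

lemma pattern_cong:
  assumes "\<And>i j. i \<le> 2 \<Longrightarrow> j \<le> 2 \<Longrightarrow> A i j = B i j"
  shows "pattern k A = pattern k B"
  unfolding pattern_def by (simp add: assms)

lemma pattern_uminus: "pattern k (\<lambda>i j. - A i j) = pattern k A"
  unfolding pattern_def by auto

text \<open>A single \<open>m\<close> serves all entries of the pattern, so the claim concerns one
  polynomial in \<open>x\<close> and \<open>y\<close> and not unrelated coefficients.\<close>

definition extremal :: "'a int_mpoly \<Rightarrow> 'a \<Rightarrow> 'a \<Rightarrow> nat \<Rightarrow> bool" where
  "extremal p x y k \<longleftrightarrow> (\<exists>m. (\<forall>u. expo m u \<le> 2) \<and> expo m x = 0 \<and> expo m y = 0 \<and> pattern k (coeffs_at p m x y))"

lemma extremalI: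
  "(\<And>u. expo m u \<le> 2) \<Longrightarrow> expo m x = 0 \<Longrightarrow> expo m y = 0 \<Longrightarrow> pattern k (coeffs_at p m x y) \<Longrightarrow> extremal p x y k"
  unfolding extremal_def by (intro exI[of _ m]) simp

lemma extremalD:
  assumes "extremal p x y k"
  shows "\<exists>m. (\<forall>u. expo m u \<le> 2) \<and> expo m x = 0 \<and> expo m y = 0 \<and> pattern k (coeffs_at p m x y) \<and>
    (\<forall>v. free_of v p \<longrightarrow> expo m v = 0)"
proof -
  obtain m where m: "\<forall>u. expo m u \<le> 2" "expo m x = 0" "expo m y = 0" "pattern k (coeffs_at p m x y)"
    using assms unfolding extremal_def by blast
  have "\<exists>i j. coeffs_at p m x y i j \<noteq> 0"
    using m(4) unfolding pattern_def by (metis dvd_0_right)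
  then obtain i j where ij: "mcoeff p (m + var_pow x i + var_pow y j) \<noteq> 0" unfolding coeffs_at_def by blast
  have "expo m v = 0" if "free_of v p" for v
    by (rule ccontr) (use free_ofD[OF that, of "m + var_pow x i + var_pow y j"] ij in simp)
  then show ?thesis using m by blast
qed

lemma extremal_sign_eq:
  assumes "sign_eq p q" "extremal q x y k"
  shows "extremal p x y k"
proof -
  obtain m where m: "\<forall>u. expo m u \<le> 2" "expo m x = 0" "expo m y = 0" "pattern k (coeffs_at q m x y)"
    using assms(2) unfolding extremal_def by blast
  have "pattern k (coeffs_at p m x y)"
    using assms(1) unfolding sign_eq_def
  proof
    assume "p = - q"
    then have "coeffs_at p m x y = (\<lambda>i j. - coeffs_at q m x y i j)"
      by (intro ext) (simp add: coeffs_at_def)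
    then show ?thesis using m(4) by (simp add: pattern_uminus)
  qed (use m in simp)
  then show ?thesis using m unfolding extremal_def by blast
qed

text \<open>Giving \<open>v\<close> its full degree as exponent leaves all coefficients in
  \<open>x\<close> and \<open>y\<close> unchanged.\<close>

lemma extremal_graph_poly_remove:
  assumes G: "outerplanar_graph V E" and v: "card (nbrs E v) \<le> 2" "v \<noteq> x" "v \<noteq> y"
    and ex: "extremal (graph_poly (del E v)) x y k"
  shows "extremal (graph_poly E) x y k"
proof -
  let ?P = "graph_poly (del E v)" and ?S = "nbrs E v"
  have free: "free_of v ?P" by (rule graph_poly_remove(2)[OF G])
  obtain m where m: "\<forall>u. expo m u \<le> 2" "expo m x = 0" "expo m y = 0" "pattern k (coeffs_at ?P m x y)" "expo m v = 0"
    using extremalD[OF ex] free by blast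
  have vn: "v \<notin> ?S" "finite ?S" using outerplanar_graphD(4)[OF G, of v v] outerplanar_graphD(6)[OF G] by auto
  let ?m = "m + var_pow v (card ?S)"
  have "coeffs_at ((\<Prod>u\<in>?S. Var v - Var u) * ?P) ?m x y i j = coeffs_at ?P m x y i j" for i j
    using top_mcoeff[OF free _ vn v(1), of "m + var_pow x i + var_pow y j"] m(5) v(2,3)
    unfolding coeffs_at_def by (simp add: expo_var_pow ac_simps)
  then have "coeffs_at ((\<Prod>u\<in>?S. Var v - Var u) * ?P) ?m x y = coeffs_at ?P m x y" by (intro ext)
  then have "extremal ((\<Prod>u\<in>?S. Var v - Var u) * ?P) x y k"
    using m v by (intro extremalI[of ?m]) (auto simp: expo_var_pow)
  then show ?thesis by (rule extremal_sign_eq[OF graph_poly_remove(1)[OF G]])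
qed

text \<open>In \<open>(x - a) (x - b) (a - b) (a - c) (b - c)\<close> the coefficient of \<open>a\<^sup>2\<close> is
  \<open>(x\<^sup>2 + x c + c\<^sup>2) (b - c)\<close> up to the multiples \<open>b\<^sup>3\<close> and \<open>c\<^sup>3\<close>.\<close>

lemma mcoeff_diamond:
  assumes "free_of a R" "distinct [x, a, b, c]" "expo m a = 0" "expo m b \<le> 2" "expo m c \<le> 2"
  defines "P \<equiv> (Var b - Var c) * R"
  shows "mcoeff ((Var x - Var a) * (Var x - Var b) * (Var a - Var b) * (Var a - Var c) * P) (m + var_pow a 2)
    = mcoeff (Var x ^ 2 * P + Var x * (Var c * P) + Var c ^ 2 * P) m"
proof -
  let ?q2 = "Var x ^ 2 * P + Var x * (Var c * P) + Var c ^ 2 * P - Var b ^ 3 * R + Var c ^ 3 * R"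
  let ?q1 = "(Var x - Var b) * (Var x * Var b + Var x * Var c + Var b * Var c) * P"
  let ?q0 = "(Var x - Var b) * (Var x * Var b * Var c) * P"
  have ne: "x \<noteq> a" "b \<noteq> a" "c \<noteq> a" using assms(2) by auto
  have free: "free_of a P" "free_of a ((Var x - Var b) * P)" "free_of a ?q1" "free_of a ?q0" "free_of a ?q2"
    unfolding P_def by (intro free_of_intros free_of_power assms(1) ne)+
  have "(Var x - Var a) * (Var x - Var b) * (Var a - Var b) * (Var a - Var c) * P
    = - (Var a ^ 3 * ((Var x - Var b) * P)) + Var a ^ 2 * ?q2 - Var a * ?q1 + ?q0"
    unfolding P_def by (simp add: algebra_simps power2_eq_square power3_eq_cube)
  then have "mcoeff ((Var x - Var a) * (Var x - Var b) * (Var a - Var b) * (Var a - Var c) * P) (m + var_pow a 2)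
    = mcoeff ?q2 m"
    using free assms(3) by (simp only: mcoeff_simps mcoeff_extract mcoeff_extract') simp
  moreover have "mcoeff (Var b ^ 3 * R) m = 0" "mcoeff (Var c ^ 3 * R) m = 0"
    using assms(4,5) by (intro mcoeff_Var_power_mult_0; simp)+
  ultimately show ?thesis by simp
qed

text \<open>The four factors contribute \<open>(x - b) (x + b + c)\<close> to \<open>a^2\<close>. At
  exponent 0 of \<open>x\<close> only \<open>- b (b + c)\<close> remains; there is no factor
  \<open>b - c\<close> here that would turn the whole into a form in \<open>x\<close> and
  \<open>c\<close>.\<close>

lemma mcoeff_open_diamond:
  assumes "free_of a P" "distinct [x, a, b, c]" "expo m a = 0" "expo m x = 0"
  shows "mcoeff ((Var x - Var a) * (Var x - Var b) * (Var a - Var b) * (Var a - Var c) * P) (m + var_pow a 2)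
    = - mcoeff (Var b ^ 2 * P + Var b * (Var c * P)) m"
proof -
  let ?q2 = "Var x * ((Var x + Var c) * P) - (Var b ^ 2 * P + Var b * (Var c * P))"
  let ?q1 = "(Var x - Var b) * (Var x * Var b + Var x * Var c + Var b * Var c) * P"
  let ?q0 = "(Var x - Var b) * (Var x * Var b * Var c) * P"
  have ne: "x \<noteq> a" "b \<noteq> a" "c \<noteq> a" using assms(2) by auto
  have free: "free_of a ((Var x - Var b) * P)" "free_of a ?q1" "free_of a ?q0" "free_of a ?q2"
    by (intro free_of_intros free_of_power assms(1) ne)+
  have "(Var x - Var a) * (Var x - Var b) * (Var a - Var b) * (Var a - Var c) * P
    = - (Var a ^ 3 * ((Var x - Var b) * P)) + Var a ^ 2 * ?q2 - Var a * ?q1 + ?q0"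
    by (simp add: algebra_simps power2_eq_square power3_eq_cube)
  then have "mcoeff ((Var x - Var a) * (Var x - Var b) * (Var a - Var b) * (Var a - Var c) * P) (m + var_pow a 2)
    = mcoeff ?q2 m"
    using free assms(3) by (simp only: mcoeff_simps mcoeff_extract mcoeff_extract') simp
  then show ?thesis using assms(4) by (simp add: mcoeff_Var_mult_0)
qed

section \<open>Extending 3-colourings\<close>

lemma proper_3_colouring_del:
  "proper_3_colouring V E C \<Longrightarrow> proper_3_colouring (V - {v}) (del E v) C"
  unfolding proper_3_colouring_def by auto

lemma proper_3_colouring_mono:
  "proper_3_colouring V E C \<Longrightarrow> E' \<subseteq> E \<Longrightarrow> proper_3_colouring V E' C"
  unfolding proper_3_colouring_def by auto

lemma proper_3_colouring_extend:
  assumes G: "outerplanar_graph V E" and C: "proper_3_colouring (V - {v}) (del E v) C"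
    and t: "t \<in> {1, 2, 3}" "\<And>u. u \<in> nbrs E v \<Longrightarrow> C u \<noteq> t"
  shows "proper_3_colouring V E (C(v := t))"
  unfolding proper_3_colouring_def
proof (intro conjI allI impI)
  show "(C(v := t)) ` V \<subseteq> {1, 2, 3}" using C t(1) unfolding proper_3_colouring_def by auto
  fix a b assume ab: "{a, b} \<in> E"
  have ne: "a \<noteq> b" using outerplanar_graphD(4)[OF G ab] by simp
  consider "a = v" | "b = v" | "v \<notin> {a, b}" by blast
  then show "(C(v := t)) a \<noteq> (C(v := t)) b"
  proof cases
    case 1
    then show ?thesis using t(2)[of b] ab ne by auto
  next
    case 2
    then show ?thesis using t(2)[of a] ab ne by (auto simp: insert_commute)
  next
    case 3
    then have "{a, b} \<in> del E v" using ab by simp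
    then have "C a \<noteq> C b" using C unfolding proper_3_colouring_def by blast
    then show ?thesis using 3 by auto
  qed
qed

lemma free_colour:
  assumes "finite S" "card S \<le> 2"
  obtains t :: nat where "t \<in> {1, 2, 3}" "t \<notin> S"
proof -
  have "\<not> {1, 2, 3 :: nat} \<subseteq> S"
  proof
    assume "{1, 2, 3 :: nat} \<subseteq> S"
    then have "card {1, 2, 3 :: nat} \<le> card S" using assms(1) by (rule card_mono[rotated])
    then show False using assms(2) by simp
  qed
  then show thesis using that by blast
qed

lemma proper_3_colouring_extend_low_degree:
  assumes G: "outerplanar_graph V E" and v: "card (nbrs E v) \<le> 2"
    and C: "proper_3_colouring (V - {v}) (del E v) C"
  obtains t where "proper_3_colouring V E (C(v := t))"
proof -
  have fin: "finite (nbrs E v)" by (rule outerplanar_graphD(6)[OF G])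
  have "card (C ` nbrs E v) \<le> 2" using card_image_le[OF fin, of C] v by linarith
  then obtain t :: nat where "t \<in> {1, 2, 3}" "t \<notin> C ` nbrs E v" using free_colour fin by (metis finite_imageI)
  then show thesis by (intro that proper_3_colouring_extend[OF G C]) auto
qed

lemma outerplanar_3_colourable:
  assumes "outerplanar_graph V E"
  shows "\<exists>C. proper_3_colouring V E C"
  using assms
proof (induction "card V" arbitrary: V E rule: less_induct)
  case less
  note D = outerplanar_graphD[OF less.prems]
  show ?case
  proof (cases "V = {}")
    case True
    have "E = {}"
    proof (rule equals0I)
      fix e assume "e \<in> E"
      then show False using D(3)[of e] D(5)[of e] True by simp
    qed
    then show ?thesis using True by (intro exI[of _ "\<lambda>_. 1"]) (simp add: proper_3_colouring_def)
  next
    case False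
    then obtain v where v: "v \<in> V" "card (nbrs E v) \<le> 2"
      using outerplanar_graph_has_low_degree_vertex[OF less.prems] by blast
    obtain C where "proper_3_colouring (V - {v}) (del E v) C"
      using less.hyps[OF card_Diff1_less[OF D(1) v(1)] outerplanar_graph_del[OF less.prems]] by blast
    then show ?thesis using proper_3_colouring_extend_low_degree[OF less.prems v(2)] by blast
  qed
qed

lemma colouring_of_edge_deleted:
  assumes "outerplanar_graph V (insert {a, b} E)"
  shows "\<exists>C. proper_3_colouring V E C \<and> C a \<noteq> C b"
proof -
  obtain C where C: "proper_3_colouring V (insert {a, b} E) C" using outerplanar_3_colourable[OF assms] by blast
  then have "proper_3_colouring V E C" by (rule proper_3_colouring_mono) blast
  moreover have "C a \<noteq> C b" using C unfolding proper_3_colouring_def by blast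
  ultimately show ?thesis by blast
qed

text \<open>The colouring counterpart of \<open>small_monomial_graph_poly_avoiding_edge\<close>:
  with the edge present, all other vertices can be peeled off at low degree; without it, the
  remaining \<open>a\<close> and \<open>b\<close> may be coloured alike.\<close>

lemma colouring_identifying_edge_deleted:
  assumes "outerplanar_graph V (insert {a, b} E)" "{a, b} \<notin> E"
  shows "\<exists>C. proper_3_colouring V E C \<and> C a = C b"
  using assms
proof (induction "card V" arbitrary: V E rule: less_induct)
  case less
  let ?E = "insert {a, b} E"
  note D = outerplanar_graphD[OF less.prems(1)]
  have G: "outerplanar_graph V E" by (rule outerplanar_graph_subgraph[OF less.prems(1)]) blast
  show ?case
  proof (cases "V - {a, b} = {}")
    case True
    have "E = {}"
    proof (rule equals0I)
      fix e assume e: "e \<in> E"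
      then have e': "e \<in> ?E" by simp
      have "e \<subseteq> {a, b}" "card e = 2" using D(3)[OF e'] D(5)[OF e'] True by (blast, simp)
      moreover have "card {a, b} = 2" using D(5) by blast
      ultimately have "e = {a, b}" using card_subset_eq[of "{a, b}" e] by simp
      then show False using e less.prems(2) by simp
    qed
    then show ?thesis by (intro exI[of _ "\<lambda>_. 1"]) (auto simp: proper_3_colouring_def)
  next
    case False
    then obtain v where v: "v \<in> V - {a, b}" "card (nbrs ?E v) \<le> 2"
      using low_degree_vertex_avoiding(2)[OF less.prems(1)] by blast
    have vE: "card (nbrs E v) \<le> 2" using v nbrs_insert(1)[of v a b E] by simp
    have del: "del ?E v = insert {a, b} (del E v)" using v by auto
    have vV: "v \<in> V" using v by simp
    obtain C where C: "proper_3_colouring (V - {v}) (del E v) C" "C a = C b"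
      using less.hyps[OF card_Diff1_less[OF D(1) vV], of "del E v"] less.prems(2)
        outerplanar_graph_del[OF less.prems(1), of v] unfolding del by blast
    obtain t where "proper_3_colouring V E (C(v := t))"
      using proper_3_colouring_extend_low_degree[OF G vE C(1)] by blast
    then show ?thesis using C(2) v(1) by (intro exI[of _ "C(v := t)"]) auto
  qed
qed

lemma proper_3_colouring_range: "proper_3_colouring V E C \<Longrightarrow> v \<in> V \<Longrightarrow> C v = 1 \<or> C v = 2 \<or> C v = 3"
  unfolding proper_3_colouring_def by auto

lemma proper_3_colouring_neq: "proper_3_colouring V E C \<Longrightarrow> {u, v} \<in> E \<Longrightarrow> C u \<noteq> C v"
  unfolding proper_3_colouring_def by blast

lemma free_colour_avoiding_two: "\<exists>t\<in>{1, 2, 3 :: nat}. t \<noteq> p \<and> t \<noteq> q"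
proof -
  have "1 \<noteq> p \<and> 1 \<noteq> q \<or> 2 \<noteq> p \<and> 2 \<noteq> q \<or> 3 \<noteq> p \<and> 3 \<noteq> q" by presburger
  then show ?thesis by blast
qed

section \<open>Matching coefficient patterns with colour types\<close>

text \<open>\<open>k\<close> is the degree of the corresponding form. Without any colouring both
  \<open>k = 1\<close> and \<open>k = 2\<close> would qualify; 3-colourability of outerplanar graphs
  rules this out.\<close>

definition colour_type :: "'a set \<Rightarrow> 'a set set \<Rightarrow> 'a \<Rightarrow> 'a \<Rightarrow> nat \<Rightarrow> bool" where
  "colour_type V E x y k \<longleftrightarrow>
    k = 0 \<and> (\<exists>C. proper_3_colouring V E C \<and> C x = C y) \<and> (\<exists>C. proper_3_colouring V E C \<and> C x \<noteq> C y) \<or>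
    k = 1 \<and> (\<forall>C. proper_3_colouring V E C \<longrightarrow> C x \<noteq> C y) \<or>
    k = 2 \<and> (\<forall>C. proper_3_colouring V E C \<longrightarrow> C x = C y)"

definition typed_extremal :: "'a set \<Rightarrow> 'a set set \<Rightarrow> 'a \<Rightarrow> 'a \<Rightarrow> bool" where
  "typed_extremal V E x y \<longleftrightarrow> (\<exists>k. extremal (graph_poly E) x y k \<and> colour_type V E x y k)"

text \<open>Every colouring of the rest extends to a vertex of degree at most 2, so both the form
  and the colour type stay the same.\<close>

lemma typed_extremal_remove:
  assumes G: "outerplanar_graph V E" and v: "card (nbrs E v) \<le> 2" "v \<noteq> x" "v \<noteq> y"
    and H: "typed_extremal (V - {v}) (del E v) x y"
  shows "typed_extremal V E x y"
proof -
  obtain k where k: "extremal (graph_poly (del E v)) x y k" "colour_type (V - {v}) (del E v) x y k"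
    using H unfolding typed_extremal_def by blast
  have lift: "\<exists>C'. proper_3_colouring V E C' \<and> C' x = C x \<and> C' y = C y"
    if C: "proper_3_colouring (V - {v}) (del E v) C" for C
  proof -
    obtain t where "proper_3_colouring V E (C(v := t))"
      using proper_3_colouring_extend_low_degree[OF G v(1) C] by blast
    then show ?thesis using v by (intro exI[of _ "C(v := t)"]) simp
  qed
  have "colour_type V E x y k"
  proof -
    have "\<exists>C. proper_3_colouring V E C \<and> C x = C y"
      if "\<exists>C. proper_3_colouring (V - {v}) (del E v) C \<and> C x = C y" using that lift by metis
    moreover have "\<exists>C. proper_3_colouring V E C \<and> C x \<noteq> C y"
      if "\<exists>C. proper_3_colouring (V - {v}) (del E v) C \<and> C x \<noteq> C y" using that lift by metis
    ultimately show ?thesis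
      using k(2) proper_3_colouring_del[of V E _ v] unfolding colour_type_def by blast
  qed
  then show ?thesis using extremal_graph_poly_remove[OF G v k(1)] unfolding typed_extremal_def by blast
qed

text \<open>Without the edge there is a nonvanishing monomial avoiding both \<open>x\<close> and
  \<open>y\<close>; the factor \<open>x - y\<close> turns it into the form for
  \<open>k = 1\<close>.\<close>

lemma typed_extremal_adjacent:
  assumes G: "outerplanar_graph V E" and xy: "{x, y} \<in> E"
  shows "typed_extremal V E x y"
proof -
  let ?E = "E - {{x, y}}" let ?P = "(Var x - Var y) * graph_poly ?E"
  have ne: "x \<noteq> y" using outerplanar_graphD(4)[OF G xy] by simp
  have "small_monomial (graph_poly ?E) {x, y}"
    by (rule small_monomial_graph_poly_avoiding_edge[of V]) (use G xy in \<open>simp_all add: insert_absorb\<close>)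
  then obtain m where "\<forall>u. expo m u \<le> 2" "\<forall>u\<in>{x, y}. expo m u = 0" and m4: "\<not> 3 dvd mcoeff (graph_poly ?E) m"
    unfolding small_monomial_def by blast
  then have m: "\<And>u. expo m u \<le> 2" "expo m x = 0" "expo m y = 0" by simp_all
  have "mcoeff (Var x * graph_poly ?E) (m + var_pow x 1) = mcoeff (graph_poly ?E) m"
    "mcoeff (Var y * graph_poly ?E) (m + var_pow y 1) = mcoeff (graph_poly ?E) m"
    using mcoeff_Var_power_mult[of x 1 "graph_poly ?E" m 0] mcoeff_Var_power_mult[of y 1 "graph_poly ?E" m 0] by simp_all
  moreover have "mcoeff (Var y * graph_poly ?E) (m + var_pow x 1) = 0" "mcoeff (Var x * graph_poly ?E) (m + var_pow y 1) = 0"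
    using m ne by (simp_all add: mcoeff_Var_mult_0 expo_var_pow)
  ultimately have "coeffs_at ?P m x y 1 0 = mcoeff (graph_poly ?E) m" "coeffs_at ?P m x y 0 1 = - mcoeff (graph_poly ?E) m"
    unfolding coeffs_at_def by (simp_all add: left_diff_distrib)
  then have "pattern 1 (coeffs_at ?P m x y)" using m4 unfolding pattern_def by simp
  then have "extremal ?P x y 1" using m by (intro extremalI)
  then have "extremal (graph_poly E) x y 1" by (rule extremal_sign_eq[OF graph_poly_insert_edge[OF G xy]])
  moreover have "colour_type V E x y 1"
    using proper_3_colouring_neq[OF _ xy] unfolding colour_type_def by blast
  ultimately show ?thesis unfolding typed_extremal_def by blast
qed

lemma extremal_0I:
  assumes "small_monomial p {x, y}"
  shows "extremal p x y 0"
proof -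
  obtain m where "\<forall>u. expo m u \<le> 2" "\<forall>u\<in>{x, y}. expo m u = 0" "\<not> 3 dvd mcoeff p m"
    using assms unfolding small_monomial_def by blast
  then show ?thesis by (intro extremalI[of m]) (simp_all add: pattern_def coeffs_at_def)
qed

text \<open>Here \<open>x\<close> takes any colour, so the type is 0. The polynomial does not
  contain \<open>x\<close>, so a monomial avoiding \<open>y\<close> avoids both.\<close>

lemma typed_extremal_isolated:
  assumes G: "outerplanar_graph V E" and x: "nbrs E x = {}" and ne: "x \<noteq> y" and y: "y \<in> V"
  shows "typed_extremal V E x y"
proof -
  note G' = outerplanar_graph_del[OF G, of x]
  have sm: "small_monomial (graph_poly (del E x)) {y}" by (rule small_monomial_graph_poly_avoiding_vertex[OF G'])
  obtain m where "\<forall>u. expo m u \<le> 2" "\<forall>u\<in>{y}. expo m u = 0" "\<not> 3 dvd mcoeff (graph_poly (del E x)) m" "expo m x = 0"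
    using small_monomialD[OF sm] graph_poly_remove(2)[OF G, of x] by blast
  then have "small_monomial (graph_poly (del E x)) {x, y}" by (intro small_monomialI[of m]) auto
  then have "extremal (graph_poly (del E x)) x y 0" by (rule extremal_0I)
  moreover have "sign_eq (graph_poly E) (graph_poly (del E x))" using graph_poly_remove(1)[OF G, of x] x by simp
  ultimately have ext: "extremal (graph_poly E) x y 0" by (rule extremal_sign_eq[rotated])
  obtain C where C: "proper_3_colouring (V - {x}) (del E x) C" using outerplanar_3_colourable[OF G'] by blast
  have Cy: "C y \<in> {1, 2, 3}" using proper_3_colouring_range[OF C, of y] y ne by auto
  have any: "proper_3_colouring V E (C(x := t))" if "t \<in> {1, 2, 3}" for t
    using proper_3_colouring_extend[OF G C that] x by simp
  obtain t :: nat where t: "t \<in> {1, 2, 3}" "t \<noteq> C y" using free_colour_avoiding_two[of "C y" "C y"] by blast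
  have "colour_type V E x y 0"
  proof -
    have "(C(x := C y)) x = (C(x := C y)) y" "(C(x := t)) x \<noteq> (C(x := t)) y" using t(2) ne by auto
    then show ?thesis using any[OF Cy] any[OF t(1)] unfolding colour_type_def by blast
  qed
  then show ?thesis using ext unfolding typed_extremal_def by blast
qed

text \<open>If \<open>a\<close> and \<open>y\<close> always agree, then \<open>x\<close> and
  \<open>y\<close> always differ; in all other cases \<open>x\<close> can both agree with
  \<open>y\<close> and differ from it. Accordingly types 0 and 1 for \<open>a\<close> and
  \<open>y\<close> give type 0, and type 2 gives type 1. The polynomial is the smaller one times
  \<open>x - a\<close>.\<close>

lemma typed_extremal_leaf:
  assumes G: "outerplanar_graph V E" and x: "nbrs E x = {a}" and ne: "x \<noteq> y" "a \<noteq> y" and y: "y \<in> V"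
    and H: "typed_extremal (V - {x}) (del E x) a y"
  shows "typed_extremal V E x y"
proof -
  let ?P = "graph_poly (del E x)"
  have xa: "{x, a} \<in> E" using x by auto
  have a: "a \<noteq> x" "a \<in> V" using outerplanar_graphD(4)[OF G xa] by auto
  obtain k where k: "extremal ?P a y k" "colour_type (V - {x}) (del E x) a y k"
    using H unfolding typed_extremal_def by blast
  have free: "free_of x ?P" by (rule graph_poly_remove(2)[OF G])
  then have freea: "free_of x (Var a * ?P)" using a(1) by (intro free_of_intros)
  obtain m where m: "\<forall>u. expo m u \<le> 2" "expo m a = 0" "expo m y = 0" "pattern k (coeffs_at ?P m a y)" "expo m x = 0"
    using extremalD[OF k(1)] free by blast
  let ?Q = "(Var x - Var a) * ?P"
  have sg: "sign_eq (graph_poly E) ?Q" using graph_poly_remove(1)[OF G, of x] x by simp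
  \<comment> \<open>Exponent 0 of \<open>x\<close> selects the summand \<open>- a\<close>, which
    shifts the exponent of \<open>a\<close> by one; hence \<open>Suc l\<close>.\<close>
  have Q0: "coeffs_at ?Q (m + var_pow a (Suc l)) x y 0 j = - coeffs_at ?P m a y l j" for l j
  proof -
    have "mcoeff (Var x * ?P) (m + var_pow a (Suc l) + var_pow y j) = 0"
      using m(5) a ne by (intro mcoeff_Var_mult_0) (simp add: expo_var_pow)
    moreover have "mcoeff (Var a * ?P) (m + var_pow y j + var_pow a (Suc l)) = mcoeff ?P (m + var_pow y j + var_pow a l)"
      using mcoeff_Var_power_mult[of a 1 ?P "m + var_pow y j" l] by simp
    ultimately show ?thesis unfolding coeffs_at_def by (simp add: left_diff_distrib ac_simps)
  qed
  have Q1: "coeffs_at ?Q (m + var_pow a l) x y 1 0 = coeffs_at ?P m a y l 0" for l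
  proof -
    have e: "expo (m + var_pow a l) x = 0" using m(5) a by (simp add: expo_var_pow)
    show ?thesis using mcoeff_extract'(1)[OF free e, of 1] mcoeff_extract'(1)[OF free e] mcoeff_extract'(2)[OF freea e, of 1]
      unfolding coeffs_at_def by (simp add: left_diff_distrib)
  qed
  have e2: "\<And>u. l \<le> 2 \<Longrightarrow> expo (m + var_pow a l) u \<le> 2" and ex: "\<And>l. expo (m + var_pow a l) x = 0"
    and ey: "\<And>l. expo (m + var_pow a l) y = 0" for l
    using m a ne by (simp_all add: expo_var_pow)
  let ?V' = "V - {x}" and ?E' = "del E x"
  have restrict: "proper_3_colouring ?V' ?E' C" "C x \<noteq> C a" if "proper_3_colouring V E C" for C
    using that proper_3_colouring_del proper_3_colouring_neq[OF that xa] by auto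
  have extend: "proper_3_colouring V E (C(x := t))" if "proper_3_colouring ?V' ?E' C" "t \<in> {1, 2, 3}" "t \<noteq> C a" for C t
    using proper_3_colouring_extend[OF G that(1,2)] x that(3) by auto
  have Cy: "C y \<in> {1, 2, 3}" if "proper_3_colouring ?V' ?E' C" for C
    using proper_3_colouring_range[OF that, of y] y ne by auto
  have eq: "\<exists>C. proper_3_colouring V E C \<and> C x = C y" if "proper_3_colouring ?V' ?E' C" "C a \<noteq> C y" for C
    using extend[OF that(1) Cy[OF that(1)]] that(2) ne by (intro exI[of _ "C(x := C y)"]) auto
  have neq: "\<exists>C. proper_3_colouring V E C \<and> C x \<noteq> C y" if C: "proper_3_colouring ?V' ?E' C" for C
  proof -
    obtain t :: nat where t: "t \<in> {1, 2, 3}" "t \<noteq> C a \<and> t \<noteq> C y"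
      using free_colour_avoiding_two[of "C a" "C y"] by blast
    then show ?thesis using extend[OF C t(1)] ne by (intro exI[of _ "C(x := t)"]) auto
  qed
  obtain C0 where C0: "proper_3_colouring ?V' ?E' C0"
    using outerplanar_3_colourable[OF outerplanar_graph_del[OF G, of x]] by blast
  consider "k = 0" | "k = 1" | "k = 2" using k(2) unfolding colour_type_def by blast
  then show ?thesis
  proof cases
    case 1
    have "pattern 0 (coeffs_at ?Q (m + var_pow a (Suc 0)) x y)"
      using m(4) 1 Q0[of 0 0] unfolding pattern_def by simp
    then have "extremal ?Q x y 0" using e2[of 1] ex ey by (intro extremalI[of "m + var_pow a (Suc 0)"]) simp_all
    then have "extremal (graph_poly E) x y 0" by (rule extremal_sign_eq[OF sg])
    moreover have "colour_type V E x y 0"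
      using k(2) 1 eq neq unfolding colour_type_def by auto
    ultimately show ?thesis unfolding typed_extremal_def by blast
  next
    case 2
    \<comment> \<open>For \<open>k = 1\<close> nothing is known about the entry
      \<open>A 0 0\<close>, so \<open>a\<close> gets exponent 2, which reads off
      \<open>A 1 0\<close>.\<close>
    have "pattern 0 (coeffs_at ?Q (m + var_pow a (Suc 1)) x y)"
      using m(4) 2 Q0[of 1 0] unfolding pattern_def by simp
    then have "extremal ?Q x y 0" using e2[of 2] ex[of "Suc 1"] ey[of "Suc 1"]
      by (intro extremalI[of "m + var_pow a (Suc 1)"]) (simp_all add: numeral_2_eq_2)
    then have "extremal (graph_poly E) x y 0" by (rule extremal_sign_eq[OF sg])
    moreover have "colour_type V E x y 0"
      using k(2) 2 C0 eq[OF C0] neq[OF C0] unfolding colour_type_def by auto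
    ultimately show ?thesis unfolding typed_extremal_def by blast
  next
    case 3
    \<comment> \<open>At \<open>a^2\<close> the summand \<open>x\<close> contributes the entry
      \<open>A 2 0\<close> and the summand \<open>- a\<close> the entry \<open>- A 1 1\<close>.
      These are opposite by the form for \<open>k = 2\<close>, which yields
      \<open>x - y\<close>.\<close>
    have "pattern 1 (coeffs_at ?Q (m + var_pow a (Suc 1)) x y)"
      using m(4) 3 Q0[of 1 1] Q1[of 2] unfolding pattern_def by (simp add: numeral_2_eq_2)
    then have "extremal ?Q x y 1" using e2[of 2] ex[of "Suc 1"] ey[of "Suc 1"]
      by (intro extremalI[of "m + var_pow a (Suc 1)"]) (simp_all add: numeral_2_eq_2)
    then have "extremal (graph_poly E) x y 1" by (rule extremal_sign_eq[OF sg])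
    moreover have "colour_type V E x y 1"
    proof -
      have "C a = C y" if "proper_3_colouring ?V' ?E' C" for C
        using k(2) 3 that unfolding colour_type_def by auto
      then show ?thesis using restrict unfolding colour_type_def by metis
    qed
    ultimately show ?thesis unfolding typed_extremal_def by blast
  qed
qed

section \<open>Removing an ear\<close>

lemma colour_type_transfer:
  assumes "colour_type V' E' x' y' k"
    and down: "\<And>C. proper_3_colouring V E C \<Longrightarrow>
      \<exists>C'. proper_3_colouring V' E' C' \<and> (C' x' = C' y' \<longleftrightarrow> C x = C y)"
    and up: "\<And>C'. proper_3_colouring V' E' C' \<Longrightarrow>
      \<exists>C. proper_3_colouring V E C \<and> (C x = C y \<longleftrightarrow> C' x' = C' y')"
  shows "colour_type V E x y k"
proof -
  have eq: "\<exists>C. proper_3_colouring V E C \<and> C x = C y" if "\<exists>C. proper_3_colouring V' E' C \<and> C x' = C y'"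
    using that up by metis
  have neq: "\<exists>C. proper_3_colouring V E C \<and> C x \<noteq> C y" if "\<exists>C. proper_3_colouring V' E' C \<and> C x' \<noteq> C y'"
    using that up by metis
  have all_neq: "\<forall>C. proper_3_colouring V E C \<longrightarrow> C x \<noteq> C y"
    if "\<forall>C. proper_3_colouring V' E' C \<longrightarrow> C x' \<noteq> C y'"
    using that down by metis
  have all_eq: "\<forall>C. proper_3_colouring V E C \<longrightarrow> C x = C y"
    if "\<forall>C. proper_3_colouring V' E' C \<longrightarrow> C x' = C y'"
    using that down by metis
  consider "k = 0" "\<exists>C. proper_3_colouring V' E' C \<and> C x' = C y'" "\<exists>C. proper_3_colouring V' E' C \<and> C x' \<noteq> C y'"
    | "k = 1" "\<forall>C. proper_3_colouring V' E' C \<longrightarrow> C x' \<noteq> C y'"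
    | "k = 2" "\<forall>C. proper_3_colouring V' E' C \<longrightarrow> C x' = C y'"
    using assms(1) unfolding colour_type_def by argo
  then show ?thesis
  proof cases
    case 1
    then show ?thesis using eq neq unfolding colour_type_def by simp
  next
    case 2
    then show ?thesis using all_neq unfolding colour_type_def by simp
  next
    case 3
    then show ?thesis using all_eq unfolding colour_type_def by simp
  qed
qed

lemma ear_graph_poly:
  assumes G: "outerplanar_graph V E" and x: "nbrs E x = {a, b}" and a: "nbrs E a = {x, b, c}"
    and dist: "distinct [x, a, b, c]"
  shows "sign_eq (graph_poly E) ((Var x - Var a) * (Var x - Var b) * (Var a - Var b) * (Var a - Var c) * graph_poly (del (del E x) a))"
    and "nbrs (del E x) a = {b, c}"
    and "free_of a (graph_poly (del (del E x) a))" "free_of x (graph_poly (del (del E x) a))"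
    and "outerplanar_graph (V - {x} - {a}) (del (del E x) a)"
proof -
  note D = outerplanar_graphD[OF G] and G1 = outerplanar_graph_del[OF G, of x]
  show na: "nbrs (del E x) a = {b, c}" using a dist by auto
  show G2: "outerplanar_graph (V - {x} - {a}) (del (del E x) a)" by (rule outerplanar_graph_del[OF G1])
  show "free_of a (graph_poly (del (del E x) a))" by (rule graph_poly_remove(2)[OF G1])
  show "free_of x (graph_poly (del (del E x) a))" by (rule free_of_graph_poly) (simp_all add: D(5))
  let ?P = "graph_poly (del (del E x) a)"
  have "sign_eq (graph_poly E) ((Var x - Var a) * (Var x - Var b) * graph_poly (del E x))"
    using graph_poly_remove(1)[OF G, of x] dist unfolding x by simp
  moreover have "sign_eq (graph_poly (del E x)) ((Var a - Var b) * (Var a - Var c) * ?P)"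
    using graph_poly_remove(1)[OF G1, of a] dist unfolding na by simp
  then have "sign_eq ((Var x - Var a) * (Var x - Var b) * graph_poly (del E x))
      ((Var x - Var a) * (Var x - Var b) * ((Var a - Var b) * (Var a - Var c) * ?P))"
    by (intro sign_eq_mult sign_eq_refl)
  ultimately have "sign_eq (graph_poly E) ((Var x - Var a) * (Var x - Var b) * ((Var a - Var b) * (Var a - Var c) * ?P))"
    by (rule sign_eq_trans)
  then show "sign_eq (graph_poly E) ((Var x - Var a) * (Var x - Var b) * (Var a - Var b) * (Var a - Var c) * ?P)"
    by (simp only: mult.assoc)
qed

text \<open>The triangles \<open>x a b\<close> and \<open>a b c\<close> force the colours of \<open>x\<close> and \<open>c\<close> to agree.\<close>

lemma typed_extremal_diamond:
  assumes G: "outerplanar_graph V E" and x: "nbrs E x = {a, b}" and a: "nbrs E a = {x, b, c}"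
    and dist: "distinct [x, a, b, c]" and y: "y \<notin> {x, a, b}" "y \<in> V" and bc: "{b, c} \<in> E"
    and H: "c \<noteq> y \<Longrightarrow> typed_extremal (V - {x} - {a}) (del (del E x) a) c y"
  shows "typed_extremal V E x y"
proof -
  let ?E = "del (del E x) a" and ?V = "V - {x} - {a}"
  let ?P = "graph_poly ?E"
  let ?Q = "(Var x - Var a) * (Var x - Var b) * (Var a - Var b) * (Var a - Var c) * ?P"
  note D = outerplanar_graphD[OF G] and ear = ear_graph_poly[OF G x a dist]
  have bc': "{b, c} \<in> ?E" using bc dist by auto
  let ?R0 = "graph_poly (?E - {{b, c}})"
  have R0: "free_of a ?R0" by (rule free_of_graph_poly) (simp_all add: D(5))
  \<comment> \<open>The unspecified sign of \<open>graph_poly\<close> is absorbed into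
    \<open>R\<close>.\<close>
  obtain R where R: "?P = (Var b - Var c) * R" "free_of a R"
  proof -
    have "?P = (Var b - Var c) * ?R0 \<or> ?P = (Var b - Var c) * (- ?R0)"
      using graph_poly_insert_edge[OF ear(5) bc'] unfolding sign_eq_def by simp
    then show thesis using that R0 free_of_intros(3)[OF R0] by blast
  qed
  have diamond: "mcoeff ?Q (m + var_pow a 2) = mcoeff (Var x ^ 2 * ?P + Var x * (Var c * ?P) + Var c ^ 2 * ?P) m"
    if "expo m a = 0" "expo m b \<le> 2" "expo m c \<le> 2" for m
    unfolding R(1) by (rule mcoeff_diamond[OF R(2) dist that])
  have edges: "{x, a} \<in> E" "{x, b} \<in> E" "{a, b} \<in> E" "{a, c} \<in> E"
    using x a by auto
  have inV: "x \<in> V" "a \<in> V" "b \<in> V" "c \<in> V" using D(4)[OF edges(1)] D(4)[OF edges(2)] D(4)[OF edges(4)] by auto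
  have forced: "C x = C c" if C: "proper_3_colouring V E C" for C
    using proper_3_colouring_neq[OF C edges(1)] proper_3_colouring_neq[OF C edges(2)]
      proper_3_colouring_neq[OF C edges(3)] proper_3_colouring_neq[OF C edges(4)] proper_3_colouring_neq[OF C bc]
      proper_3_colouring_range[OF C inV(1)] proper_3_colouring_range[OF C inV(2)]
      proper_3_colouring_range[OF C inV(3)] proper_3_colouring_range[OF C inV(4)] by presburger
  have freecP: "free_of x (Var c * ?P)" "free_of x (Var c ^ 2 * ?P)"
    using dist by (intro free_of_intros free_of_power ear(4); auto)+
  have E: "mcoeff (Var x ^ 2 * ?P + Var x * (Var c * ?P) + Var c ^ 2 * ?P) (n + var_pow x i)
    = (if 2 = i then mcoeff ?P n else 0) + (if i = 1 then mcoeff (Var c * ?P) n else 0)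
      + (if i = 0 then mcoeff (Var c ^ 2 * ?P) n else 0)" if "expo n x = 0" for n i
    using mcoeff_extract[OF ear(4) that, of 2 i] mcoeff_extract'(1)[OF freecP(1) that, of i]
      mcoeff_extract'(2)[OF freecP(2) that, of i] by (simp only: mcoeff_simps)
  show ?thesis
  proof (cases "c = y")
    case True
    \<comment> \<open>With \<open>c = y\<close> the form \<open>x^2 + x c + c^2\<close> is itself
      the pattern for \<open>k = 2\<close>; it remains to multiply by a monomial avoiding
      \<open>y\<close>.\<close>
    have sm: "small_monomial ?P {y}" by (rule small_monomial_graph_poly_avoiding_vertex[OF ear(5)])
    obtain m where m0: "\<forall>u. expo m u \<le> 2" "\<forall>u\<in>{y}. expo m u = 0" "\<not> 3 dvd mcoeff ?P m"
      "\<forall>v. free_of v ?P \<longrightarrow> expo m v = 0"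
      using small_monomialD[OF sm] by blast
    have m: "\<forall>u. expo m u \<le> 2" "expo m y = 0" "\<not> 3 dvd mcoeff ?P m" "expo m x = 0" "expo m a = 0"
      using m0(1-3) m0(4)[rule_format, OF ear(4)] m0(4)[rule_format, OF ear(3)] by simp_all
    have Q: "coeffs_at ?Q (m + var_pow a 2) x y i j
      = mcoeff (Var x ^ 2 * ?P + Var x * (Var c * ?P) + Var c ^ 2 * ?P) (m + var_pow y j + var_pow x i)" if "j \<le> 2" for i j
    proof -
      let ?n = "m + var_pow y j + var_pow x i"
      have "expo ?n a = 0" "expo ?n b \<le> 2" "expo ?n c \<le> 2"
        using m dist y that True by (auto simp: expo_var_pow)
      note diamond[OF this]
      moreover have "m + var_pow a 2 + var_pow x i + var_pow y j = ?n + var_pow a 2" by (simp only: add_ac)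
      ultimately show ?thesis unfolding coeffs_at_def by (simp only:)
    qed
    have e: "expo (m + var_pow y j) x = 0" for j using m(4) y by (auto simp: expo_var_pow)
    have yy: "mcoeff (Var c * ?P) (m + var_pow y 1) = mcoeff ?P m" "mcoeff (Var c ^ 2 * ?P) (m + var_pow y 2) = mcoeff ?P m"
      using mcoeff_Var_power_mult[of c 1 ?P m 0] mcoeff_Var_power_mult[of c 2 ?P m 0] True by simp_all
    have "coeffs_at ?Q (m + var_pow a 2) x y 2 0 = mcoeff ?P m"
      "coeffs_at ?Q (m + var_pow a 2) x y 1 1 = mcoeff ?P m"
      "coeffs_at ?Q (m + var_pow a 2) x y 0 2 = mcoeff ?P m"
      using Q[of 0 2] Q[of 1 1] Q[of 2 0] E[OF e, of 0 2] E[OF e, of 1 1] E[OF e, of 2 0] yy by simp_all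
    then have "pattern 2 (coeffs_at ?Q (m + var_pow a 2) x y)" using m(3) unfolding pattern_def by simp
    then have "extremal ?Q x y 2"
      using m y dist by (intro extremalI[of "m + var_pow a 2"]) (auto simp: expo_var_pow)
    then have "extremal (graph_poly E) x y 2" by (rule extremal_sign_eq[OF ear(1)])
    moreover have "colour_type V E x y 2" using forced True unfolding colour_type_def by blast
    ultimately show ?thesis unfolding typed_extremal_def by blast
  next
    case False
    obtain k where k: "extremal ?P c y k" "colour_type ?V ?E c y k"
      using H[OF False] unfolding typed_extremal_def by blast
    obtain m where m: "\<forall>u. expo m u \<le> 2" "expo m c = 0" "expo m y = 0" "pattern k (coeffs_at ?P m c y)"
      and mf: "\<forall>v. free_of v ?P \<longrightarrow> expo m v = 0"
      using extremalD[OF k(1)] by blast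
    note m = m mf[rule_format, OF ear(4)] mf[rule_format, OF ear(3)]
    \<comment> \<open>Why \<open>c\<close> gets exponent 2: in \<open>x^2 + x c + c^2\<close> the
      power \<open>x^i\<close> comes with \<open>c^(2 - i)\<close>, so the coefficient of
      \<open>x^i\<close> becomes that of \<open>c^i\<close> in the smaller polynomial, and
      \<open>x\<close> takes over the role of \<open>c\<close>.\<close>
    let ?m = "m + var_pow c 2 + var_pow a 2"
    have Q: "coeffs_at ?Q ?m x y i j = coeffs_at ?P m c y i j" if ij: "i \<le> 2" "j \<le> 2" for i j
    proof -
      let ?n = "m + var_pow y j + var_pow c 2"
      have "coeffs_at ?Q ?m x y i j
        = mcoeff (Var x ^ 2 * ?P + Var x * (Var c * ?P) + Var c ^ 2 * ?P) (?n + var_pow x i)"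
      proof -
        have "expo (?n + var_pow x i) a = 0" "expo (?n + var_pow x i) b \<le> 2" "expo (?n + var_pow x i) c \<le> 2"
          using m dist y ij False by (auto simp: expo_var_pow)
        note diamond[OF this]
        moreover have "?m + var_pow x i + var_pow y j = ?n + var_pow x i + var_pow a 2" by (simp only: add_ac)
        ultimately show ?thesis unfolding coeffs_at_def by (simp only:)
      qed
      moreover have e: "expo ?n x = 0" using m(5) dist y by (auto simp: expo_var_pow)
      moreover have c1: "mcoeff (Var c * ?P) ?n = mcoeff ?P (m + var_pow y j + var_pow c 1)"
        using mcoeff_Var_power_mult[of c 1 ?P "m + var_pow y j" 1] by (simp add: numeral_2_eq_2)
      moreover have c2: "mcoeff (Var c ^ 2 * ?P) ?n = mcoeff ?P (m + var_pow y j)"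
        using mcoeff_Var_power_mult[of c 2 ?P "m + var_pow y j" 0] by simp
      ultimately have "coeffs_at ?Q ?m x y i j = (if i = 2 then mcoeff ?P ?n else if i = 1
          then mcoeff ?P (m + var_pow y j + var_pow c 1) else mcoeff ?P (m + var_pow y j))"
        using ij(1) E[OF e, of i] by auto
      also have "\<dots> = mcoeff ?P (m + var_pow y j + var_pow c i)"
      proof -
        consider "i = 0" | "i = 1" | "i = 2" using ij(1) by linarith
        then show ?thesis by cases simp_all
      qed
      also have "m + var_pow y j + var_pow c i = m + var_pow c i + var_pow y j" by (simp only: add_ac)
      finally show ?thesis unfolding coeffs_at_def .
    qed
    have "pattern k (coeffs_at ?Q ?m x y) = pattern k (coeffs_at ?P m c y)" by (rule pattern_cong) (rule Q)
    then have "extremal ?Q x y k"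
      using m y dist False by (intro extremalI[of ?m]) (auto simp: expo_var_pow)
    then have "extremal (graph_poly E) x y k" by (rule extremal_sign_eq[OF ear(1)])
    moreover have "colour_type V E x y k"
    proof (rule colour_type_transfer[OF k(2)])
      show "\<exists>C'. proper_3_colouring ?V ?E C' \<and> (C' c = C' y \<longleftrightarrow> C x = C y)" if C: "proper_3_colouring V E C" for C
      proof -
        have "proper_3_colouring ?V ?E C" using C by (intro proper_3_colouring_del)
        then show ?thesis using forced[OF C] by (intro exI[of _ C]) simp
      qed
      show "\<exists>C. proper_3_colouring V E C \<and> (C x = C y \<longleftrightarrow> C' c = C' y)" if C: "proper_3_colouring ?V ?E C'" for C'
      proof -
        have "card (nbrs (del E x) a) \<le> 2" unfolding ear(2) by (simp add: card_insert_if)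
        then obtain s where s: "proper_3_colouring (V - {x}) (del E x) (C'(a := s))"
          using proper_3_colouring_extend_low_degree[OF outerplanar_graph_del[OF G] _ C] by blast
        have "card (nbrs E x) \<le> 2" unfolding x by (simp add: card_insert_if)
        then obtain t where t: "proper_3_colouring V E ((C'(a := s))(x := t))"
          using proper_3_colouring_extend_low_degree[OF G _ s] by blast
        show ?thesis
          by (rule exI[of _ "(C'(a := s))(x := t)"]) (use forced[OF t] t y dist in auto)
      qed
    qed
    ultimately show ?thesis unfolding typed_extremal_def by blast
  qed
qed

lemma typed_extremal_0I:
  assumes "small_monomial (graph_poly E) {x, y}" "\<exists>C. proper_3_colouring V E C \<and> C x = C y" "\<exists>C. proper_3_colouring V E C \<and> C x \<noteq> C y"
  shows "typed_extremal V E x y"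
  unfolding typed_extremal_def
proof (intro exI conjI)
  show "extremal (graph_poly E) x y 0" using assms(1) by (rule extremal_0I)
  show "colour_type V E x y 0" using assms(2,3) unfolding colour_type_def by simp
qed

lemma proper_3_colouring_ear:
  assumes G: "outerplanar_graph V E" and x: "nbrs E x = {a, b}" and a: "nbrs E a = {x, b, c}"
    and dist: "distinct [x, a, b, c]" and C: "proper_3_colouring (V - {x} - {a}) (del (del E x) a) C"
    and ta: "ta \<in> {1, 2, 3}" "ta \<noteq> C b" "ta \<noteq> C c" and tx: "tx \<in> {1, 2, 3}" "tx \<noteq> C b" "tx \<noteq> ta"
  shows "proper_3_colouring V E (C(a := ta, x := tx))"
proof -
  have na: "nbrs (del E x) a = {b, c}" by (rule ear_graph_poly(2)[OF G x a dist])
  have "proper_3_colouring (V - {x}) (del E x) (C(a := ta))"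
  proof (rule proper_3_colouring_extend[OF outerplanar_graph_del[OF G] C ta(1)])
    fix u assume "u \<in> nbrs (del E x) a"
    then have "u = b \<or> u = c" using na by blast
    then show "C u \<noteq> ta" using ta(2,3) by auto
  qed
  then show ?thesis
  proof (rule proper_3_colouring_extend[OF G _ tx(1)])
    fix u assume "u \<in> nbrs E x"
    then have "u = a \<or> u = b" using x by blast
    then show "(C(a := ta)) u \<noteq> tx" using tx(2,3) dist by auto
  qed
qed

text \<open>Smoothing \<open>a\<close> after deleting \<open>x\<close> shows that \<open>b y\<close>
  may be added as an edge. Hence the smaller graph has colourings with \<open>b\<close> and
  \<open>y\<close> different, where \<open>x\<close> can copy \<open>y\<close>, and with
  \<open>b\<close> and \<open>y\<close> equal, where \<open>x\<close> must differ from
  \<open>y\<close>. For the monomial, \<open>a^2 b^2\<close> times one that avoids \<open>b\<close>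
  and \<open>y\<close> selects the first term of \<open>b^2 + b y\<close>.\<close>

lemma typed_extremal_open_diamond_adjacent:
  assumes G: "outerplanar_graph V E" and x: "nbrs E x = {a, b}" and a: "nbrs E a = {x, b, y}"
    and dist: "distinct [x, a, b, y]" and by': "{b, y} \<notin> E"
  shows "typed_extremal V E x y"
proof (rule typed_extremal_0I)
  let ?E = "del (del E x) a" and ?V = "V - {x} - {a}"
  let ?P = "graph_poly ?E"
  let ?Q = "(Var x - Var a) * (Var x - Var b) * (Var a - Var b) * (Var a - Var y) * ?P"
  note D = outerplanar_graphD[OF G] and ear = ear_graph_poly[OF G x a dist] and G1 = outerplanar_graph_del[OF G, of x]
  have ab: "{a, b} \<in> del E x" "{a, y} \<in> del E x" and ne: "b \<noteq> y" using a dist by auto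
  have G2: "outerplanar_graph ?V (insert {b, y} ?E)" by (rule outerplanar_graph_smooth[OF G1 ab ne])
  have by2: "{b, y} \<notin> ?E" using by' by simp
  have sm: "small_monomial ?P {b, y}" by (rule small_monomial_graph_poly_avoiding_edge[OF G2 by2])
  obtain m where m0: "\<forall>u. expo m u \<le> 2" "\<forall>u\<in>{b, y}. expo m u = 0" "\<not> 3 dvd mcoeff ?P m"
    "\<forall>v. free_of v ?P \<longrightarrow> expo m v = 0"
    using small_monomialD[OF sm] by blast
  have m: "\<forall>u. expo m u \<le> 2" "expo m b = 0" "expo m y = 0" "\<not> 3 dvd mcoeff ?P m" "expo m x = 0" "expo m a = 0"
    using m0(1-3) m0(4)[rule_format, OF ear(4)] m0(4)[rule_format, OF ear(3)] by simp_all
  let ?n = "m + var_pow b 2"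
  have "expo ?n a = 0" "expo ?n x = 0" using m dist by (auto simp: expo_var_pow)
  then have "mcoeff ?Q (?n + var_pow a 2) = - mcoeff (Var b ^ 2 * ?P + Var b * (Var y * ?P)) ?n"
    by (rule mcoeff_open_diamond[OF ear(3) dist])
  moreover have "mcoeff (Var b ^ 2 * ?P) ?n = mcoeff ?P m"
    using mcoeff_Var_power_mult[of b 2 ?P m 0] by simp
  moreover have "mcoeff (Var y * (Var b * ?P)) ?n = 0"
    using m(3) ne by (intro mcoeff_Var_mult_0) (auto simp: expo_var_pow)
  then have "mcoeff (Var b * (Var y * ?P)) ?n = 0" by (simp only: mult.left_commute)
  ultimately have "mcoeff ?Q (?n + var_pow a 2) = - mcoeff ?P m" by simp
  then have "small_monomial ?Q {x, y}"
    using m dist by (intro small_monomialI[of "?n + var_pow a 2"]) (auto simp: expo_var_pow)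
  then show "small_monomial (graph_poly E) {x, y}" by (rule small_monomial_sign_eq[OF ear(1)])
  have edges: "{x, a} \<in> E" "{x, b} \<in> E" "{a, y} \<in> E" using x a by auto
  have inV: "b \<in> ?V" "y \<in> ?V"
    using D(4)[OF edges(2)] D(4)[OF edges(3)] dist by auto
  obtain C where C: "proper_3_colouring ?V ?E C" "C b \<noteq> C y"
    using colouring_of_edge_deleted[OF G2] by blast
  obtain ta :: nat where ta: "ta \<in> {1, 2, 3}" "ta \<noteq> C b \<and> ta \<noteq> C y" using free_colour_avoiding_two by blast
  have "C y \<in> {1, 2, 3}" using proper_3_colouring_range[OF C(1) inV(2)] by auto
  then have "proper_3_colouring V E (C(a := ta, x := C y))"
    using C(2) ta by (intro proper_3_colouring_ear[OF G x a dist C(1)]) auto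
  then show "\<exists>C. proper_3_colouring V E C \<and> C x = C y"
    using dist by (intro exI[of _ "C(a := ta, x := C y)"]) auto
  obtain C' where C': "proper_3_colouring ?V ?E C'" "C' b = C' y"
    using colouring_identifying_edge_deleted[OF G2 by2] by blast
  obtain ta' :: nat where ta': "ta' \<in> {1, 2, 3}" "ta' \<noteq> C' b \<and> ta' \<noteq> C' y" using free_colour_avoiding_two by blast
  obtain tx :: nat where tx: "tx \<in> {1, 2, 3}" "tx \<noteq> C' b \<and> tx \<noteq> ta'" using free_colour_avoiding_two by blast
  have "proper_3_colouring V E (C'(a := ta', x := tx))"
    using ta' tx by (intro proper_3_colouring_ear[OF G x a dist C'(1)]) auto
  then show "\<exists>C. proper_3_colouring V E C \<and> C x \<noteq> C y"
    using dist tx C'(2) by (intro exI[of _ "C'(a := ta', x := tx)"]) auto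
qed

text \<open>\<open>p\<close>, \<open>q\<close>, \<open>t\<close> are the colours of
  \<open>c\<close>, \<open>d\<close>, \<open>x\<close>. The two colours other than \<open>t\<close>
  can be given to \<open>a\<close> and \<open>b\<close> in two orders, and both orders are blocked
  only if \<open>p = q\<close>.\<close>

lemma ear_colours:
  fixes p q t :: nat
  assumes "p = 1 \<or> p = 2 \<or> p = 3" "q = 1 \<or> q = 2 \<or> q = 3" "t = 1 \<or> t = 2 \<or> t = 3" "p \<noteq> q"
  shows "\<exists>tb\<in>{1, 2, 3}. \<exists>ta\<in>{1, 2, 3}. tb \<noteq> q \<and> ta \<noteq> tb \<and> ta \<noteq> p \<and> t \<noteq> tb \<and> t \<noteq> ta"
  using assms by (elim disjE) simp_all

text \<open>Extracting \<open>a^2\<close> leaves \<open>b (b + c) (b - d)\<close> up to sign, in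
  which \<open>b^2\<close> has coefficient \<open>c - d\<close>. If \<open>c d\<close> is not an
  edge, this factor completes the polynomial of the graph with \<open>b\<close> smoothed as well; if
  it is one, the edge gets doubled. As to colours, \<open>c\<close> and \<open>d\<close> can be
  coloured differently, and then \<open>x\<close> can take any colour independently of
  \<open>y\<close>.\<close>

lemma typed_extremal_ladder:
  assumes G: "outerplanar_graph V E" and x: "nbrs E x = {a, b}" and a: "nbrs E a = {x, b, c}"
    and b: "nbrs E b = {x, a, d}" and dist: "distinct [x, a, b, c, d]"
    and y: "y \<notin> {x, a, b, c}" "y \<in> V"
  shows "typed_extremal V E x y"
proof (rule typed_extremal_0I)
  let ?E = "del (del E x) a" and ?V = "V - {x} - {a}"
  let ?P = "graph_poly ?E"
  let ?Q = "(Var x - Var a) * (Var x - Var b) * (Var a - Var b) * (Var a - Var c) * ?P"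
  let ?E3 = "del ?E b" and ?V3 = "V - {x} - {a} - {b}"
  let ?P3 = "graph_poly ?E3"
  have dist': "distinct [x, a, b, c]" using dist by simp
  note D = outerplanar_graphD[OF G] and ear = ear_graph_poly[OF G x a dist'] and G1 = outerplanar_graph_del[OF G, of x]
  have ab: "{a, b} \<in> del E x" "{a, c} \<in> del E x" and ne: "b \<noteq> c" "c \<noteq> d" using a dist by auto
  have G2: "outerplanar_graph ?V (insert {b, c} ?E)" by (rule outerplanar_graph_smooth[OF G1 ab ne(1)])
  have nb: "nbrs ?E b = {d}" using b dist by auto
  have G3: "outerplanar_graph ?V3 (insert {c, d} ?E3)"
  proof -
    have "{b, c} \<in> insert {b, c} ?E" "{b, d} \<in> insert {b, c} ?E" using nb by auto
    from outerplanar_graph_smooth[OF G2 this ne(2)]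
    have "outerplanar_graph ?V3 (insert {c, d} (del (insert {b, c} ?E) b))" .
    moreover have "del (insert {b, c} ?E) b = ?E3" by auto
    ultimately show ?thesis by simp
  qed
  have G3': "outerplanar_graph ?V3 ?E3" by (rule outerplanar_graph_del[OF ear(5)])
  have sm: "small_monomial ((Var c - Var d) * ?P3) {y}"
  proof (cases "{c, d} \<in> ?E3")
    case True
    then show ?thesis by (rule small_monomial_doubled_edge[OF G3'])
  next
    case False
    have "sign_eq (graph_poly (insert {c, d} ?E3)) ((Var c - Var d) * ?P3)"
      by (rule graph_poly_insert[OF outerplanar_graphD(2)[OF G3'] False ne(2)])
    then show ?thesis
      using small_monomial_graph_poly_avoiding_vertex[OF G3, of y] by (rule small_monomial_sign_eq[OF sign_eq_sym])
  qed
  have free3: "free_of b ?P3" "free_of a ?P3" "free_of x ?P3"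
    by (rule free_of_graph_poly; simp add: D(5))+
  have free: "free_of v ((Var c - Var d) * ?P3)" if "v \<in> {x, a, b}" for v
    using that free3 dist by (intro free_of_intros) auto
  obtain m where m0: "\<forall>u. expo m u \<le> 2" "\<forall>u\<in>{y}. expo m u = 0" "\<not> 3 dvd mcoeff ((Var c - Var d) * ?P3) m"
    "\<forall>v. free_of v ((Var c - Var d) * ?P3) \<longrightarrow> expo m v = 0"
    using small_monomialD[OF sm] by blast
  have m: "\<forall>u. expo m u \<le> 2" "expo m y = 0" "expo m b = 0" "expo m x = 0" "expo m a = 0"
    using m0(1,2) m0(4) free by auto
  have P: "sign_eq ?P ((Var b - Var d) * ?P3)"
    using graph_poly_remove(1)[OF ear(5), of b] unfolding nb by simp
  let ?Q3 = "(Var x - Var a) * (Var x - Var b) * (Var a - Var b) * (Var a - Var c) * ((Var b - Var d) * ?P3)"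
  have "sign_eq ?Q ?Q3" by (intro sign_eq_mult sign_eq_refl P)
  with ear(1) have sg: "sign_eq (graph_poly E) ?Q3" by (rule sign_eq_trans)
  have fa: "free_of a ((Var b - Var d) * ?P3)" using dist by (intro free_of_intros free3(2)) auto
  let ?n = "m + var_pow b 2"
  have "expo ?n a = 0" "expo ?n x = 0" using m dist by (auto simp: expo_var_pow)
  then have "mcoeff ?Q3 (?n + var_pow a 2)
    = - mcoeff (Var b ^ 2 * ((Var b - Var d) * ?P3) + Var b * (Var c * ((Var b - Var d) * ?P3))) ?n"
    by (rule mcoeff_open_diamond[OF fa dist'])
  also have "Var b ^ 2 * ((Var b - Var d) * ?P3) + Var b * (Var c * ((Var b - Var d) * ?P3))
    = Var b ^ 3 * ?P3 + Var b ^ 2 * ((Var c - Var d) * ?P3) - Var b * (Var c * Var d * ?P3)"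
    by (simp add: algebra_simps power2_eq_square power3_eq_cube)
  also have "mcoeff \<dots> ?n = mcoeff ((Var c - Var d) * ?P3) m"
  proof -
    have "free_of b (Var c * Var d * ?P3)" using dist by (intro free_of_intros free3(1)) auto
    then show ?thesis
      using mcoeff_extract[OF free3(1) m(3), of 3 2] mcoeff_extract[OF free[of b] m(3), of 2 2]
        mcoeff_extract'(1)[OF _ m(3), of "Var c * Var d * ?P3" 2]
      by (simp only: mcoeff_simps) simp
  qed
  finally have "mcoeff ?Q3 (?n + var_pow a 2) = - mcoeff ((Var c - Var d) * ?P3) m" .
  then have "small_monomial ?Q3 {x, y}"
    using m m0(3) dist y by (intro small_monomialI[of "?n + var_pow a 2"]) (auto simp: expo_var_pow)
  then show "small_monomial (graph_poly E) {x, y}" by (rule small_monomial_sign_eq[OF sg])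
  obtain C where C: "proper_3_colouring ?V3 ?E3 C" "C c \<noteq> C d"
    using colouring_of_edge_deleted[OF G3] by blast
  have edges: "{a, c} \<in> E" "{b, d} \<in> E" using a b by auto
  have inV: "c \<in> ?V3" "d \<in> ?V3" "y \<in> ?V3"
    using D(4)[OF edges(1)] D(4)[OF edges(2)] dist y by auto
  have any: "\<exists>C'. proper_3_colouring V E C' \<and> C' x = t \<and> C' y = C y" if t: "t \<in> {1, 2, 3}" for t
  proof -
    obtain tb ta where tb: "tb \<in> {1, 2, 3}" and ta: "ta \<in> {1, 2, 3}"
      and "tb \<noteq> C d \<and> ta \<noteq> tb \<and> ta \<noteq> C c \<and> t \<noteq> tb \<and> t \<noteq> ta"
      using ear_colours[OF proper_3_colouring_range[OF C(1) inV(1)] proper_3_colouring_range[OF C(1) inV(2)] _ C(2), of t] t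
      by blast
    then have ne: "tb \<noteq> C d" "ta \<noteq> tb" "ta \<noteq> C c" "t \<noteq> tb" "t \<noteq> ta" by simp_all
    have Cb: "proper_3_colouring ?V ?E (C(b := tb))"
    proof (rule proper_3_colouring_extend[OF ear(5) C(1) tb])
      fix u assume "u \<in> nbrs ?E b"
      then have "u = d" unfolding nb by simp
      then show "C u \<noteq> tb" using ne(1) by simp
    qed
    have "proper_3_colouring V E ((C(b := tb))(a := ta, x := t))"
      using ne ta t dist by (intro proper_3_colouring_ear[OF G x a dist' Cb]) auto
    then show ?thesis using dist y by (intro exI[of _ "(C(b := tb))(a := ta, x := t)"]) auto
  qed
  have "C y \<in> {1, 2, 3}" using proper_3_colouring_range[OF C(1) inV(3)] by auto
  from any[OF this] show "\<exists>C. proper_3_colouring V E C \<and> C x = C y" by metis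
  obtain t :: nat where t: "t \<in> {1, 2, 3}" "t \<noteq> C y" using free_colour_avoiding_two[of "C y" "C y"] by blast
  from any[OF t(1)] show "\<exists>C. proper_3_colouring V E C \<and> C x \<noteq> C y" using t(2) by metis
qed

text \<open>By \<open>min\<close> the vertex \<open>a\<close> has degree at least 3, but by
  \<open>low\<close> at most 2 once \<open>x\<close> is smoothed. So it loses \<open>x\<close>
  without gaining \<open>b\<close>: already \<open>a b\<close> is an edge, and \<open>a\<close> has
  exactly one further neighbour \<open>c\<close>.\<close>

lemma typed_extremal_ear:
  assumes G: "outerplanar_graph V E" and x: "nbrs E x = {a, b}" and "a \<noteq> b"
    and y: "y \<notin> {x, a, b}" "y \<in> V"
    and min: "\<And>v. v \<in> V \<Longrightarrow> v \<notin> {x, y} \<Longrightarrow> \<not> card (nbrs E v) \<le> 2"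
    and low: "card (nbrs (insert {a, b} (del E x)) a) \<le> 2"
    and IH: "\<And>c. c \<in> V - {x} - {a} \<Longrightarrow> c \<noteq> y \<Longrightarrow> typed_extremal (V - {x} - {a}) (del (del E x) a) c y"
  shows "typed_extremal V E x y"
proof -
  note D = outerplanar_graphD[OF G]
  have xa: "{x, a} \<in> E" and xb: "{x, b} \<in> E" using x by auto
  have inV: "x \<in> V" "a \<in> V" "b \<in> V" "x \<noteq> a" "x \<noteq> b" using D(4)[OF xa] D(4)[OF xb] by auto
  let ?N = "nbrs E a"
  have fin: "finite ?N" and xN: "x \<in> ?N" using D(6) xa nbrs_sym[of x a E] by auto
  have big: "\<not> card ?N \<le> 2" using min[OF inV(2)] inV y by auto
  have N1: "nbrs (insert {a, b} (del E x)) a = insert b (?N - {x})"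
    using nbrs_insert(2)[OF assms(3), of "del E x"] nbrs_del[OF inV(4), of E] by simp
  have cardN: "card (?N - {x}) = card ?N - 1" using xN fin by simp
  have bN: "b \<in> ?N"
  proof (rule ccontr)
    assume "b \<notin> ?N"
    then have "card (insert b (?N - {x})) = Suc (card (?N - {x}))" using fin by (intro card_insert_disjoint) auto
    then show False using low big cardN unfolding N1 by linarith
  qed
  then have "insert b (?N - {x}) = ?N - {x}" using inV by auto
  then have "card (?N - {x}) = 2" using low big cardN unfolding N1 by simp
  then obtain p q where pq: "?N - {x} = {p, q}" "p \<noteq> q" by (auto simp: card_2_iff)
  have "b \<in> ?N - {x}" using bN inV by simp
  then have "b = p \<or> b = q" unfolding pq(1) by blast
  then obtain c where c: "?N - {x} = {b, c}" "b \<noteq> c"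
  proof
    assume "b = p"
    then show ?thesis using that pq by blast
  next
    assume "b = q"
    then show ?thesis using that[of p] pq by (simp add: insert_commute)
  qed
  have "?N = insert x (?N - {x})" using xN by (simp only: insert_Diff)
  then have a: "?N = {x, b, c}" unfolding c(1) .
  have ac: "{a, c} \<in> E" "{a, b} \<in> E" using a by auto
  have "c \<noteq> x" using c by auto
  then have dist: "distinct [x, a, b, c]" using inV D(4)[OF ac(1)] c assms(3) by auto
  have cV: "c \<in> V" using D(4)[OF ac(1)] by simp
  show ?thesis
  proof (cases "{b, c} \<in> E")
    case True
    then show ?thesis
      using typed_extremal_diamond[OF G x a dist y True] IH[of c] cV dist by auto
  next
    case bc: False
    show ?thesis
    proof (cases "c = y")
      case True
      then show ?thesis using typed_extremal_open_diamond_adjacent[of V E x a b y] G x a dist bc by simp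
    next
      case False
      let ?V = "V - {x} - {a}" and ?E = "del (del E x) a"
      have ab1: "{a, b} \<in> del E x" "{a, c} \<in> del E x" using ac dist by auto
      have G2: "outerplanar_graph ?V (insert {b, c} ?E)"
        by (rule outerplanar_graph_smooth[OF outerplanar_graph_del[OF G] ab1 c(2)])
      have bV: "b \<in> ?V - {y}" using inV y dist by auto
      \<comment> \<open>Only \<open>b\<close> can be this vertex: \<open>c\<close> trades its
        neighbour \<open>a\<close> for \<open>b\<close>, and vertices other than \<open>b\<close>
        and \<open>c\<close> keep their neighbours, while \<open>b\<close> loses \<open>x\<close>
        and \<open>a\<close> and gains \<open>c\<close>. It follows that \<open>b\<close> has
        exactly one neighbour \<open>d\<close> besides \<open>x\<close> and
        \<open>a\<close>.\<close>
      obtain w where w: "w \<in> ?V - {y}" "card (nbrs (insert {b, c} ?E) w) \<le> 2"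
        using low_degree_vertex_avoiding(1)[OF G2, of y] bV by blast
      have w2: "nbrs ?E w = nbrs E w - {x} - {a}"
        using w(1) nbrs_del[of a w "del E x"] nbrs_del[of x w E] by auto
      have wbig: "\<not> card (nbrs E w) \<le> 2" and wfin: "finite (nbrs E w)" using min[of w] w(1) D(6) by auto
      consider "w \<notin> {b, c}" | "w = c" | "w = b" by blast
      then show ?thesis
      proof cases
        case 1
        have "w \<notin> nbrs E x" "w \<notin> nbrs E a" unfolding x a using 1 w(1) by auto
        then have "x \<notin> nbrs E w" "a \<notin> nbrs E w" by (simp_all add: nbrs_sym[of _ w E] del: mem_Collect_eq)
        then have "nbrs (insert {b, c} ?E) w = nbrs E w" using nbrs_insert(1)[OF 1, of ?E] w2 by auto
        then show ?thesis using w(2) wbig by simp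
      next
        case 2
        have "w \<notin> nbrs E x" "w \<in> nbrs E a" unfolding x a using 2 dist by auto
        then have xw: "x \<notin> nbrs E w" "a \<in> nbrs E w" by (simp_all add: nbrs_sym[of _ w E] del: mem_Collect_eq)
        have bw: "b \<notin> nbrs E w" using bc 2 by (simp add: insert_commute)
        have "nbrs (insert {b, c} ?E) w = insert b (nbrs E w - {a})"
          using nbrs_insert(3)[OF c(2), of ?E] w2 2 xw by auto
        moreover have "card (insert b (nbrs E w - {a})) = Suc (card (nbrs E w - {a}))"
          using wfin bw by (intro card_insert_disjoint) auto
        moreover have "card (nbrs E w - {a}) = card (nbrs E w) - 1" using xw wfin by simp
        ultimately show ?thesis using w(2) wbig by simp
      next
        case 3
        have "w \<in> nbrs E x" "w \<in> nbrs E a" unfolding x a using 3 by auto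
        then have xw: "x \<in> nbrs E w" "a \<in> nbrs E w" by (simp_all add: nbrs_sym[of _ w E] del: mem_Collect_eq)
        let ?M = "nbrs E w - {x} - {a}"
        have aM: "a \<in> nbrs E w - {x}" using xw(2) inV(4) by blast
        have cw: "c \<notin> nbrs E w" using bc 3 by simp
        have "nbrs (insert {b, c} ?E) w = insert c ?M"
          using nbrs_insert(2)[OF c(2), of ?E] w2 3 by simp
        moreover have "card (insert c ?M) = Suc (card ?M)"
          using wfin cw by (intro card_insert_disjoint) auto
        moreover have "card ?M = card (nbrs E w) - 2"
        proof -
          have "card ?M = card (nbrs E w - {x}) - 1" using aM by (rule card_Diff_singleton)
          also have "card (nbrs E w - {x}) = card (nbrs E w) - 1" using xw(1) by (rule card_Diff_singleton)
          finally show ?thesis by simp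
        qed
        ultimately have "card ?M = 1" using w(2) wbig by simp
        then obtain d where d: "?M = {d}" by (auto simp: card_1_singleton_iff)
        have "nbrs E w = insert x (insert a ?M)" using insert_Diff[OF xw(1)] insert_Diff[OF aM] by simp
        then have "nbrs E w = {x, a, d}" unfolding d .
        then have b: "nbrs E b = {x, a, d}" using 3 by simp
        have bd: "{b, d} \<in> E" using b by auto
        have "d \<noteq> c" "d \<noteq> x" "d \<noteq> a" using d cw by auto
        then have "distinct [x, a, b, c, d]" using dist D(4)[OF bd] by auto
        then show ?thesis using typed_extremal_ladder[OF G x a b] y False by auto
      qed
    qed
  qed
qed

section \<open>The main induction and its conclusion\<close>

text \<open>The vertex \<open>x\<close> varies in the induction because a leaf hands over to its
  neighbour and the diamond hands over from \<open>x\<close> to \<open>c\<close>; the latter deletes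
  two vertices at once.\<close>

theorem outerplanar_typed_extremal:
  assumes "outerplanar_graph V E" "x \<in> V" "y \<in> V" "x \<noteq> y"
  shows "typed_extremal V E x y"
  using assms
proof (induction "card V" arbitrary: V E x rule: less_induct)
  case less
  note G = less.prems(1) and D = outerplanar_graphD[OF less.prems(1)]
  show ?case
  proof (cases "\<exists>v\<in>V - {x, y}. card (nbrs E v) \<le> 2")
    case True
    then obtain v where v: "v \<in> V" "v \<noteq> x" "v \<noteq> y" "card (nbrs E v) \<le> 2" by blast
    have "typed_extremal (V - {v}) (del E v) x y"
      by (rule less.hyps[OF card_Diff1_less[OF D(1) v(1)] outerplanar_graph_del[OF G]]) (use v less.prems in auto)
    then show ?thesis by (rule typed_extremal_remove[OF G v(4,2,3)])
  next
    case False
    then have min: "\<not> card (nbrs E v) \<le> 2" if "v \<in> V" "v \<notin> {x, y}" for v using that by blast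
    show ?thesis
    proof (cases "{x, y} \<in> E")
      case True
      then show ?thesis by (rule typed_extremal_adjacent[OF G])
    next
      case nxy: False
      have small: "card (V - {x}) < card V" by (rule card_Diff1_less[OF D(1) less.prems(2)])
      note G1 = outerplanar_graph_del[OF G, of x]
      have "V - {y} \<noteq> {}" using less.prems by blast
      \<comment> \<open>All vertices other than \<open>x\<close> and \<open>y\<close> have degree at
        least 3, so the low-degree vertex away from \<open>y\<close> must be
        \<open>x\<close>.\<close>
      then obtain w where "w \<in> V - {y}" "card (nbrs E w) \<le> 2"
        using low_degree_vertex_avoiding(1)[OF G, of y] by blast
      then have low: "card (nbrs E x) \<le> 2" using min[of w] by auto
      show ?thesis
      proof (cases rule: card_le_2E[OF low D(6)])
        case 1
        then show ?thesis by (rule typed_extremal_isolated[OF G _ less.prems(4,3)])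
      next
        case (2 a)
        then have xa: "{x, a} \<in> E" by auto
        then have a: "a \<in> V - {x}" "a \<noteq> y" using D(4)[OF xa] nxy by auto
        have "typed_extremal (V - {x}) (del E x) a y"
          by (rule less.hyps[OF small G1]) (use a less.prems in auto)
        then show ?thesis by (rule typed_extremal_leaf[OF G 2 less.prems(4) a(2) less.prems(3)])
      next
        case (3 a b)
        then have xa: "{x, a} \<in> E" "{x, b} \<in> E" by auto
        have y: "y \<notin> {x, a, b}" using xa nxy less.prems(4) by auto
        have IH: "typed_extremal (V - {x} - {u}) (del (del E x) u) c y"
          if u: "u \<in> V - {x}" "u \<noteq> y" and c: "c \<in> V - {x} - {u}" "c \<noteq> y" for u c
        proof (rule less.hyps[OF _ outerplanar_graph_del[OF G1]])
          show "card (V - {x} - {u}) < card V"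
            using small card_Diff1_less[of "V - {x}" u] D(1) u(1) by simp
        qed (use u c less.prems in auto)
        have G2: "outerplanar_graph (V - {x}) (insert {a, b} (del E x))"
          by (rule outerplanar_graph_smooth[OF G xa 3(2)])
        have aV: "a \<in> V - {x}" "b \<in> V - {x}" using D(4)[OF xa(1)] D(4)[OF xa(2)] by auto
        \<comment> \<open>Smoothing \<open>x\<close> changes the neighbours of \<open>a\<close> and
          \<open>b\<close> only, so the low-degree vertex of the smoothed graph is one of these
          two.\<close>
        obtain w where w: "w \<in> V - {x} - {y}" "card (nbrs (insert {a, b} (del E x)) w) \<le> 2"
          using low_degree_vertex_avoiding(1)[OF G2, of y] aV y by blast
        have "w \<in> {a, b}"
        proof (rule ccontr)
          assume nw: "w \<notin> {a, b}"
          then have "w \<notin> nbrs E x" using 3(1) by simp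
          then have "x \<notin> nbrs E w" by (simp add: nbrs_sym[of _ w E] del: mem_Collect_eq)
          then have "nbrs (insert {a, b} (del E x)) w = nbrs E w"
            using nbrs_insert(1)[OF nw, of "del E x"] nbrs_del[of x w E] w(1) by auto
          then show False using min[of w] w by auto
        qed
        then consider "w = a" | "w = b" by blast
        then show ?thesis
        proof cases
          case 1
          show ?thesis
            by (rule typed_extremal_ear[OF G 3 y less.prems(3) min]) (use w 1 IH[OF aV(1)] y in auto)
        next
          case 2
          have ba: "nbrs E x = {b, a}" "b \<noteq> a" and y': "y \<notin> {x, b, a}" using 3 y by auto
          show ?thesis
            by (rule typed_extremal_ear[OF G ba y' less.prems(3) min])
              (use w 2 IH[OF aV(2)] y in \<open>auto simp: insert_commute\<close>)
        qed
      qed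
    qed
  qed
qed

theorem theorem1p4:
  fixes V :: "'a set" and E :: "'a set set" and D :: "('a \<times> 'a) set"
    and x y :: 'a and v :: "nat \<Rightarrow> 'a" and n :: nat
  assumes "simple_graph V E"
    and "outerplanar V E"
    and "V = {x, y} \<union> v ` {1..n}"
    and "x \<noteq> y" and "inj_on v {1..n}" and "x \<notin> v ` {1..n}" and "y \<notin> v ` {1..n}"
    and "orientation_of D E"
  shows "\<exists>(\<beta>::nat) (\<gamma>::nat) (\<alpha>::nat \<Rightarrow> nat).
           mcoeff (graph_polynomial D)
             (var_pow x \<beta> + var_pow y \<gamma> + (\<Sum>i=1..n. var_pow (v i) (\<alpha> i))) \<noteq> 0 \<and>
           (\<forall>i\<in>{1..n}. \<alpha> i \<le> 2) \<and> \<beta> \<le> 1 \<and> \<gamma> \<le> 1 \<and>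
           ((\<forall>C. proper_3_colouring V E C \<longrightarrow> C x = C y) \<longrightarrow> \<beta> = 1 \<and> \<gamma> = 1) \<and>
           ((\<forall>C. proper_3_colouring V E C \<longrightarrow> C x \<noteq> C y) \<longrightarrow> \<beta> + \<gamma> = 1) \<and>
           (\<not> (\<forall>C. proper_3_colouring V E C \<longrightarrow> C x = C y) \<and>
            \<not> (\<forall>C. proper_3_colouring V E C \<longrightarrow> C x \<noteq> C y) \<longrightarrow> \<beta> = 0 \<and> \<gamma> = 0)"
proof -
  have G: "outerplanar_graph V E" using assms(1,2) unfolding outerplanar_graph_def by simp
  have xy: "x \<in> V" "y \<in> V" using assms(3) by auto
  obtain k where k: "extremal (graph_poly E) x y k" and type: "colour_type V E x y k"
    using outerplanar_typed_extremal[OF G xy assms(4)] unfolding typed_extremal_def by blast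
  have sg: "sign_eq (graph_polynomial D) (graph_poly E)"
    by (rule graph_polynomial_sign_eq_graph_poly[OF assms(8) outerplanar_graphD(5)[OF G]])
  obtain m where m: "\<forall>u. expo m u \<le> 2" "expo m x = 0" "expo m y = 0" "pattern k (coeffs_at (graph_poly E) m x y)"
    and mf: "\<forall>v. free_of v (graph_poly E) \<longrightarrow> expo m v = 0"
    using extremalD[OF k] by blast
  have outside: "expo m u = 0" if "u \<notin> V" for u
  proof -
    have "free_of u (graph_poly E)"
      using outerplanar_graphD(3,5)[OF G] that by (intro free_of_graph_poly) auto
    then show ?thesis using mf by blast
  qed
  \<comment> \<open>The exponents of \<open>m\<close> vanish at \<open>x\<close>, at
    \<open>y\<close> and off \<open>V\<close>, so \<open>m\<close> is determined by its exponents at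
    the \<open>v i\<close>; injectivity of \<open>v\<close> ensures that each is counted
    once.\<close>
  have m_sum: "(\<Sum>i=1..n. var_pow (v i) (expo m (v i))) = m"
  proof (rule poly_mapping_eqI)
    fix u
    have "expo (\<Sum>i=1..n. var_pow (v i) (expo m (v i))) u = (\<Sum>i=1..n. if u = v i then expo m (v i) else 0)"
      by (simp add: lookup_sum expo_var_pow)
    also have "\<dots> = expo m u"
    proof (cases "u \<in> v ` {1..n}")
      case True
      then obtain j where j: "j \<in> {1..n}" "u = v j" by blast
      have "(\<Sum>i=1..n. if u = v i then expo m (v i) else 0) = (\<Sum>i=1..n. if i = j then expo m u else 0)"
        using j inj_onD[OF assms(5)] by (intro sum.cong) auto
      then show ?thesis using j by simp
    next
      case False
      then have "(\<Sum>i=1..n. if u = v i then expo m (v i) else 0) = 0" by (intro sum.neutral) auto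
      moreover have "expo m u = 0" using False m(2,3) outside[of u] assms(3) by (cases "u \<in> V") auto
      ultimately show ?thesis by simp
    qed
    finally show "expo (\<Sum>i=1..n. var_pow (v i) (expo m (v i))) u = expo m u" .
  qed
  have nonzero: "mcoeff (graph_polynomial D)
      (var_pow x \<beta> + var_pow y \<gamma> + (\<Sum>i=1..n. var_pow (v i) (expo m (v i)))) \<noteq> 0"
    if "coeffs_at (graph_poly E) m x y \<beta> \<gamma> \<noteq> 0" for \<beta> \<gamma>
  proof -
    have "var_pow x \<beta> + var_pow y \<gamma> + m = m + var_pow x \<beta> + var_pow y \<gamma>" by (simp only: add_ac)
    then show ?thesis using that sign_eq_mcoeff[OF sg] unfolding m_sum coeffs_at_def by auto
  qed
  \<comment> \<open>A colouring exists, so \<open>x\<close> and \<open>y\<close> cannot both always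
    agree and always differ; the exponents required in these two cases are incompatible.\<close>
  obtain C0 where C0: "proper_3_colouring V E C0" using outerplanar_3_colourable[OF G] by blast
  have main: "\<exists>\<beta> \<gamma>. coeffs_at (graph_poly E) m x y \<beta> \<gamma> \<noteq> 0 \<and> \<beta> \<le> 1 \<and> \<gamma> \<le> 1 \<and>
      ((\<forall>C. proper_3_colouring V E C \<longrightarrow> C x = C y) \<longrightarrow> \<beta> = 1 \<and> \<gamma> = 1) \<and>
      ((\<forall>C. proper_3_colouring V E C \<longrightarrow> C x \<noteq> C y) \<longrightarrow> \<beta> + \<gamma> = 1) \<and>
      (\<not> (\<forall>C. proper_3_colouring V E C \<longrightarrow> C x = C y) \<and>
       \<not> (\<forall>C. proper_3_colouring V E C \<longrightarrow> C x \<noteq> C y) \<longrightarrow> \<beta> = 0 \<and> \<gamma> = 0)"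
  proof -
    consider "k = 0" | "k = 1" | "k = 2" using type unfolding colour_type_def by blast
    then show ?thesis
    proof cases
      case 1
      have "coeffs_at (graph_poly E) m x y 0 0 \<noteq> 0" using m(4) 1 unfolding pattern_def by auto
      moreover have "\<not> (\<forall>C. proper_3_colouring V E C \<longrightarrow> C x = C y)" "\<not> (\<forall>C. proper_3_colouring V E C \<longrightarrow> C x \<noteq> C y)"
        using type 1 unfolding colour_type_def by auto
      ultimately show ?thesis by (intro exI[of _ 0]) simp
    next
      case 2
      have "coeffs_at (graph_poly E) m x y 1 0 \<noteq> 0" using m(4) 2 unfolding pattern_def by auto
      moreover have all: "\<forall>C. proper_3_colouring V E C \<longrightarrow> C x \<noteq> C y"
        using type 2 unfolding colour_type_def by auto
      moreover have "\<not> (\<forall>C. proper_3_colouring V E C \<longrightarrow> C x = C y)" using all C0 by blast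
      ultimately show ?thesis by (intro exI[of _ 1] exI[of _ 0]) simp
    next
      case 3
      \<comment> \<open>Of the three terms of the form for \<open>k = 2\<close>, the middle one is
        the only one with both exponents at most 1.\<close>
      have "coeffs_at (graph_poly E) m x y 1 1 \<noteq> 0" using m(4) 3 unfolding pattern_def by auto
      moreover have all: "\<forall>C. proper_3_colouring V E C \<longrightarrow> C x = C y"
        using type 3 unfolding colour_type_def by auto
      moreover have "\<not> (\<forall>C. proper_3_colouring V E C \<longrightarrow> C x \<noteq> C y)" using all C0 by blast
      ultimately show ?thesis by (intro exI[of _ 1]) simp
    qed
  qed
  then obtain \<beta> \<gamma> where "coeffs_at (graph_poly E) m x y \<beta> \<gamma> \<noteq> 0" and rest: "\<beta> \<le> 1 \<and> \<gamma> \<le> 1 \<and>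
      ((\<forall>C. proper_3_colouring V E C \<longrightarrow> C x = C y) \<longrightarrow> \<beta> = 1 \<and> \<gamma> = 1) \<and>
      ((\<forall>C. proper_3_colouring V E C \<longrightarrow> C x \<noteq> C y) \<longrightarrow> \<beta> + \<gamma> = 1) \<and>
      (\<not> (\<forall>C. proper_3_colouring V E C \<longrightarrow> C x = C y) \<and>
       \<not> (\<forall>C. proper_3_colouring V E C \<longrightarrow> C x \<noteq> C y) \<longrightarrow> \<beta> = 0 \<and> \<gamma> = 0)" by blast
  moreover have "\<forall>i\<in>{1..n}. expo m (v i) \<le> 2" using m(1) by blast
  ultimately show ?thesis
    using nonzero by (intro exI[of _ \<beta>] exI[of _ \<gamma>] exI[of _ "\<lambda>i. expo m (v i)"]) blast
qed

end
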